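(* Let $\alpha = 2-\sqrt{3}$, $p = \frac{1-\alpha}{2}$ and $\varepsilon < \frac{1}{3}$ (with $\varepsilon>0$). Then \textsc{ParKnapsack}$(\mathcal{N}, f, \varepsilon, \alpha, p, B)$ is a $(9.465+\varepsilon)$-approximation algorithm for maximizing $f(T)$ subject to $c(T)\le B$, with adaptive complexity $O(\frac{1}{\varepsilon}\log n)$ and query complexity $O(\frac{n^2}{\varepsilon^3}\log^2 n\,\log\frac{1}{\varepsilon})$.
   Context: Problem setting: $\mathcal{N}$ is a finite ground set with $|\mathcal{N}|=n$; $f:2^{\mathcal{N}}\to\mathbb{R}$ is non-negative and submodular (not necessarily monotone), where $f(S\,|\,T)=f(S\cup T)-f(T)$, $f(x\,|\,T)=f(\{x\}\,|\,T)$, and submodularity means $f(x\,|\,T)\le f(x\,|\,S)$ for all $S\subseteq T$, $x\notin T$. A cost function $c:\mathcal{N}\to\mathbb{R}_{>0}$ is extended additively, $c(S)=\sum_{x\in S}c(x)$, and $B>0$ is a budget; it is assumed throughout that $\max_{x\in\mathcal{N}}c(x)\le B$. Let $OPT=\max\{f(T): T\subseteq\mathcal{N}, c(T)\le B\}$. A (randomized) algorithm is a $\beta$-approximation if $\beta\cdot\mathbb{E}[f(\text{output})]\ge OPT$. The function $f$ is accessed only by value queries (an oracle returning $f(S)$ for any $S$); the query complexity is the total number of value queries, and the adaptive complexity is the number of sequential rounds, where in each round polynomially many queries are issued in parallel and may depend only on answers to queries of earlier rounds. Logarithms are natural. \textsc{SampleSeq}$(S,X,B)$: set $A\leftarrow[\,]$;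 while $X\neq\emptyset$: draw $a$ uniformly at random from $X$, append $a$ to $A$, and set $X\leftarrow\{x\in X\setminus\{a\}: c(x)+c(A)+c(S)\le B\}$. Return $A=[a_1,\dots,a_d]$. \textsc{ThreshSeq}$(X,\tau,\varepsilon,\ell,B)$ (with $\tau>0$, $\varepsilon\in(0,1)$): set $S\leftarrow\emptyset$, $\mathrm{ctr}\leftarrow0$, $X\leftarrow\{x\in X: f(x)\ge\tau c(x)\}$. While $X\neq\emptyset$ and $\mathrm{ctr}<\ell$: let $[a_1,\dots,a_d]\leftarrow$\textsc{SampleSeq}$(S,X,B)$; for $i=1,\dots,d$ let $A_i=\{a_1,\dots,a_i\}$, $X_i=\{a\in X\setminus A_i: c(a)+c(S\cup A_i)\le B\}$, $G_i=\{a\in X_i: f(a\,|\,S\cup A_i)\ge\tau c(a)\}$, $E_i=\{a\in X_i: f(a\,|\,S\cup A_i)<0\}$; let $i^*=\min\{i: c(G_i)\le(1-\varepsilon)c(X)\}$, $j^*=\min\{j: \varepsilon\sum_{x\in G_j}f(x\,|\,S\cup A_j)\le\sum_{x\in E_j}|f(x\,|\,S\cup A_j)|\}$, $k^*=\min\{i^*,j^*\}$; set $S\leftarrow S\cup A_{k^*}$, $X\leftarrow G_{k^*}$, and if $j^*<i^*$ increase $\mathrm{ctr}$ by 1. Return $S$. \textsc{SubmodMax}$(\mathcal{N}',\delta)$ is an unconstrained submodular maximization subroutine which returns a (random) set $S\subseteq\mathcal{N}'$ with $(2+\delta)\,f(S)\ge\max_{T\subseteq\mathcal{N}'}f(T)$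 (in expectation), using $O(\frac1\delta\log\frac1\delta)$ adaptive rounds and $O(|\mathcal{N}'|)$ queries (e.g. the algorithm of Fahrbach–Karbasi / Feldman et al.). \textsc{ParKnapsack}$(\mathcal{N},f,\varepsilon,\alpha,p,B)$: let $\mathcal{N}_-=\{x\in\mathcal{N}: c(x)<B/n\}$, $\mathcal{N}_+=\mathcal{N}\setminus\mathcal{N}_-$; let $x^*\in\arg\max_{x\in\mathcal{N}_+}f(x)$ and $\hat\tau=\alpha n f(x^* )/B$; let $\hat\varepsilon=\varepsilon/125$, $\ell=\hat\varepsilon^{-2}$, $k=\hat\varepsilon^{-1}\log n$; let $S_-\leftarrow$\textsc{SubmodMax}$(\mathcal{N}_-,\hat\varepsilon)$; let $H$ contain each element of $\mathcal{N}_+$ independently with probability $p$; for $i=0,1,\dots,k$ (in parallel) let $\tau_i=\hat\tau(1-\hat\varepsilon)^i$ and for $j=1,\dots,\hat\varepsilon^{-1}\log(\hat\varepsilon^{-1})$ (in parallel, independent runs) let $S^i_j\leftarrow$\textsc{ThreshSeq}$(H,\tau_i,\hat\varepsilon,\ell,B)$. Return the set of largest $f$-value among all $S^i_j$, $\{x^*\}$ and $S_-$. *)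

theory Defs
  imports "HOL-Probability.Probability"
begin

section \<open>Submodular maximization under a knapsack constraint\<close>

definition marginal :: "('a set \<Rightarrow> real) \<Rightarrow> 'a set \<Rightarrow> 'a set \<Rightarrow> real" where
  "marginal f S T = f (S \<union> T) - f T"

definition submodular_on :: "'a set \<Rightarrow> ('a set \<Rightarrow> real) \<Rightarrow> bool" where
  "submodular_on N f \<longleftrightarrow>
     (\<forall>S T x. S \<subseteq> T \<and> T \<subseteq> N \<and> x \<in> N - T \<longrightarrow> marginal f {x} T \<le> marginal f {x} S)"

definition nonneg_on :: "'a set \<Rightarrow> ('a set \<Rightarrow> real) \<Rightarrow> bool" where
  "nonneg_on N f \<longleftrightarrow> (\<forall>S \<subseteq> N. 0 \<le> f S)"

definition knapsack_instance ::
  "'a set \<Rightarrow> ('a set \<Rightarrow> real) \<Rightarrow> ('a \<Rightarrow> real) \<Rightarrow> real \<Rightarrow> bool" where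
  "knapsack_instance N f c B \<longleftrightarrow>
     finite N \<and> nonneg_on N f \<and> submodular_on N f \<and> 0 < B \<and> (\<forall>x\<in>N. 0 < c x \<and> c x \<le> B)"

definition feasible_sets :: "'a set \<Rightarrow> ('a \<Rightarrow> real) \<Rightarrow> real \<Rightarrow> 'a set set" where
  "feasible_sets N c B = {T. T \<subseteq> N \<and> sum c T \<le> B}"

definition OPT :: "'a set \<Rightarrow> ('a set \<Rightarrow> real) \<Rightarrow> ('a \<Rightarrow> real) \<Rightarrow> real \<Rightarrow> real" where
  "OPT N f c B = Max (f ` feasible_sets N c B)"

section \<open>Randomized algorithms with value queries\<close>

text \<open>
  An algorithm maps the value oracle to the joint distribution of its result, the number of
  adaptive rounds and the number of value queries.  The algorithms below are built from the
  following combinators only and never mention the oracle itself, so they learn about it only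
  through \<open>ask\<close>, which issues a set of queries in parallel in a single round and reveals the
  oracle on these sets and nowhere else.
\<close>

type_synonym ('a, 'r) qalg = "('a set \<Rightarrow> real) \<Rightarrow> ('r \<times> nat \<times> nat) pmf"

definition qreturn :: "'r \<Rightarrow> ('a, 'r) qalg" where
  "qreturn x = (\<lambda>f. return_pmf (x, 0, 0))"

definition draw :: "'r pmf \<Rightarrow> ('a, 'r) qalg" where
  "draw P = (\<lambda>f. map_pmf (\<lambda>x. (x, 0, 0)) P)"

definition ask :: "'a set set \<Rightarrow> ('a, 'a set \<Rightarrow> real) qalg" where
  "ask Q = (\<lambda>f. return_pmf (restrict f Q, 1, card Q))"

definition qbind :: "('a, 'r) qalg \<Rightarrow> ('r \<Rightarrow> ('a, 's) qalg) \<Rightarrow> ('a, 's) qalg"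
    (infixl \<open>\<bind>\<^sub>q\<close> 54) where
  "(m \<bind>\<^sub>q k) = (\<lambda>f. bind_pmf (m f) (\<lambda>(x, r, q).
     map_pmf (\<lambda>(y, r', q'). (y, r + r', q + q')) (k x f)))"

text \<open>Independent parallel runs: rounds are shared, queries add up.\<close>

fun par :: "('a, 'r) qalg list \<Rightarrow> ('a, 'r list) qalg" where
  "par [] = qreturn []"
| "par (m # ms) = (\<lambda>f. bind_pmf (m f) (\<lambda>(x, r, q).
     map_pmf (\<lambda>(xs, r', q'). (x # xs, max r r', q + q')) (par ms f)))"

definition outcomes :: "('a, 'r) qalg \<Rightarrow> ('a set \<Rightarrow> real) \<Rightarrow> ('r \<times> nat \<times> nat) set" where
  "outcomes m f = set_pmf (m f)"

definition output_set :: "('a, 'r) qalg \<Rightarrow> ('a set \<Rightarrow> real) \<Rightarrow> 'r set" where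
  "output_set m f = fst ` outcomes m f"

definition expected_value :: "('a, 'a set) qalg \<Rightarrow> ('a set \<Rightarrow> real) \<Rightarrow> real" where
  "expected_value m f = measure_pmf.expectation (map_pmf fst (m f)) f"

lemma qbind_cong [fundef_cong]:
  assumes "m = m'" "\<And>x. x \<in> (\<Union>f. output_set m' f) \<Longrightarrow> k x = k' x"
  shows "(m \<bind>\<^sub>q k) = (m' \<bind>\<^sub>q k')"
  unfolding qbind_def assms(1)
  by (rule ext, rule bind_pmf_cong[OF refl])
     (force simp: output_set_def outcomes_def split_beta intro!: assms(2)
        arg_cong[where f = "map_pmf _"] fun_cong[where f = "k _"])

text \<open>
  A \<open>\<beta>\<close>-approximation algorithm always returns a feasible set.
\<close>

definition approximation_algorithm ::
  "real \<Rightarrow> ('a, 'a set) qalg \<Rightarrow> 'a set \<Rightarrow> ('a set \<Rightarrow> real) \<Rightarrow> ('a \<Rightarrow> real) \<Rightarrow> real \<Rightarrow> bool" where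
  "approximation_algorithm \<beta> m N f c B \<longleftrightarrow>
     output_set m f \<subseteq> feasible_sets N c B \<and> \<beta> * expected_value m f \<ge> OPT N f c B"

text \<open>
  Specification of an unconstrained submodular maximization subroutine.  The range of \<open>\<delta>\<close> keeps
  \<open>ln (1 / \<delta>)\<close> away from 0, and \<open>max 1\<close> leaves room for constantly many queries on the empty
  ground set.
\<close>

definition is_submod_max :: "('a set \<Rightarrow> real \<Rightarrow> ('a, 'a set) qalg) \<Rightarrow> bool" where
  "is_submod_max submod_max \<longleftrightarrow> (\<exists>K > 0. \<forall>N \<delta> f.
     finite N \<and> nonneg_on N f \<and> submodular_on N f \<and> 0 < \<delta> \<and> \<delta> \<le> 1 / 2 \<longrightarrow>
       output_set (submod_max N \<delta>) f \<subseteq> Pow N \<and>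
       (2 + \<delta>) * expected_value (submod_max N \<delta>) f \<ge> Max (f ` Pow N) \<and>
       (\<forall>(S, r, q) \<in> outcomes (submod_max N \<delta>) f.
          real r \<le> K * (1 / \<delta> * ln (1 / \<delta>)) \<and> real q \<le> K * max 1 (real (card N))))"

section \<open>The algorithms\<close>

text \<open>The argument \<open>A\<close> accumulates the sequence; it starts as \<open>[]\<close>.\<close>

function sample_seq ::
  "('a \<Rightarrow> real) \<Rightarrow> real \<Rightarrow> 'a set \<Rightarrow> 'a list \<Rightarrow> 'a set \<Rightarrow> 'a list pmf" where
  "sample_seq c B S A X =
     (if finite X \<and> X \<noteq> {} then
        bind_pmf (pmf_of_set X) (\<lambda>a.
          sample_seq c B S (A @ [a])
            {x \<in> X - {a}. c x + sum c (set (A @ [a])) + sum c S \<le> B})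
      else return_pmf A)"
  by pat_completeness auto
termination
  by (relation "Wellfounded.measure (\<lambda>(c, B, S, A, X). card X)")
     (auto intro!: psubset_card_mono)

declare sample_seq.simps [simp del]

definition prefix_set :: "'a list \<Rightarrow> nat \<Rightarrow> 'a set" where
  "prefix_set A i = set (take i A)"

definition X_set ::
  "('a \<Rightarrow> real) \<Rightarrow> real \<Rightarrow> 'a set \<Rightarrow> 'a set \<Rightarrow> 'a list \<Rightarrow> nat \<Rightarrow> 'a set" where
  "X_set c B S X A i =
     {a \<in> X - prefix_set A i. c a + sum c (S \<union> prefix_set A i) \<le> B}"

definition G_set ::
  "('a set \<Rightarrow> real) \<Rightarrow> ('a \<Rightarrow> real) \<Rightarrow> real \<Rightarrow> real \<Rightarrow> 'a set \<Rightarrow> 'a set \<Rightarrow> 'a list \<Rightarrow> nat \<Rightarrow> 'a set"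
  where
  "G_set v c B \<tau> S X A i =
     {a \<in> X_set c B S X A i. marginal v {a} (S \<union> prefix_set A i) \<ge> \<tau> * c a}"

definition E_set ::
  "('a set \<Rightarrow> real) \<Rightarrow> ('a \<Rightarrow> real) \<Rightarrow> real \<Rightarrow> 'a set \<Rightarrow> 'a set \<Rightarrow> 'a list \<Rightarrow> nat \<Rightarrow> 'a set" where
  "E_set v c B S X A i =
     {a \<in> X_set c B S X A i. marginal v {a} (S \<union> prefix_set A i) < 0}"

text \<open>
  The two minima range over the indices \<open>1, \<dots>, d\<close>.  The last index \<open>d\<close> always satisfies both
  conditions, because the candidate set at \<open>d\<close> is empty (lemma \<open>X_set_last\<close> below); inserting it
  explicitly only makes the minima total functions of their arguments.
\<close>

definition i_star ::
  "('a set \<Rightarrow> real) \<Rightarrow> ('a \<Rightarrow> real) \<Rightarrow> real \<Rightarrow> real \<Rightarrow> real \<Rightarrow> 'a set \<Rightarrow> 'a set \<Rightarrow> 'a list \<Rightarrow> nat" where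
  "i_star v c B \<tau> \<epsilon> S X A = Min (insert (length A)
     {i \<in> {1..length A}. sum c (G_set v c B \<tau> S X A i) \<le> (1 - \<epsilon>) * sum c X})"

definition j_star ::
  "('a set \<Rightarrow> real) \<Rightarrow> ('a \<Rightarrow> real) \<Rightarrow> real \<Rightarrow> real \<Rightarrow> real \<Rightarrow> 'a set \<Rightarrow> 'a set \<Rightarrow> 'a list \<Rightarrow> nat" where
  "j_star v c B \<tau> \<epsilon> S X A = Min (insert (length A)
     {j \<in> {1..length A}.
        \<epsilon> * (\<Sum>x \<in> G_set v c B \<tau> S X A j. marginal v {x} (S \<union> prefix_set A j))
        \<le> (\<Sum>x \<in> E_set v c B S X A j. \<bar>marginal v {x} (S \<union> prefix_set A j)\<bar>)})"

definition k_star ::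
  "('a set \<Rightarrow> real) \<Rightarrow> ('a \<Rightarrow> real) \<Rightarrow> real \<Rightarrow> real \<Rightarrow> real \<Rightarrow> 'a set \<Rightarrow> 'a set \<Rightarrow> 'a list \<Rightarrow> nat" where
  "k_star v c B \<tau> \<epsilon> S X A = min (i_star v c B \<tau> \<epsilon> S X A) (j_star v c B \<tau> \<epsilon> S X A)"

definition thresh_queries ::
  "('a \<Rightarrow> real) \<Rightarrow> real \<Rightarrow> 'a set \<Rightarrow> 'a set \<Rightarrow> 'a list \<Rightarrow> 'a set set" where
  "thresh_queries c B S X A =
     (\<Union>i \<in> {1..length A}. insert (S \<union> prefix_set A i)
        ((\<lambda>a. {a} \<union> (S \<union> prefix_set A i)) ` X_set c B S X A i))"

lemma sample_seq_support:
  assumes "A' \<in> set_pmf (sample_seq c B S A X)" "finite X"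
  shows "\<exists>zs. A' = A @ zs \<and> set zs \<subseteq> X \<and> (X \<noteq> {} \<longrightarrow> zs \<noteq> []) \<and>
     ((\<forall>x\<in>X. 0 < c x) \<longrightarrow>
        (\<forall>x\<in>X. x \<in> set zs \<or> c x + sum c (set A') + sum c S > B))"
  using assms
proof (induction c B S A X rule: sample_seq.induct)
  case (1 c B S A X)
  show ?case
  proof (cases "X = {}")
    case True
    then show ?thesis using 1 by (simp add: sample_seq.simps)
  next
    case False
    let ?X = "\<lambda>a. {x \<in> X - {a}. c x + sum c (set (A @ [a])) + sum c S \<le> B}"
    from 1(2) False 1(3) obtain a where a: "a \<in> X"
      "A' \<in> set_pmf (sample_seq c B S (A @ [a]) (?X a))"
      by (subst (asm) sample_seq.simps) auto
    from 1(3) have "finite (?X a)" by simp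
    with 1(1)[of a] a False 1(3) obtain zs where zs:
      "A' = (A @ [a]) @ zs" "set zs \<subseteq> ?X a"
      "(\<forall>x\<in>?X a. 0 < c x) \<longrightarrow> (\<forall>x\<in>?X a. x \<in> set zs \<or> c x + sum c (set A') + sum c S > B)"
      by auto
    have "x \<in> set (a # zs) \<or> c x + sum c (set A') + sum c S > B"
      if pos: "\<forall>x\<in>X. 0 < c x" and x: "x \<in> X" for x
    proof (cases "x = a \<or> x \<in> ?X a")
      case True
      then show ?thesis using zs pos by auto
    next
      case out: False
      have "sum c (set (A @ [a])) \<le> sum c (set A')"
      proof (rule sum_mono2)
        show "0 \<le> c b" if "b \<in> set A' - set (A @ [a])" for b
          using that zs(1,2) pos by (force intro: less_imp_le)
      qed (use zs in auto)
      then show ?thesis using out x by auto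
    qed
    moreover have "A' = A @ a # zs" "set (a # zs) \<subseteq> X" using zs a by auto
    ultimately show ?thesis by blast
  qed
qed

lemma X_set_last:
  assumes "A \<in> set_pmf (sample_seq c B S [] X)" "finite X" "finite S" "S \<inter> X = {}"
    "\<forall>x\<in>X. 0 < c x"
  shows "X_set c B S X A (length A) = {}"
proof -
  from sample_seq_support[OF assms(1,2)] assms(5)
  have *: "set A \<subseteq> X" "\<forall>x\<in>X. x \<in> set A \<or> c x + sum c (set A) + sum c S > B" by auto
  with assms(3,4) have "sum c (S \<union> set A) = sum c S + sum c (set A)"
    by (intro sum.union_disjoint) auto
  with * show ?thesis by (force simp: X_set_def prefix_set_def)
qed

lemma k_star_pos: "A \<noteq> [] \<Longrightarrow> 1 \<le> k_star v c B \<tau> \<epsilon> S X A"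
  by (auto simp: k_star_def i_star_def j_star_def Suc_le_eq)

lemma G_set_psubset:
  assumes "A \<in> set_pmf (sample_seq c B S [] X)" "finite X" "X \<noteq> {}"
  shows "G_set v c B \<tau> S X A (k_star v c B \<tau> \<epsilon> S X A) \<subset> X"
proof -
  from sample_seq_support[OF assms(1,2)] assms(3)
  obtain a as where A: "A = a # as" "a \<in> X" by (cases A) auto
  with k_star_pos[of A v c B \<tau> \<epsilon> S X]
  have "a \<in> prefix_set A (k_star v c B \<tau> \<epsilon> S X A)"
    by (cases "k_star v c B \<tau> \<epsilon> S X A") (auto simp: prefix_set_def)
  with A(2) show ?thesis by (auto simp: G_set_def X_set_def)
qed

lemma output_draw: "output_set (draw P) f = set_pmf P"
  by (force simp: output_set_def outcomes_def draw_def)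

function thresh_loop ::
  "('a \<Rightarrow> real) \<Rightarrow> real \<Rightarrow> real \<Rightarrow> real \<Rightarrow> real \<Rightarrow> 'a set \<Rightarrow> nat \<Rightarrow> 'a set \<Rightarrow> ('a, 'a set) qalg" where
  "thresh_loop c B \<tau> \<epsilon> l S ctr X =
     (if finite X \<and> X \<noteq> {} \<and> real ctr < l then
        draw (sample_seq c B S [] X) \<bind>\<^sub>q (\<lambda>A.
        ask (thresh_queries c B S X A) \<bind>\<^sub>q (\<lambda>v.
        thresh_loop c B \<tau> \<epsilon> l
          (S \<union> prefix_set A (k_star v c B \<tau> \<epsilon> S X A))
          (if j_star v c B \<tau> \<epsilon> S X A < i_star v c B \<tau> \<epsilon> S X A then ctr + 1 else ctr)
          (G_set v c B \<tau> S X A (k_star v c B \<tau> \<epsilon> S X A))))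
      else qreturn S)"
  by pat_completeness auto
termination
  by (relation "Wellfounded.measure (\<lambda>(c, B, \<tau>, \<epsilon>, l, S, ctr, X). card X)")
     (simp_all add: output_draw psubset_card_mono G_set_psubset)

declare thresh_loop.simps [simp del]

definition thresh_seq ::
  "('a \<Rightarrow> real) \<Rightarrow> 'a set \<Rightarrow> real \<Rightarrow> real \<Rightarrow> real \<Rightarrow> real \<Rightarrow> ('a, 'a set) qalg" where
  "thresh_seq c X \<tau> \<epsilon> l B =
     ask ((\<lambda>x. {x}) ` X) \<bind>\<^sub>q (\<lambda>v.
     thresh_loop c B \<tau> \<epsilon> l {} 0 {x \<in> X. v {x} \<ge> \<tau> * c x})"

definition random_subset :: "real \<Rightarrow> 'a set \<Rightarrow> 'a set pmf" where
  "random_subset p X =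
     map_pmf (\<lambda>b. {x \<in> X. b x}) (Pi_pmf X False (\<lambda>_. bernoulli_pmf p))"

text \<open>
  The real-valued loop bounds are rounded up.  If every element is cheaper than \<open>B / n\<close>,
  there is no candidate for the best singleton, nothing to sample from, and the answer of the
  subroutine is returned.
\<close>

definition par_knapsack ::
  "('a set \<Rightarrow> real \<Rightarrow> ('a, 'a set) qalg) \<Rightarrow> ('a \<Rightarrow> real) \<Rightarrow>
   'a set \<Rightarrow> real \<Rightarrow> real \<Rightarrow> real \<Rightarrow> real \<Rightarrow> ('a, 'a set) qalg" where
  "par_knapsack submod_max c N \<epsilon> \<alpha> p B =
     (let n = real (card N);
          N_minus = {x \<in> N. c x < B / n};
          N_plus = N - N_minus;
          \<epsilon>' = \<epsilon> / 125;
          l = 1 / \<epsilon>'\<^sup>2;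
          k = nat \<lceil>1 / \<epsilon>' * ln n\<rceil>;
          m = nat \<lceil>1 / \<epsilon>' * ln (1 / \<epsilon>')\<rceil>
      in
        submod_max N_minus \<epsilon>' \<bind>\<^sub>q (\<lambda>S_minus.
        if N_plus = {} then qreturn S_minus else
        ask ((\<lambda>x. {x}) ` N_plus) \<bind>\<^sub>q (\<lambda>v.
        let x_star = arg_max_on (\<lambda>x. v {x}) N_plus;
            \<tau> = \<alpha> * n * v {x_star} / B
        in
          draw (random_subset p N_plus) \<bind>\<^sub>q (\<lambda>H.
          par [thresh_seq c H (\<tau> * (1 - \<epsilon>') ^ i) \<epsilon>' l B. i \<leftarrow> [0..<k + 1], j \<leftarrow> [1..<m + 1]]
            \<bind>\<^sub>q (\<lambda>Ss.
          let candidates = insert {x_star} (insert S_minus (set Ss)) in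
          ask candidates \<bind>\<^sub>q (\<lambda>w.
          qreturn (arg_max_on w candidates)))))))"

end

theory Submission
  imports Defs
begin

text \<open>
  Fix an optimal set and split it into its cheap elements, which the unconstrained subroutine
  handles, and its expensive ones.  A run of the threshold subroutine with threshold \<open>\<tau>\<close> has
  expected value at least about \<open>\<tau>\<close> times its expected cost, and whenever it leaves room for one
  more element of a set \<open>T\<close> of sampled elements, its value \<open>f S\<close> satisfies
  \<open>f (S \<union> T) \<le> (1 + \<epsilon>) * f S + \<tau> * c T\<close>.  Comparing two consecutive thresholds, one of which
  mostly leaves room while the other does not, bounds the value reached on a sample by
  the value and cost of \<open>T\<close> alone.

  It remains to average over the sample.  On the expensive part of the optimum, \<open>f\<close> dominates an
  additive function \<open>d\<close>, and the loss caused by sampled elements outside it is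
  dominated by an additive function of total at most 1.  Unless the best singleton or the cheap part is
  already good enough, all weights \<open>d x\<close> are small.  The ratio of value to cost in the bound is
  estimated by a tangent, the excess over the cap by the extremal binomial case, and a
  few numerical cases in the size of the largest weight give the constant.
\<close>

section \<open>Submodular functions\<close>

text \<open>With the expensive part of the optimum scaled to value 1, \<open>v\<close> the value of
  the cheap solution and the mean taken over the sample, the target is
  \<open>2 * v + 1 \<le> 9.465 * mean\<close>; the 2 is the loss of the unconstrained subroutine.
  Let \<open>w\<close> be the larger of \<open>v\<close> and the best singleton. Once
  \<open>7.465 * w \<ge> 1\<close>, the guaranteed value \<open>w\<close> is enough, so only
  \<open>w < 200 / 1493\<close> needs work. As \<open>w\<close> tends to 0 and the costs fill the
  budget, the ratio of sampled value to 1 plus sampled cost concentrates at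
  \<open>p / (1 + p)\<close>. The equation \<open>2 * p\<^sup>2 = 1 - 2 * p\<close> says that this
  equals \<open>\<alpha> = 1 - 2 * p\<close>, the factor in the cap set by the largest threshold.
  The difficulty is \<open>w\<close> of moderate size: the sampled value fluctuates above the cap,
  and the room to be left for one more element depends on the most expensive element used. That
  element is kept if its cost is small relative to \<open>w\<close>; otherwise it is dropped and
  only the second most expensive one needs room. Another obstacle is that \<open>f {}\<close> may be
  positive. The threshold runs never query the empty set, so its value can be replaced by 0 in their
  analysis.\<close>

lemma submodular_onD:
  "submodular_on N f \<Longrightarrow> S \<subseteq> T \<Longrightarrow> T \<subseteq> N \<Longrightarrow> x \<in> N - T \<Longrightarrow> marginal f {x} T \<le> marginal f {x} S"
  by (auto simp: submodular_on_def)

lemma submodular_on_subset: "submodular_on N f \<Longrightarrow> M \<subseteq> N \<Longrightarrow> submodular_on M f"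
  unfolding submodular_on_def by blast

lemma nonneg_on_subset: "nonneg_on N f \<Longrightarrow> M \<subseteq> N \<Longrightarrow> nonneg_on M f"
  unfolding nonneg_on_def by blast

lemma marginal_antimono_set:
  assumes sub: "submodular_on N f" and fin: "finite D"
    and "C \<subseteq> A" "A \<subseteq> N" "D \<subseteq> N" "D \<inter> A = {}"
  shows "marginal f D A \<le> marginal f D C"
  using fin assms(5,6)
proof (induction D)
  case empty
  then show ?case by (simp add: marginal_def)
next
  case (insert x D)
  have "marginal f {x} (D \<union> A) \<le> marginal f {x} (D \<union> C)"
    using insert.prems insert.hyps assms(3,4) by (intro submodular_onD[OF sub]) auto
  moreover have "marginal f D A \<le> marginal f D C"
    using insert by auto
  ultimately show ?case
    by (simp add: marginal_def)
qed

lemma submodular_union_inter: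
  assumes sub: "submodular_on N f" and "finite N" "A \<subseteq> N" "B \<subseteq> N"
  shows "f (A \<union> B) + f (A \<inter> B) \<le> f A + f B"
proof -
  have "marginal f (B - A) A \<le> marginal f (B - A) (A \<inter> B)"
    using assms by (intro marginal_antimono_set[OF sub]) (auto intro: finite_subset)
  moreover have "(B - A) \<union> A = A \<union> B" "(B - A) \<union> (A \<inter> B) = B" by auto
  ultimately show ?thesis by (simp add: marginal_def)
qed

lemma marginal_le_sum:
  assumes sub: "submodular_on N f" and fin: "finite D"
    and "A \<subseteq> N" "D \<subseteq> N" "D \<inter> A = {}"
  shows "marginal f D A \<le> (\<Sum>x\<in>D. marginal f {x} A)"
  using fin assms(4,5)
proof (induction D)
  case empty
  then show ?case by (simp add: marginal_def)
next
  case (insert x D)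
  have "marginal f {x} (D \<union> A) \<le> marginal f {x} A"
    using insert.prems insert.hyps assms(3) by (intro submodular_onD[OF sub]) auto
  moreover have "marginal f D A \<le> (\<Sum>x\<in>D. marginal f {x} A)"
    using insert by auto
  ultimately show ?case
    using insert.hyps by (simp add: marginal_def)
qed

text \<open>The initial filter of a threshold run tests \<open>f {x}\<close>, which is the marginal
  value of \<open>x\<close> only if the empty set has value 0. The runs cannot tell \<open>f\<close>
  from \<open>ground f\<close> (\<open>thresh_seq_ground\<close>).\<close>

definition ground :: "('a set \<Rightarrow> real) \<Rightarrow> 'a set \<Rightarrow> real" where
  "ground f S = (if S = {} then 0 else f S)"

lemma ground_empty [simp]: "ground f {} = 0"
  and ground_nonempty [simp]: "S \<noteq> {} \<Longrightarrow> ground f S = f S"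
  and ground_insert [simp]: "ground f (insert x S) = f (insert x S)"
  by (auto simp: ground_def)

lemma ground_le: "nonneg_on N f \<Longrightarrow> ground f S \<le> f S"
  by (auto simp: ground_def nonneg_on_def)

lemma nonneg_ground: "nonneg_on N f \<Longrightarrow> nonneg_on N (ground f)"
  by (auto simp: ground_def nonneg_on_def)

text \<open>Lowering the value at the empty set only raises the marginal values there, and these
  stand on the larger side of the inequality.\<close>

lemma submodular_ground:
  assumes "nonneg_on N f" "submodular_on N f"
  shows "submodular_on N (ground f)"
  unfolding submodular_on_def
proof (intro allI impI, elim conjE)
  fix S T x assume *: "S \<subseteq> T" "T \<subseteq> N" "x \<in> N - T"
  have "marginal f {x} T \<le> marginal f {x} S"
    using submodular_onD[OF assms(2)] * by blast
  moreover have "0 \<le> f {}" using assms(1) by (auto simp: nonneg_on_def)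
  ultimately show "marginal (ground f) {x} T \<le> marginal (ground f) {x} S"
    using * by (auto simp: marginal_def ground_def)
qed

text \<open>
  The weight of an element is its marginal value at the moment it is added; elements that would
  not increase the value are skipped, so that all weights are positive.
\<close>

lemma additive_minorant:
  assumes sub: "submodular_on N f" and fin: "finite A" and AN: "A \<subseteq> N" and f0: "f {} = 0"
  obtains P d where "P \<subseteq> A" "\<And>x. x \<in> P \<Longrightarrow> 0 < d x" "\<And>x. x \<in> P \<Longrightarrow> d x \<le> f {x}"
    "\<And>T. T \<subseteq> P \<Longrightarrow> sum d T \<le> f T" "f A \<le> sum d P"
proof -
  have "\<exists>P d. P \<subseteq> A \<and> (\<forall>x\<in>P. 0 < d x \<and> d x \<le> f {x}) \<and> (\<forall>T \<subseteq> P. sum d T \<le> f T) \<and> f A \<le> sum d P"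
    using fin AN
  proof (induction A)
    case empty
    then show ?case using f0 by (intro exI[of _ "{}"]) auto
  next
    case (insert x A)
    then obtain P d where Pd: "P \<subseteq> A" "\<forall>x\<in>P. 0 < d x \<and> d x \<le> f {x}"
      "\<forall>T \<subseteq> P. sum d T \<le> f T" "f A \<le> sum d P" by auto
    have fP: "finite P" using Pd(1) insert.hyps(1) finite_subset by auto
    have xP: "x \<notin> P" using Pd insert by auto
    define m where "m = marginal f {x} A"
    \<comment> \<open>The marginal value over all of \<open>A\<close> bounds the one over each
      subset from below. This makes the weights a minorant on every subset of \<open>P\<close>, not
      only along the order of insertion.\<close>
    have m_le: "m \<le> marginal f {x} T" if "T \<subseteq> A" for T
      unfolding m_def using that insert.prems insert.hyps by (intro submodular_onD[OF sub]) auto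
    show ?case
    proof (cases "m \<le> 0")
      case True
      then have "f (insert x A) \<le> f A" by (simp add: m_def marginal_def)
      then show ?thesis using Pd by (intro exI[of _ P] exI[of _ d]) auto
    next
      case False
      let ?d = "d(x := m)"
      have eq: "sum ?d T = sum d T" if "x \<notin> T" for T
        using that by (intro sum.cong) auto
      have "sum ?d T \<le> f T" if T: "T \<subseteq> insert x P" for T
      proof (cases "x \<in> T")
        case True
        define R where "R = T - {x}"
        have R: "R \<subseteq> P" "x \<notin> R" "T = insert x R" "finite R"
          using T True fP finite_subset[of R P] by (auto simp: R_def)
        then have "sum ?d T = m + sum d R" by (simp add: eq del: fun_upd_apply) simp
        also have "\<dots> \<le> marginal f {x} R + f R"
          using m_le[of R] R Pd by (intro add_mono) auto
        also have "\<dots> = f T" using R by (simp add: marginal_def)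
        finally show ?thesis .
      next
        case False
        then show ?thesis using T Pd(3) by (subst eq) auto
      qed
      moreover have "f (insert x A) \<le> sum ?d (insert x P)"
        using Pd(4) fP xP eq[OF xP] by (simp add: m_def marginal_def)
      moreover have "\<forall>y\<in>insert x P. 0 < ?d y \<and> ?d y \<le> f {y}"
        using Pd(2) False m_le[of "{}"] f0 by (auto simp: marginal_def)
      ultimately show ?thesis using Pd(1) by (intro exI[of _ "insert x P"] exI[of _ ?d]) auto
    qed
  qed
  then show thesis using that by blast
qed

text \<open>
  The invariant of the induction is that the total of the weights is attained as a decrease of
  \<open>h\<close> by some subset.
\<close>

lemma damage_weights:
  assumes sub: "submodular_on U h" and nn: "nonneg_on U h" and fin: "finite U"
  obtains k where "\<And>z. z \<in> U \<Longrightarrow> 0 \<le> (k z :: real)" "sum k U \<le> h {}"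
    "\<And>S. S \<subseteq> U \<Longrightarrow> h {} - sum k S \<le> h S"
proof -
  have "\<exists>k. (\<forall>z\<in>V. 0 \<le> k z) \<and> (\<forall>S\<subseteq>V. h {} - sum k S \<le> h S) \<and> (\<exists>R\<subseteq>V. h R = h {} - sum k V)"
    if "V \<subseteq> U" for V
    using finite_subset[OF that fin] that
  proof (induction V)
    case empty
    then show ?case by auto
  next
    case (insert z V)
    then obtain k R where k: "\<forall>z\<in>V. 0 \<le> k z" "\<forall>S\<subseteq>V. h {} - sum k S \<le> h S"
      and R: "R \<subseteq> V" "h R = h {} - sum k V" by auto
    define m where "m = Min ((\<lambda>S. h (insert z S)) ` Pow V)"
    have finV: "finite ((\<lambda>S. h (insert z S)) ` Pow V)" using insert.hyps(1) by simp
    have m_le: "m \<le> h (insert z S)" if "S \<subseteq> V" for S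
      unfolding m_def using finV that by (intro Min_le) auto
    have "m \<in> (\<lambda>S. h (insert z S)) ` Pow V"
      unfolding m_def using finV by (intro Min_in) auto
    then obtain S0 where S0: "S0 \<subseteq> V" "h (insert z S0) = m" by auto
    \<comment> \<open>The weight of \<open>z\<close> is the further decrease below
      \<open>h R\<close> that \<open>z\<close> makes possible, so the total weight stays equal to an
      attained decrease.\<close>
    define k' where "k' = k(z := max 0 (h R - m))"
    have eq: "sum k' S = sum k S" if "z \<notin> S" for S
      unfolding k'_def using that by (intro sum.cong) auto
    have "h {} - sum k' S \<le> h S" if S: "S \<subseteq> insert z V" for S
    proof (cases "z \<in> S")
      case True
      define S1 where "S1 = S - {z}"
      have S1: "S1 \<subseteq> V" "z \<notin> S1" "S = insert z S1" "finite S1"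
        using S True insert.hyps(1) finite_subset[of S1 V] by (auto simp: S1_def)
      \<comment> \<open>The union contains \<open>z\<close>, so its value is at least
        \<open>m\<close>; the intersection avoids \<open>z\<close> and falls under the induction
        hypothesis.\<close>
      have "h (S \<union> R) + h (S \<inter> R) \<le> h S + h R"
        using S R insert.prems by (intro submodular_union_inter[OF sub fin]) auto
      moreover have "m \<le> h (S \<union> R)" using m_le[of "S1 \<union> R"] S1 R(1) by simp
      moreover have "h {} - sum k S1 \<le> h (S \<inter> R)"
      proof -
        have "sum k (S \<inter> R) \<le> sum k S1"
          using S1 R(1) k(1) insert.hyps by (intro sum_mono2) auto
        moreover have "h {} - sum k (S \<inter> R) \<le> h (S \<inter> R)"
          using k(2) R(1) by (meson le_infI2)
        ultimately show ?thesis by linarith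
      qed
      moreover have "sum k' S = k' z + sum k S1" using S1 by (simp add: eq)
      moreover have "h R - m \<le> k' z" by (simp add: k'_def)
      ultimately show ?thesis by linarith
    next
      case False
      then show ?thesis using S k(2) by (subst eq) auto
    qed
    moreover have "\<forall>x\<in>insert z V. 0 \<le> k' x" using k(1) by (auto simp: k'_def)
    moreover have "\<exists>R'\<subseteq>insert z V. h R' = h {} - sum k' (insert z V)"
    proof (cases "h R \<le> m")
      case True
      then have "k' z = 0" by (simp add: k'_def)
      then show ?thesis using R insert.hyps by (intro exI[of _ R]) (auto simp: eq)
    next
      case False
      then have "k' z = h R - m" by (simp add: k'_def)
      then show ?thesis using R S0 insert.hyps by (intro exI[of _ "insert z S0"]) (auto simp: eq)
    qed
    ultimately show ?case by blast
  qed
  from this[OF order_refl] obtain k R where k: "\<forall>z\<in>U. 0 \<le> k z" "\<forall>S\<subseteq>U. h {} - sum k S \<le> h S"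
    "R \<subseteq> U" "h R = h {} - sum k U" by blast
  moreover have "0 \<le> h R" using nn k(3) by (auto simp: nonneg_on_def)
  ultimately show thesis using that[of k] by auto
qed

text \<open>\<open>damage_weights\<close> applies to \<open>f (S \<union> T)\<close> as a function
  of \<open>S\<close> and gives a total of at most \<open>f T\<close>; dividing by
  \<open>f T\<close> normalizes it to 1. Scaling down to \<open>t\<close> is possible because
  \<open>1 - sum k S\<close> is never negative. A loss stated for each set, and not only in the
  mean, can later be combined with a cap before averaging.\<close>

lemma damaged_value:
  assumes sub: "submodular_on N f" and nn: "nonneg_on N f" and fin: "finite N"
    and TN: "T \<subseteq> N" and UN: "U \<subseteq> N" and TU: "T \<inter> U = {}" and t: "0 \<le> t" "t \<le> f T"
  obtains k where "\<And>z. z \<in> U \<Longrightarrow> 0 \<le> (k z :: real)" "sum k U \<le> 1"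
    "\<And>S. S \<subseteq> U \<Longrightarrow> t * (1 - sum k S) \<le> f (S \<union> T)"
proof (cases "t = 0")
  case True
  show thesis
  proof (rule that[of "\<lambda>_. 0"])
    show "t * (1 - (\<Sum>x\<in>S. 0)) \<le> f (S \<union> T)" if "S \<subseteq> U" for S
      using that True nn TN UN by (auto simp: nonneg_on_def)
  qed auto
next
  case False
  define h where "h = (\<lambda>S. f (S \<union> T))"
  have "submodular_on U h" unfolding submodular_on_def
  proof (intro allI impI, elim conjE)
    fix S R x assume *: "S \<subseteq> R" "R \<subseteq> U" "x \<in> U - R"
    have "marginal f {x} (R \<union> T) \<le> marginal f {x} (S \<union> T)"
      using * TN UN TU by (intro submodular_onD[OF sub]) auto
    then show "marginal h {x} R \<le> marginal h {x} S" by (simp add: marginal_def h_def)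
  qed
  moreover have "nonneg_on U h"
    unfolding nonneg_on_def h_def
  proof (intro allI impI)
    fix S assume "S \<subseteq> U"
    then have "S \<union> T \<subseteq> N" using TN UN by auto
    then show "0 \<le> f (S \<union> T)" using nn by (auto simp: nonneg_on_def)
  qed
  moreover have finU: "finite U" using UN fin finite_subset by auto
  ultimately obtain k where k: "\<And>z. z \<in> U \<Longrightarrow> 0 \<le> (k z :: real)" "sum k U \<le> h {}"
    "\<And>S. S \<subseteq> U \<Longrightarrow> h {} - sum k S \<le> h S" using damage_weights by blast
  have h0: "h {} = f T" by (simp add: h_def)
  have pos: "0 < f T" using False t by simp
  show thesis
  proof (rule that[of "\<lambda>z. k z / f T"])
    show "0 \<le> k z / f T" if "z \<in> U" for z using k(1)[OF that] pos by simp
    show "(\<Sum>z\<in>U. k z / f T) \<le> 1"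
      using k(2) pos h0 by (simp add: sum_divide_distrib[symmetric])
    show "t * (1 - (\<Sum>z\<in>S. k z / f T)) \<le> f (S \<union> T)" if S: "S \<subseteq> U" for S
    proof -
      have "sum k S \<le> sum k U" using S k(1) finU by (intro sum_mono2) auto
      then have "0 \<le> 1 - sum k S / f T" using k(2) h0 pos by (simp add: field_simps)
      then have "t * (1 - sum k S / f T) \<le> f T * (1 - sum k S / f T)"
        using t by (intro mult_right_mono) auto
      also have "\<dots> = f T - sum k S" using pos by (simp add: field_simps)
      also have "\<dots> \<le> f (S \<union> T)" using k(3)[OF S] h0 by (simp add: h_def)
      finally show ?thesis by (simp add: sum_divide_distrib)
    qed
  qed
qed

section \<open>Expectations over random subsets\<close>

definition subset_mean :: "real \<Rightarrow> 'a set \<Rightarrow> ('a set \<Rightarrow> real) \<Rightarrow> real" where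
  "subset_mean p X g = measure_pmf.expectation (random_subset p X) g"

lemma set_random_subset: "set_pmf (random_subset p X) \<subseteq> Pow X"
  by (auto simp: random_subset_def)

lemma finite_random_subset: "finite X \<Longrightarrow> finite (set_pmf (random_subset p X))"
  using set_random_subset finite_subset by (metis finite_Pow_iff)

lemma integrable_random_subset:
  fixes g :: "'a set \<Rightarrow> real"
  shows "finite X \<Longrightarrow> integrable (measure_pmf (random_subset p X)) g"
  by (intro integrable_measure_pmf_finite finite_random_subset)

lemma random_subset_insert:
  assumes "finite X" "x \<notin> X"
  shows "random_subset p (insert x X) =
    bind_pmf (bernoulli_pmf p) (\<lambda>y. map_pmf (\<lambda>A. if y then insert x A else A) (random_subset p X))"
proof -
  have eq: "{z \<in> insert x X. (b(x := y)) z} = (if y then insert x {z \<in> X. b z} else {z \<in> X. b z})" for b y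
    using assms(2) by (auto split: if_splits)
  show ?thesis
    unfolding random_subset_def Pi_pmf_insert'[OF assms]
    by (simp add: map_bind_pmf map_pmf_comp eq del: fun_upd_apply insert_iff flip: map_pmf_def)
qed

lemma subset_mean_empty: "subset_mean p {} g = g {}"
  by (simp add: subset_mean_def random_subset_def)

lemma subset_mean_insert:
  assumes "finite X" "x \<notin> X" "0 \<le> p" "p \<le> 1"
  shows "subset_mean p (insert x X) g =
    p * subset_mean p X (\<lambda>A. g (insert x A)) + (1 - p) * subset_mean p X g"
  unfolding subset_mean_def random_subset_insert[OF assms(1,2)]
  by (subst pmf_expectation_bind[of UNIV])
     (use assms finite_random_subset in \<open>auto simp: UNIV_bool\<close>)

lemma subset_mean_add:
  "finite X \<Longrightarrow> subset_mean p X (\<lambda>A. g A + h A) = subset_mean p X g + subset_mean p X h"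
  unfolding subset_mean_def by (intro Bochner_Integration.integral_add integrable_random_subset)

lemma subset_mean_diff:
  "finite X \<Longrightarrow> subset_mean p X (\<lambda>A. g A - h A) = subset_mean p X g - subset_mean p X h"
  unfolding subset_mean_def by (intro Bochner_Integration.integral_diff integrable_random_subset)

lemma subset_mean_cmult: "subset_mean p X (\<lambda>A. a * g A) = a * subset_mean p X g"
  unfolding subset_mean_def by simp

lemma subset_mean_const: "subset_mean p X (\<lambda>A. a) = a"
  unfolding subset_mean_def by simp

lemma subset_mean_mono:
  assumes "finite X" "\<And>A. A \<subseteq> X \<Longrightarrow> g A \<le> h A"
  shows "subset_mean p X g \<le> subset_mean p X h"
  unfolding subset_mean_def using assms set_random_subset[of p X]
  by (intro integral_mono_AE integrable_random_subset) (auto simp: AE_measure_pmf_iff)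

lemma subset_mean_cong:
  assumes "\<And>A. A \<subseteq> X \<Longrightarrow> g A = h A"
  shows "subset_mean p X g = subset_mean p X h"
  unfolding subset_mean_def using assms set_random_subset[of p X]
  by (intro integral_cong_AE) (auto simp: AE_measure_pmf_iff)

lemma subset_mean_union:
  assumes "finite X" "finite Y" "X \<inter> Y = {}" "0 \<le> p" "p \<le> 1"
  shows "subset_mean p (X \<union> Y) g = subset_mean p X (\<lambda>A. subset_mean p Y (\<lambda>B. g (A \<union> B)))"
  using assms(1,3)
proof (induction X arbitrary: g)
  case empty
  then show ?case by (simp add: subset_mean_empty)
next
  case (insert x X)
  then show ?case
    using assms by (simp add: subset_mean_insert)
qed

lemma subset_mean_sum:
  assumes "finite X" "0 \<le> p" "p \<le> 1"
  shows "subset_mean p X (sum d) = p * sum d X"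
  using assms(1)
proof (induction X)
  case empty
  then show ?case by (simp add: subset_mean_empty)
next
  case (insert x X)
  have "subset_mean p X (\<lambda>A. sum d (insert x A)) = subset_mean p X (\<lambda>A. d x + sum d A)"
    using insert.hyps by (intro subset_mean_cong sum.insert) (auto intro: finite_subset)
  then show ?case
    using insert assms
    by (simp add: subset_mean_insert subset_mean_add subset_mean_const algebra_simps)
qed

text \<open>Two distinct elements are both sampled with probability \<open>p\<^sup>2\<close>, an
  element together with itself with probability \<open>p\<close>; the last sum corrects the
  diagonal.\<close>

lemma subset_mean_sum_mult_sum:
  assumes "finite X" "0 \<le> p" "p \<le> 1"
  shows "subset_mean p X (\<lambda>A. sum d A * sum c A) =
    p\<^sup>2 * (sum d X * sum c X) + p * (1 - p) * (\<Sum>x\<in>X. d x * c x)"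
  using assms(1)
proof (induction X)
  case empty
  then show ?case by (simp add: subset_mean_empty)
next
  case (insert x X)
  have "subset_mean p X (\<lambda>A. sum d (insert x A) * sum c (insert x A)) =
      subset_mean p X (\<lambda>A. d x * c x + (d x * sum c A + (c x * sum d A + sum d A * sum c A)))"
  proof (intro subset_mean_cong)
    fix A assume "A \<subseteq> X"
    then have "sum g (insert x A) = g x + sum g A" for g :: "'a \<Rightarrow> real"
      using insert.hyps by (intro sum.insert) (auto intro: finite_subset)
    then show "sum d (insert x A) * sum c (insert x A) =
      d x * c x + (d x * sum c A + (c x * sum d A + sum d A * sum c A))"
      by (simp add: algebra_simps)
  qed
  also have "\<dots> = d x * c x + (d x * (p * sum c X) + (c x * (p * sum d X) +
      subset_mean p X (\<lambda>A. sum d A * sum c A)))"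
    using insert.hyps assms
    by (simp add: subset_mean_add subset_mean_const subset_mean_cmult subset_mean_sum)
  finally show ?case
    using insert assms by (simp add: subset_mean_insert algebra_simps power2_eq_square)
qed

lemma subset_mean_card:
  assumes "finite X" "0 \<le> p" "p \<le> 1"
  shows "subset_mean p X (\<lambda>A. h (card A)) =
    (\<Sum>k\<le>card X. real (card X choose k) * p ^ k * (1 - p) ^ (card X - k) * h k)"
proof -
  have "subset_mean p X (\<lambda>A. h (card A)) =
      measure_pmf.expectation (map_pmf card (random_subset p X)) h"
    by (simp add: subset_mean_def)
  also have "map_pmf card (random_subset p X) = binomial_pmf (card X) p"
    unfolding random_subset_def map_pmf_comp
    using assms by (subst binomial_pmf_altdef'[of X _ _ False]) auto
  also have "measure_pmf.expectation \<dots> h =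
      (\<Sum>k\<le>card X. real (card X choose k) * p ^ k * (1 - p) ^ (card X - k) * h k)"
    using assms by (subst expectation_binomial_pmf') auto
  finally show ?thesis .
qed

text \<open>
  Among all weights bounded by \<open>l\<close> with total \<open>n * l\<close>, a convex function of the random sum has the
  largest mean when \<open>n\<close> of the weights equal \<open>l\<close>: moving mass between two fractional
  weights in one of the two directions does not decrease the mean.
\<close>

lemma subset_mean_convex_le_binomial:
  fixes d :: "'a \<Rightarrow> real" and \<phi> :: "real \<Rightarrow> real"
  assumes conv: "convex_on UNIV \<phi>" and fin: "finite I" and p: "0 \<le> p" "p \<le> 1" and l: "0 < l"
    and "\<And>i. i \<in> I \<Longrightarrow> 0 \<le> d i" "\<And>i. i \<in> I \<Longrightarrow> d i \<le> l" "sum d I = real n * l"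
  shows "subset_mean p I (\<lambda>A. \<phi> (sum d A)) \<le>
    (\<Sum>k\<le>n. real (n choose k) * p ^ k * (1 - p) ^ (n - k) * \<phi> (l * real k))"
  using assms(6-8)
proof (induction "card {i \<in> I. 0 < d i \<and> d i < l}" arbitrary: d rule: less_induct)
  case less
  let ?F = "{i \<in> I. 0 < d i \<and> d i < l}"
  define J where "J = {i \<in> I. d i = l}"
  have J: "J \<subseteq> I" "finite J" using fin by (auto simp: J_def)
  have I_eq: "I = J \<union> ?F \<union> {i \<in> I. d i = 0}"
    using less.prems(1,2) by (force simp: J_def)
  have "sum d I = sum d (J \<union> ?F) + sum d {i \<in> I. d i = 0}"
    by (subst I_eq, rule sum.union_disjoint) (use fin J l in \<open>auto simp: J_def\<close>)
  also have "sum d (J \<union> ?F) = sum d J + sum d ?F"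
    by (rule sum.union_disjoint) (use fin J in \<open>auto simp: J_def\<close>)
  also have "sum d J = real (card J) * l" by (simp add: J_def)
  finally have sumI: "sum d I = real (card J) * l + sum d ?F" by simp
  show ?case
  proof (cases "?F = {}")
    case True
    then have dv: "d i = (if i \<in> J then l else 0)" if "i \<in> I" for i
      using that less.prems(1)[OF that] less.prems(2)[OF that] by (force simp: J_def)
    have "sum d A = l * real (card (A \<inter> J))" if "A \<subseteq> I" for A
    proof -
      have "finite A" using that fin finite_subset by auto
      have "sum d A = (\<Sum>i\<in>A. if i \<in> J then l else 0)" using that dv by (intro sum.cong) auto
      also have "\<dots> = l * real (card (A \<inter> J))"
        using \<open>finite A\<close> by (subst sum.inter_restrict[symmetric]) auto
      finally show ?thesis .
    qed
    then have "subset_mean p I (\<lambda>A. \<phi> (sum d A)) = subset_mean p I (\<lambda>A. \<phi> (l * real (card (A \<inter> J))))"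
      by (intro subset_mean_cong) auto
    also have "\<dots> = subset_mean p (J \<union> (I - J)) (\<lambda>A. \<phi> (l * real (card (A \<inter> J))))"
      using J(1) by (simp add: Un_absorb1)
    also have "\<dots> =
        subset_mean p J (\<lambda>A. subset_mean p (I - J) (\<lambda>C. \<phi> (l * real (card ((A \<union> C) \<inter> J)))))"
      using J fin p by (intro subset_mean_union) auto
    also have "\<dots> = subset_mean p J (\<lambda>A. subset_mean p (I - J) (\<lambda>C. \<phi> (l * real (card A))))"
    proof (intro subset_mean_cong)
      fix A C assume "A \<subseteq> J" "C \<subseteq> I - J"
      then have "(A \<union> C) \<inter> J = A" by auto
      then show "\<phi> (l * real (card ((A \<union> C) \<inter> J))) = \<phi> (l * real (card A))" by simp
    qed
    also have "\<dots> = subset_mean p J (\<lambda>A. \<phi> (l * real (card A)))"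
      by (simp add: subset_mean_const)
    also have "\<dots> = (\<Sum>k\<le>card J. real (card J choose k) * p ^ k * (1 - p) ^ (card J - k) * \<phi> (l * real k))"
      using J p by (intro subset_mean_card) auto
    also have "card J = n"
    proof -
      have "sum d ?F = 0" unfolding True by simp
      then have "real (card J) * l = real n * l" using sumI less.prems(3) by linarith
      then show ?thesis using l by simp
    qed
    finally show ?thesis by simp
  next
    case False
    then obtain i where i: "i \<in> ?F" by auto
    \<comment> \<open>A single fractional weight is impossible, since the total and all other
      weights are multiples of \<open>l\<close>.\<close>
    have "?F \<noteq> {i}"
    proof
      assume "?F = {i}"
      then have "real (card J) * l + d i = real n * l" using sumI less.prems(3) by simp
      then have "d i = (real n - real (card J)) * l" by (simp add: algebra_simps)
      then have *: "0 < (real n - real (card J)) * l" "(real n - real (card J)) * l < 1 * l"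
        using i by auto
      then have "0 < real n - real (card J)" "real n - real (card J) < 1"
        using l by (auto simp: zero_less_mult_iff simp del: mult_1)
      then have "real (card J) < real n" "real n < real (card J + 1)" by auto
      then have "card J < n" "n < card J + 1" by (simp_all only: of_nat_less_iff)
      then show False by linarith
    qed
    with i obtain j where j: "j \<in> ?F" "j \<noteq> i" by blast
    \<comment> \<open>The largest transfers in the two directions that keep both weights between 0
      and \<open>l\<close>. Each of them turns one of the two weights into 0 or \<open>l\<close>, so
      fewer fractional weights remain.\<close>
    define a where "a = min (d i) (l - d j)"
    define b where "b = min (l - d i) (d j)"
    have ab: "0 < a" "0 < b" using i j by (auto simp: a_def b_def)
    define dm where "dm = d(i := d i - a, j := d j + a)"
    define dp where "dp = d(i := d i + b, j := d j - b)"
    let ?R = "(\<Sum>k\<le>n. real (n choose k) * p ^ k * (1 - p) ^ (n - k) * \<phi> (l * real k))"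
    have bound: "subset_mean p I (\<lambda>A. \<phi> (sum d' A)) \<le> ?R"
      if d': "d' = d(i := d i + s, j := d j - s)" and s: "s = - a \<or> s = b" for d' s
    proof (rule less.hyps)
      have range: "0 \<le> d i + s" "d i + s \<le> l" "0 \<le> d j - s" "d j - s \<le> l"
        using s i j by (auto simp: a_def b_def)
      have full: "d i + s = 0 \<or> d i + s = l \<or> d j - s = 0 \<or> d j - s = l"
        using s by (auto simp: a_def b_def min_def)
      show "\<And>k. k \<in> I \<Longrightarrow> 0 \<le> d' k" "\<And>k. k \<in> I \<Longrightarrow> d' k \<le> l"
        using less.prems(1,2) range by (auto simp: d')
      have "{k \<in> I. 0 < d' k \<and> d' k < l} \<subset> ?F"
        using full i j by (force simp: d' split: if_splits)
      then show "card {k \<in> I. 0 < d' k \<and> d' k < l} < card ?F"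
        using fin by (intro psubset_card_mono) auto
      have split: "sum g I = g i + g j + sum g (I - {i} - {j})" for g :: "'a \<Rightarrow> real"
        using i j fin by (subst sum.remove[of I i], simp, simp, subst sum.remove[of "I - {i}" j]) auto
      have "sum d' (I - {i} - {j}) = sum d (I - {i} - {j})"
        by (intro sum.cong) (auto simp: d')
      moreover have "d' i = d i + s" "d' j = d j - s" using j(2) by (auto simp: d')
      ultimately show "sum d' I = real n * l"
        using less.prems(3) split[of d'] split[of d] by linarith
    qed
    have bm: "subset_mean p I (\<lambda>A. \<phi> (sum dm A)) \<le> ?R"
      by (rule bound[of _ "- a"]) (simp_all add: dm_def)
    have bp: "subset_mean p I (\<lambda>A. \<phi> (sum dp A)) \<le> ?R"
      by (rule bound[of _ b]) (simp_all add: dp_def)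
    \<comment> \<open>With these coefficients the two transfers cancel, so \<open>d\<close> is a
      convex combination of \<open>dm\<close> and \<open>dp\<close>.\<close>
    define u where "u = b / (a + b)"
    have u: "0 \<le> u" "u \<le> 1" "1 - u = a / (a + b)" using ab by (auto simp: u_def field_simps)
    have comb: "d k = u * dm k + (1 - u) * dp k" for k
    proof -
      have "d k = (u + (1 - u)) * d k" by simp
      moreover have "u * a = (1 - u) * b" using u(3) ab by (simp add: u_def field_simps)
      ultimately show ?thesis using j(2) by (auto simp: dm_def dp_def algebra_simps)
    qed
    have "subset_mean p I (\<lambda>A. \<phi> (sum d A)) \<le>
        subset_mean p I (\<lambda>A. u * \<phi> (sum dm A) + (1 - u) * \<phi> (sum dp A))"
    proof (rule subset_mean_mono[OF fin])
      fix A
      have "sum d A = (\<Sum>k\<in>A. u * dm k + (1 - u) * dp k)" using comb by (intro sum.cong) auto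
      also have "\<dots> = u * sum dm A + (1 - u) * sum dp A" by (simp add: sum.distrib sum_distrib_left)
      finally show "\<phi> (sum d A) \<le> u * \<phi> (sum dm A) + (1 - u) * \<phi> (sum dp A)"
        using convex_onD[OF conv, of "1 - u" "sum dm A" "sum dp A"] u(1,2) by simp
    qed
    also have "\<dots> = u * subset_mean p I (\<lambda>A. \<phi> (sum dm A)) + (1 - u) * subset_mean p I (\<lambda>A. \<phi> (sum dp A))"
      using fin by (simp add: subset_mean_add subset_mean_cmult)
    also have "\<dots> \<le> u * ?R + (1 - u) * ?R"
      using u bm bp by (intro add_mono mult_left_mono) auto
    finally show ?thesis by (simp add: algebra_simps)
  qed
qed

section \<open>Numerical estimates\<close>

text \<open>The mean of the positive part of \<open>l * K - z\<close> for a binomial variable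
  \<open>K\<close> with parameters \<open>n\<close> and \<open>p\<close>.\<close>

definition binomial_excess :: "real \<Rightarrow> nat \<Rightarrow> real \<Rightarrow> real \<Rightarrow> real" where
  "binomial_excess p n l z =
    (\<Sum>k\<le>n. real (n choose k) * p ^ k * (1 - p) ^ (n - k) * max 0 (l * real k - z))"

lemma binomial_excess_nonneg: "0 \<le> p \<Longrightarrow> p \<le> 1 \<Longrightarrow> 0 \<le> binomial_excess p n l z"
  unfolding binomial_excess_def by (intro sum_nonneg mult_nonneg_nonneg) auto

text \<open>Both \<open>p\<close> and \<open>1 - p\<close> are rounded up, so the right side is no
  longer a mean, but it is an explicit rational number once \<open>n\<close>, \<open>l'\<close> and
  \<open>z'\<close> are numerals.\<close>

lemma binomial_excess_le:
  assumes "0.36602 \<le> p" "p \<le> 0.36603" "l \<le> l'" "z' \<le> z"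
  shows "binomial_excess p n l z \<le>
    (\<Sum>k\<le>n. real (n choose k) * 0.36603 ^ k * 0.63398 ^ (n - k) * max 0 (l' * real k - z'))"
  unfolding binomial_excess_def
proof (rule sum_mono, rule mult_mono)
  fix k assume "k \<in> {..n}"
  show "real (n choose k) * p ^ k * (1 - p) ^ (n - k) \<le>
      real (n choose k) * 0.36603 ^ k * 0.63398 ^ (n - k)"
    using assms by (intro mult_mono power_mono) auto
  have "l * real k \<le> l' * real k" using assms by (intro mult_right_mono) auto
  then show "max 0 (l * real k - z) \<le> max 0 (l' * real k - z')" using assms by auto
qed (use assms in auto)

lemma choose_numerals:
  "(6::nat) choose 2 = 15" "(6::nat) choose 3 = 20" "(6::nat) choose 4 = 15" "(6::nat) choose 5 = 6"
  "(7::nat) choose 2 = 21" "(7::nat) choose 3 = 35" "(7::nat) choose 4 = 35" "(7::nat) choose 5 = 21"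
  "(7::nat) choose 6 = 7"
  "(8::nat) choose 2 = 28" "(8::nat) choose 3 = 56" "(8::nat) choose 4 = 70" "(8::nat) choose 5 = 56"
  "(8::nat) choose 6 = 28" "(8::nat) choose 7 = 8"
  "(9::nat) choose 2 = 36" "(9::nat) choose 3 = 84" "(9::nat) choose 4 = 126" "(9::nat) choose 5 = 126"
  "(9::nat) choose 6 = 84" "(9::nat) choose 7 = 36" "(9::nat) choose 8 = 9"
  "(10::nat) choose 2 = 45" "(10::nat) choose 3 = 120" "(10::nat) choose 4 = 210"
  "(10::nat) choose 5 = 252" "(10::nat) choose 6 = 210" "(10::nat) choose 7 = 120"
  "(10::nat) choose 8 = 45" "(10::nat) choose 9 = 10"
  by (simp_all add: binomial_fact' fact_numeral)

lemma sum_atMost_numerals: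
  fixes f :: "nat \<Rightarrow> real"
  shows "(\<Sum>k\<le>6. f k) = f 0 + f 1 + f 2 + f 3 + f 4 + f 5 + f 6"
    "(\<Sum>k\<le>7. f k) = f 0 + f 1 + f 2 + f 3 + f 4 + f 5 + f 6 + f 7"
    "(\<Sum>k\<le>8. f k) = f 0 + f 1 + f 2 + f 3 + f 4 + f 5 + f 6 + f 7 + f 8"
    "(\<Sum>k\<le>9. f k) = f 0 + f 1 + f 2 + f 3 + f 4 + f 5 + f 6 + f 7 + f 8 + f 9"
    "(\<Sum>k\<le>10. f k) = f 0 + f 1 + f 2 + f 3 + f 4 + f 5 + f 6 + f 7 + f 8 + f 9 + f 10"
  by (simp_all add: numeral_eq_Suc)

text \<open>One instance for each range of \<open>w\<close>: the first three serve
  \<open>parameters_drop\<close>, with \<open>1 - w\<close> bounded by 1, 0.9 and 0.875 in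
  \<open>l\<close>; the last three serve \<open>parameters_keep\<close>, where \<open>z\<close> is
  bounded by \<open>\<delta> * (1 - w)\<close> at the right end of the range (slightly rounded down
  in the last one).\<close>

lemma binomial_excess_numerals:
  assumes p: "0.36602 \<le> p" "p \<le> 0.36603"
  shows "l \<le> 1 / 9 \<Longrightarrow> binomial_excess p 9 l 0.45 \<le> 0.03033"
    "l \<le> 0.9 / 7 \<Longrightarrow> binomial_excess p 7 l 0.52 \<le> 0.00985"
    "l \<le> 0.875 / 6 \<Longrightarrow> binomial_excess p 6 l 0.58 \<le> 0.00481"
    "0.414 \<le> z \<Longrightarrow> binomial_excess p 10 (1 / 10) z \<le> 0.04011"
    "0.49875 \<le> z \<Longrightarrow> binomial_excess p 8 (1 / 8) z \<le> 0.02075"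
    "0.57 \<le> z \<Longrightarrow> binomial_excess p 7 (1 / 7) z \<le> 0.01168"
proof -
  show "binomial_excess p 9 l 0.45 \<le> 0.03033" if "l \<le> 1 / 9"
    by (rule order.trans[OF binomial_excess_le[OF p that order_refl]])
       (simp add: sum_atMost_numerals choose_numerals power_divide)
  show "binomial_excess p 7 l 0.52 \<le> 0.00985" if "l \<le> 0.9 / 7"
    by (rule order.trans[OF binomial_excess_le[OF p that order_refl]])
       (simp add: sum_atMost_numerals choose_numerals power_divide)
  show "binomial_excess p 6 l 0.58 \<le> 0.00481" if "l \<le> 0.875 / 6"
    by (rule order.trans[OF binomial_excess_le[OF p that order_refl]])
       (simp add: sum_atMost_numerals choose_numerals power_divide)
  show "binomial_excess p 10 (1 / 10) z \<le> 0.04011" if "0.414 \<le> z"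
    by (rule order.trans[OF binomial_excess_le[OF p order_refl that]])
       (simp add: sum_atMost_numerals choose_numerals power_divide)
  show "binomial_excess p 8 (1 / 8) z \<le> 0.02075" if "0.49875 \<le> z"
    by (rule order.trans[OF binomial_excess_le[OF p order_refl that]])
       (simp add: sum_atMost_numerals choose_numerals power_divide)
  show "binomial_excess p 7 (1 / 7) z \<le> 0.01168" if "0.57 \<le> z"
    by (rule order.trans[OF binomial_excess_le[OF p order_refl that]])
       (simp add: sum_atMost_numerals choose_numerals power_divide)
qed

lemma excess_term_le:
  assumes "0.36602 \<le> (p::real)" "p \<le> 1" "x \<le> lo" "0 \<le> x" "0.63398 * lo \<le> ell * (1 + \<delta>)\<^sup>2" "0 < \<delta>"
  shows "(1 - p) * (x / (1 + \<delta>)\<^sup>2) \<le> ell"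
proof -
  have "(1 - p) * x \<le> 0.63398 * lo" by (rule mult_mono) (use assms in simp_all)
  also have "\<dots> \<le> ell * (1 + \<delta>)\<^sup>2" by fact
  finally have "(1 - p) * x / (1 + \<delta>)\<^sup>2 \<le> ell" using assms(6) by (simp add: pos_divide_le_eq)
  then show ?thesis by simp
qed

text \<open>Reduces the inequality to conditions with rational coefficients. The line
  \<open>e0 - e1 * w\<close> stays below the main fraction, \<open>lo\<close> bounds the excess,
  \<open>ell\<close> bounds its discounted contribution, and \<open>p\<close> is replaced by the
  unfavourable end of its interval. What remains, \<open>tang\<close> and \<open>fin\<close>, is
  quadratic in \<open>w\<close>.\<close>

lemma chord_bound_drop:
  fixes p w \<delta> :: real
  assumes p: "0.36602 \<le> p" "p \<le> 0.36603" "2 * p\<^sup>2 = 1 - 2 * p" and w: "0 \<le> w" "w \<le> 1 / 7" and \<delta>: "0 < \<delta>"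
    and exc: "0 \<le> x" "x \<le> lo" "0.63398 * lo \<le> ell * (1 + \<delta>)\<^sup>2"
    and tang: "(e0 - e1 * w) * (1.36603 - 0.73204 * w) \<le> 0.23204 * (1 - w)\<^sup>2"
    and nn: "0 \<le> e0 - ell - (1 + e1) * w"
    and fin: "(1 - 7.465 * w) * (\<delta> / (1 + \<delta>) - w) \<le> 9.465 * ((0.26794 - w) * (e0 - ell - (1 + e1) * w))"
  shows "(1 - 7.465 * w) * (\<delta> / (1 + \<delta>) - w) \<le>
    9.465 * ((1 - 2 * p - w) * ((1 - p) * (p * (1 - w)\<^sup>2 / (1 + p - 2 * p * w) - x / (1 + \<delta>)\<^sup>2) - w))"
proof -
  have pw: "0.36602 * w \<le> p * w" "p * w \<le> 0.36603 * w" using mult_right_mono[OF p(1) w(1)] mult_right_mono[OF p(2) w(1)] by simp_all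
  have den: "0 < 1 + p - 2 * p * w" "1 + p - 2 * p * w \<le> 1.36603 - 0.73204 * w"
    using p w pw by (simp_all add: mult.assoc)
  have den': "0 < 1.36603 - 0.73204 * w" using w by simp
  have "e0 - e1 * w \<le> 0.23204 * (1 - w)\<^sup>2 / (1.36603 - 0.73204 * w)"
    using tang by (rule pos_le_divide_eq[OF den', THEN iffD2])
  also have "\<dots> \<le> ((1 - p) * p * (1 - w)\<^sup>2) / (1 + p - 2 * p * w)"
  proof (intro frac_le mult_right_mono)
    \<comment> \<open>By \<open>2 * p\<^sup>2 = 1 - 2 * p\<close> the product equals
      \<open>2 * p - 1 / 2\<close>; this is 0.23204 at \<open>p = 0.36602\<close>.\<close>
    show "0.23204 \<le> (1 - p) * p" using p by (simp add: algebra_simps power2_eq_square)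
    show "0 \<le> (1 - p) * p * (1 - w)\<^sup>2" using p by simp
  qed (use den in auto)
  finally have E: "e0 - e1 * w \<le> (1 - p) * (p * (1 - w)\<^sup>2 / (1 + p - 2 * p * w))"
    by (simp add: mult.assoc)
  have "(1 - p) * (x / (1 + \<delta>)\<^sup>2) \<le> ell"
    using p exc \<delta> by (intro excess_term_le) auto
  then have Y: "e0 - ell - (1 + e1) * w \<le>
      (1 - p) * (p * (1 - w)\<^sup>2 / (1 + p - 2 * p * w) - x / (1 + \<delta>)\<^sup>2) - w"
    using E unfolding right_diff_distrib distrib_right by linarith
  have A: "0.26794 - w \<le> 1 - 2 * p - w" "0 \<le> 1 - 2 * p - w" using p w by simp_all
  have "(0.26794 - w) * (e0 - ell - (1 + e1) * w) \<le>
      (1 - 2 * p - w) * ((1 - p) * (p * (1 - w)\<^sup>2 / (1 + p - 2 * p * w) - x / (1 + \<delta>)\<^sup>2) - w)"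
    by (rule mult_mono[OF A(1) Y A(2) nn])
  then show ?thesis by (intro order.trans[OF fin] mult_left_mono) simp_all
qed

text \<open>The reduction of \<open>chord_bound_drop\<close> for the other main fraction. Its
  denominator is quadratic in \<open>w\<close>, so multiplying by the line gives a cubic; the
  nonnegative term \<open>e1 * w * (0.63398 * w\<^sup>2)\<close> is discarded to keep the condition
  \<open>chord\<close> quadratic.\<close>

lemma chord_bound_keep:
  fixes p w \<delta> :: real
  assumes p: "0.36602 \<le> p" "p \<le> 0.36603" "2 * p\<^sup>2 = 1 - 2 * p" and w: "0 \<le> w" "w \<le> 1 / 7" and \<delta>: "0 < \<delta>"
    and exc: "0 \<le> x" "x \<le> lo" "0.63398 * lo \<le> ell * (1 + \<delta>)\<^sup>2"
    and e: "0 \<le> e1"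
    and chord: "(e0 - e1 * w) * 1.36603 + e0 * (0.63398 * w\<^sup>2) \<le> 0.23204 * (1 - w)"
    and nn: "0 \<le> e0 - ell - (1 + e1) * w"
    and fin: "(1 - 7.465 * w) * (\<delta> / (1 + \<delta>) * (1 - w) - w) \<le>
      9.465 * ((0.26794 * (1 - w) - w) * (e0 - ell - (1 + e1) * w))"
  shows "(1 - 7.465 * w) * (\<delta> / (1 + \<delta>) * (1 - w) - w) \<le>
    9.465 * (((1 - 2 * p) * (1 - w) - w) *
      ((1 - p) * (p * (1 - w) / (1 + p + (1 - p) * w\<^sup>2) - x / (1 + \<delta>)\<^sup>2) - w))"
proof -
  have den: "0 < 1 + p + (1 - p) * w\<^sup>2" "1 + p + (1 - p) * w\<^sup>2 \<le> 1.36603 + 0.63398 * w\<^sup>2"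
  proof -
    have "(1 - p) * w\<^sup>2 \<le> 0.63398 * w\<^sup>2" by (rule mult_right_mono) (use p in simp_all)
    then show "1 + p + (1 - p) * w\<^sup>2 \<le> 1.36603 + 0.63398 * w\<^sup>2" using p by simp
    show "0 < 1 + p + (1 - p) * w\<^sup>2" using p by (intro add_pos_nonneg mult_nonneg_nonneg) simp_all
  qed
  have den': "0 < 1.36603 + 0.63398 * w\<^sup>2" by (intro add_pos_nonneg) auto
  have expand: "(e0 - e1 * w) * (y + z) = (e0 - e1 * w) * y + e0 * z - e1 * w * z" for y z
    by (simp add: algebra_simps)
  have "0 \<le> e1 * w * (0.63398 * w\<^sup>2)" using e w by simp
  then have "(e0 - e1 * w) * (1.36603 + 0.63398 * w\<^sup>2) \<le> 0.23204 * (1 - w)"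
    using chord by (subst expand) linarith
  then have "e0 - e1 * w \<le> 0.23204 * (1 - w) / (1.36603 + 0.63398 * w\<^sup>2)"
    by (rule pos_le_divide_eq[OF den', THEN iffD2])
  also have "\<dots> \<le> ((1 - p) * p * (1 - w)) / (1 + p + (1 - p) * w\<^sup>2)"
  proof (intro frac_le mult_right_mono)
    show "0.23204 \<le> (1 - p) * p" using p by (simp add: algebra_simps power2_eq_square)
    show "0 \<le> (1 - p) * p * (1 - w)" using p w by simp
  qed (use den w in auto)
  finally have E: "e0 - e1 * w \<le> (1 - p) * (p * (1 - w) / (1 + p + (1 - p) * w\<^sup>2))"
    by (simp add: mult.assoc)
  have "(1 - p) * (x / (1 + \<delta>)\<^sup>2) \<le> ell"
    using p exc \<delta> by (intro excess_term_le) auto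
  then have Y: "e0 - ell - (1 + e1) * w \<le>
      (1 - p) * (p * (1 - w) / (1 + p + (1 - p) * w\<^sup>2) - x / (1 + \<delta>)\<^sup>2) - w"
    using E unfolding right_diff_distrib distrib_right by linarith
  have "0.26794 * (1 - w) \<le> (1 - 2 * p) * (1 - w)"
    by (rule mult_right_mono) (use p w in simp_all)
  then have A: "0.26794 * (1 - w) - w \<le> (1 - 2 * p) * (1 - w) - w" "0 \<le> (1 - 2 * p) * (1 - w) - w"
    using w by simp_all
  have "(0.26794 * (1 - w) - w) * (e0 - ell - (1 + e1) * w) \<le>
      ((1 - 2 * p) * (1 - w) - w) *
      ((1 - p) * (p * (1 - w) / (1 + p + (1 - p) * w\<^sup>2) - x / (1 + \<delta>)\<^sup>2) - w)"
    by (rule mult_mono[OF A(1) Y A(2) nn])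
  then show ?thesis by (intro order.trans[OF fin] mult_left_mono) simp_all
qed

text \<open>In each range \<open>n\<close> is the largest integer with
  \<open>n * w \<le> 1 - w\<close> throughout, because spreading the weight over more elements
  lowers the excess. The choice of \<open>\<delta>\<close> is a compromise: a larger one lowers the
  excess, but it raises the auxiliary cap and so flattens the chord of
  \<open>chord_min\<close>.\<close>

lemma parameters_drop:
  fixes p w :: real
  assumes p: "0.36602 \<le> p" "p \<le> 0.36603" "2 * p\<^sup>2 = 1 - 2 * p" and w: "0 \<le> w" "w < 200 / 1493"
  obtains \<delta> :: real and n :: nat where "0 < \<delta>" "0 < n" "real n * w \<le> 1 - w"
    "1 - 2 * p < \<delta> / (1 + \<delta>)"
    "(1 - 7.465 * w) * (\<delta> / (1 + \<delta>) - w) \<le> 9.465 * ((1 - 2 * p - w) *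
      ((1 - p) * (p * (1 - w)\<^sup>2 / (1 + p - 2 * p * w)
        - binomial_excess p n ((1 - w) / real n) \<delta> / (1 + \<delta>)\<^sup>2) - w))"
proof -
  have nn: "0 \<le> binomial_excess p n l z" for n l z using p by (intro binomial_excess_nonneg) auto
  note exc = binomial_excess_numerals(1-3)[OF p(1,2)]
  consider "w \<le> 0.1" | "0.1 \<le> w" "w \<le> 0.125" | "0.125 \<le> w" by linarith
  then show thesis
  proof cases
    case 1
    \<comment> \<open>Linear arithmetic needs facts about \<open>w * w\<close>. The square at 0.05,
      where the line \<open>0.16974 - 0.2449 * w\<close> is nearly tangent to the rounded fraction,
      serves \<open>tang\<close>; the square at 0.1 serves \<open>fin\<close>. The other two ranges
      follow the same pattern.\<close>
    have sq: "0 \<le> (w - 0.1)\<^sup>2" "0 \<le> (w - 0.05)\<^sup>2" by simp_all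
    show thesis
    proof (rule that[of "0.45" "9"])
      show "(1 - 7.465 * w) * (0.45 / (1 + 0.45) - w) \<le> 9.465 * ((1 - 2 * p - w) *
        ((1 - p) * (p * (1 - w)\<^sup>2 / (1 + p - 2 * p * w)
          - binomial_excess p 9 ((1 - w) / real 9) 0.45 / (1 + 0.45)\<^sup>2) - w))"
        by (rule chord_bound_drop[OF p w(1) _ _ nn exc(1), where ell = "0.00915" and ?e0.0 = "0.16974" and ?e1.0 = "0.2449"])
           (use w 1 sq in \<open>simp_all add: power2_eq_square field_simps\<close>)
    qed (use p w 1 in \<open>auto simp: field_simps\<close>)
  next
    case 2
    have sq: "0 \<le> (w - 0.125)\<^sup>2" "0 \<le> (w - 0.1125)\<^sup>2" by simp_all
    show thesis
    proof (rule that[of "0.52" "7"])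
      show "(1 - 7.465 * w) * (0.52 / (1 + 0.52) - w) \<le> 9.465 * ((1 - 2 * p - w) *
        ((1 - p) * (p * (1 - w)\<^sup>2 / (1 + p - 2 * p * w)
          - binomial_excess p 7 ((1 - w) / real 7) 0.52 / (1 + 0.52)\<^sup>2) - w))"
        by (rule chord_bound_drop[OF p w(1) _ _ nn exc(2), where ell = "0.00271" and ?e0.0 = "0.16932" and ?e1.0 = "0.2397"])
           (use w 2 sq in \<open>simp_all add: power2_eq_square field_simps\<close>)
    qed (use p w 2 in \<open>auto simp: field_simps\<close>)
  next
    case 3
    have sq: "0 \<le> (w - 0.125)\<^sup>2" "0 \<le> (w - 0.1294)\<^sup>2" by simp_all
    show thesis
    proof (rule that[of "0.58" "6"])
      show "(1 - 7.465 * w) * (0.58 / (1 + 0.58) - w) \<le> 9.465 * ((1 - 2 * p - w) *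
        ((1 - p) * (p * (1 - w)\<^sup>2 / (1 + p - 2 * p * w)
          - binomial_excess p 6 ((1 - w) / real 6) 0.58 / (1 + 0.58)\<^sup>2) - w))"
        by (rule chord_bound_drop[OF p w(1) _ _ nn exc(3), where ell = "0.00123" and ?e0.0 = "0.16914" and ?e1.0 = "0.2382"])
           (use w 3 sq in \<open>simp_all add: power2_eq_square field_simps\<close>)
    qed (use p w 3 in \<open>auto simp: field_simps\<close>)
  qed
qed

text \<open>Here the total weight is 1 and not \<open>1 - w\<close>, so the constraint is
  \<open>n * w \<le> 1\<close> and the largest admissible \<open>n\<close> are 10, 8 and 7.\<close>

lemma parameters_keep:
  fixes p w :: real
  assumes p: "0.36602 \<le> p" "p \<le> 0.36603" "2 * p\<^sup>2 = 1 - 2 * p" and w: "0 \<le> w" "w < 200 / 1493"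
  obtains \<delta> :: real and n :: nat where "0 < \<delta>" "0 < n" "real n * w \<le> 1"
    "1 - 2 * p < \<delta> / (1 + \<delta>)"
    "(1 - 7.465 * w) * (\<delta> / (1 + \<delta>) * (1 - w) - w) \<le> 9.465 * (((1 - 2 * p) * (1 - w) - w) *
      ((1 - p) * (p * (1 - w) / (1 + p + (1 - p) * w\<^sup>2)
        - binomial_excess p n (1 / real n) (\<delta> * (1 - w)) / (1 + \<delta>)\<^sup>2) - w))"
proof -
  have nn: "0 \<le> binomial_excess p n l z" for n l z using p by (intro binomial_excess_nonneg) auto
  note exc = binomial_excess_numerals(4-6)[OF p(1,2)]
  consider "w \<le> 0.1" | "0.1 \<le> w" "w \<le> 0.125" | "0.125 \<le> w" by linarith
  then show thesis
  proof cases
    case 1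
    \<comment> \<open>The line \<open>e0 - e1 * w\<close> is essentially a chord over the range. The
      difference in the condition \<open>chord\<close> is a concave quadratic, so the product of the
      distances of \<open>w\<close> to both ends of the range settles it.\<close>
    have sq: "0 \<le> (w - 0.1)\<^sup>2" "0 \<le> w * (0.1 - w)" using w 1 by simp_all
    show thesis
    proof (rule that[of "0.46" "10"])
      show "(1 - 7.465 * w) * (0.46 / (1 + 0.46) * (1 - w) - w) \<le> 9.465 * (((1 - 2 * p) * (1 - w) - w) *
        ((1 - p) * (p * (1 - w) / (1 + p + (1 - p) * w\<^sup>2)
          - binomial_excess p 10 (1 / real 10) (0.46 * (1 - w)) / (1 + 0.46)\<^sup>2) - w))"
        using w 1 sq exc(1)[of "0.46 * (1 - w)"]
        by (intro chord_bound_keep[OF p w(1) _ _ nn, where lo = "0.04011" and ell = "0.01194" and ?e0.0 = "0.16977" and ?e1.0 = "0.177"])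
           (simp_all add: power2_eq_square field_simps)
    qed (use p w 1 in \<open>auto simp: field_simps\<close>)
  next
    case 2
    have sq: "0 \<le> (w - 0.113)\<^sup>2" "0 \<le> (w - 0.1) * (0.125 - w)" using w 2 by simp_all
    show thesis
    proof (rule that[of "0.57" "8"])
      show "(1 - 7.465 * w) * (0.57 / (1 + 0.57) * (1 - w) - w) \<le> 9.465 * (((1 - 2 * p) * (1 - w) - w) *
        ((1 - p) * (p * (1 - w) / (1 + p + (1 - p) * w\<^sup>2)
          - binomial_excess p 8 (1 / real 8) (0.57 * (1 - w)) / (1 + 0.57)\<^sup>2) - w))"
        using w 2 sq exc(2)[of "0.57 * (1 - w)"]
        by (intro chord_bound_keep[OF p w(1) _ _ nn, where lo = "0.02075" and ell = "0.00535" and ?e0.0 = "0.17043" and ?e1.0 = "0.1845"])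
           (simp_all add: power2_eq_square field_simps)
    qed (use p w 2 in \<open>auto simp: field_simps\<close>)
  next
    case 3
    have sq: "0 \<le> (w - 0.125)\<^sup>2" "0 \<le> (w - 0.125) * (200 / 1493 - w)" using w 3 by simp_all
    show thesis
    proof (rule that[of "0.66" "7"])
      show "(1 - 7.465 * w) * (0.66 / (1 + 0.66) * (1 - w) - w) \<le> 9.465 * (((1 - 2 * p) * (1 - w) - w) *
        ((1 - p) * (p * (1 - w) / (1 + p + (1 - p) * w\<^sup>2)
          - binomial_excess p 7 (1 / real 7) (0.66 * (1 - w)) / (1 + 0.66)\<^sup>2) - w))"
        using w 3 sq exc(3)[of "0.66 * (1 - w)"]
        by (intro chord_bound_keep[OF p w(1) _ _ nn, where lo = "0.01168" and ell = "0.00269" and ?e0.0 = "0.17059" and ?e1.0 = "0.1861"])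
           (simp_all add: power2_eq_square field_simps)
    qed (use p w 3 in \<open>auto simp: field_simps\<close>)
  qed
qed

section \<open>The averaging argument\<close>

lemma binomial_excess_antimono:
  assumes "0 \<le> p" "p \<le> 1" "z' \<le> z"
  shows "binomial_excess p n l z \<le> binomial_excess p n l z'"
  unfolding binomial_excess_def
  by (rule sum_mono, rule mult_left_mono) (use assms in auto)

lemma subset_mean_affine:
  "finite X \<Longrightarrow> subset_mean p X (\<lambda>A. a * g A + b) = a * subset_mean p X g + b"
  by (simp add: subset_mean_add subset_mean_cmult subset_mean_const)

text \<open>The excess is a convex function of the sampled weight, and
  \<open>l = sum d P / n\<close> makes the total exactly \<open>n * l\<close>, as the extremal
  binomial case requires.\<close>

lemma subset_mean_excess_le:
  assumes "finite P" "0 \<le> p" "p \<le> 1" "\<And>x. x \<in> P \<Longrightarrow> 0 \<le> d x"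
    "\<And>x. x \<in> P \<Longrightarrow> real n * d x \<le> sum d P" "0 < n" "0 < sum d P"
  shows "subset_mean p P (\<lambda>T. max 0 (sum d T - z)) \<le> binomial_excess p n (sum d P / real n) z"
  unfolding binomial_excess_def
proof (rule subset_mean_convex_le_binomial[where \<phi> = "\<lambda>u. max 0 (u - z)"])
  show "convex_on UNIV (\<lambda>u. max 0 (u - z))"
  proof (rule convex_onI)
    fix t x y :: real assume t: "0 < t" "t < 1"
    have "(1 - t) * (x - z) \<le> (1 - t) * max 0 (x - z)" "t * (y - z) \<le> t * max 0 (y - z)"
      using t by (auto intro!: mult_left_mono)
    moreover have "(1 - t) * x + t * y - z = (1 - t) * (x - z) + t * (y - z)"
      by (simp add: algebra_simps)
    moreover have "0 \<le> (1 - t) * max 0 (x - z)" "0 \<le> t * max 0 (y - z)" using t by auto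
    ultimately show "max 0 ((1 - t) *\<^sub>R x + t *\<^sub>R y - z) \<le>
        (1 - t) * max 0 (x - z) + t * max 0 (y - z)" by auto
  qed simp
qed (use assms in \<open>auto simp: field_simps\<close>)

text \<open>Two linearizations. The tangent of \<open>1 / q\<close> at \<open>qm\<close> makes the
  ratio a polynomial in \<open>d\<close> and \<open>d * c\<close>, whose means are known. For the
  cap, \<open>s * d \<le> G * c\<close> bounds the ratio by \<open>d * G / (G + d)\<close>, which
  equals the cap at \<open>d = \<delta> * G\<close> and rises beyond it with slope at most
  \<open>1 / (1 + \<delta>)\<^sup>2\<close>.\<close>

lemma capped_ratio_bound:
  fixes d c s G \<delta> qm :: real
  assumes "0 \<le> d" "0 \<le> c" "0 < s" "0 < G" "0 < \<delta>" "0 < qm" "s * d \<le> G * c"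
  shows "2 / qm * d - (d + d * c / s) / qm\<^sup>2 - max 0 (d - \<delta> * G) / (1 + \<delta>)\<^sup>2
    \<le> min (d / (1 + c / s)) (\<delta> / (1 + \<delta>) * G)"
proof -
  define q where "q = 1 + c / s"
  have q: "1 + d / G \<le> q" "0 < q" using assms by (auto simp: q_def field_simps add_pos_nonneg)
  have "0 \<le> (q - qm)\<^sup>2" by simp
  then have "2 * qm * q - q\<^sup>2 \<le> qm\<^sup>2" by (simp add: power2_eq_square algebra_simps)
  then have "2 / qm - q / qm\<^sup>2 \<le> 1 / q"
    using assms q by (simp add: divide_simps power2_eq_square) (simp add: algebra_simps)
  then have "d * (2 / qm - q / qm\<^sup>2) \<le> d * (1 / q)" using assms by (intro mult_left_mono) auto
  moreover have "d + d * c / s = d * q" by (simp add: q_def distrib_left)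
  ultimately have 1: "2 / qm * d - (d + d * c / s) / qm\<^sup>2 \<le> d / q"
    by (simp add: right_diff_distrib mult.commute)
  have 2: "d / q - max 0 (d - \<delta> * G) / (1 + \<delta>)\<^sup>2 \<le> \<delta> / (1 + \<delta>) * G"
  proof -
    have "d / q \<le> d / (1 + d / G)" using q assms by (intro divide_left_mono mult_pos_pos) (auto intro: add_pos_nonneg)
    also have "\<dots> = d * G / (G + d)" using assms by (simp add: field_simps)
    finally have dq: "d / q \<le> d * G / (G + d)" .
    have id: "d * G / (G + d) - \<delta> / (1 + \<delta>) * G = G / (G + d) * ((d - \<delta> * G) / (1 + \<delta>))"
      using assms by (simp add: divide_simps) (simp add: algebra_simps)
    show ?thesis
    proof (cases "d \<le> \<delta> * G")
      case True
      have "G / (G + d) * ((d - \<delta> * G) / (1 + \<delta>)) \<le> 0"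
        using True assms by (intro mult_nonneg_nonpos divide_nonpos_pos) auto
      then show ?thesis using dq id True by simp
    next
      case False
      have "G / (G + d) \<le> 1 / (1 + \<delta>)" using False assms by (simp add: field_simps)
      then have "G / (G + d) * ((d - \<delta> * G) / (1 + \<delta>)) \<le> 1 / (1 + \<delta>) * ((d - \<delta> * G) / (1 + \<delta>))"
        using False assms by (intro mult_right_mono) auto
      also have "\<dots> = max 0 (d - \<delta> * G) / (1 + \<delta>)\<^sup>2" using False by (simp add: power2_eq_square)
      finally show ?thesis using dq id by linarith
    qed
  qed
  have "0 \<le> max 0 (d - \<delta> * G) / (1 + \<delta>)\<^sup>2" by simp
  then show ?thesis using 1 2 unfolding q_def[symmetric] by linarith
qed

text \<open>On the interval from \<open>w\<close> to \<open>X\<close>, the concave function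
  \<open>min A x - w\<close> lies above the chord from \<open>(w, 0)\<close> to
  \<open>(X, A - w)\<close>. So the true cap \<open>A\<close> can be exchanged for a larger cap
  \<open>X\<close> at the price of the slope, and less of the fluctuating sampled value is cut
  off.\<close>

lemma chord_min:
  fixes w A X z u :: real
  assumes "0 \<le> w" "w < A" "A \<le> X" "w \<le> b" "min A (z * u) \<le> b" "0 \<le> z" "0 \<le> u" "u \<le> 1"
  shows "(A - w) / (X - w) * (min z X * u - w) \<le> b - w"
proof -
  define \<kappa> where "\<kappa> = (A - w) / (X - w)"
  have \<kappa>: "0 \<le> \<kappa>" "\<kappa> \<le> 1" "\<kappa> * (X - w) = A - w" using assms by (auto simp: \<kappa>_def)
  define m where "m = min z X * u"
  have "m \<le> X * u" unfolding m_def using assms by (intro mult_right_mono) auto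
  also have "\<dots> \<le> X" using assms by (intro mult_left_le) auto
  finally have mX: "m \<le> X" .
  have mz: "m \<le> z * u" unfolding m_def using assms by (intro mult_right_mono) auto
  have "\<kappa> * (m - w) \<le> b - w"
  proof (cases "m \<le> w")
    case True
    then have "\<kappa> * (m - w) \<le> 0" using \<kappa> by (intro mult_nonneg_nonpos) auto
    then show ?thesis using assms by linarith
  next
    case False
    have "\<kappa> * (m - w) \<le> \<kappa> * (X - w)" using \<kappa> mX by (intro mult_left_mono) auto
    moreover have "\<kappa> * (m - w) \<le> 1 * (m - w)" using \<kappa> False by (intro mult_right_mono) auto
    ultimately show ?thesis using \<kappa>(3) mz assms(5) by (auto simp: min_def split: if_splits)
  qed
  then show ?thesis by (simp add: \<kappa>_def m_def)
qed

text \<open>A sample splits into \<open>T\<close> inside \<open>P\<close> and \<open>Q\<close>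
  outside. For fixed \<open>T\<close>, the bound of \<open>chord_min\<close> is affine in
  \<open>sum k Q\<close>, whose mean is at most \<open>p\<close>; this produces the factor
  \<open>1 - p\<close>. The mean over \<open>T\<close> then needs only the moments in
  \<open>capped_ratio_bound\<close> and the extremal excess.\<close>

lemma family_bound:
  fixes \<beta> :: "'a set \<Rightarrow> real" and d c :: "'a \<Rightarrow> real"
  assumes fin: "finite X" and PX: "P \<subseteq> X" and p: "0 \<le> p" "p \<le> 1"
    and d: "\<And>x. x \<in> P \<Longrightarrow> 0 \<le> d x" "\<And>x. x \<in> P \<Longrightarrow> d x \<le> w"
    and c: "\<And>x. x \<in> P \<Longrightarrow> 0 \<le> c x"
    and dc: "\<And>x. x \<in> P \<Longrightarrow> s * d x \<le> G * c x"
    and n: "\<And>x. x \<in> P \<Longrightarrow> real n * d x \<le> sum d P" "0 < n" "0 < sum d P"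
    and pos: "0 < s" "0 < G" "0 < \<delta>" "0 < qm" and w: "0 \<le> w" "w < a * G" "a \<le> \<delta> / (1 + \<delta>)"
    and \<beta>w: "\<And>H. H \<subseteq> X \<Longrightarrow> w \<le> \<beta> H"
    and \<beta>: "\<And>T. T \<subseteq> P \<Longrightarrow> \<exists>k. (\<forall>z\<in>X - P. 0 \<le> k z) \<and> sum k (X - P) \<le> 1 \<and>
      (\<forall>Q\<subseteq>X - P. min (a * G) (sum d T / (1 + sum c T / s) * (1 - sum k Q)) \<le> \<beta> (T \<union> Q))"
  shows "(a * G - w) / (\<delta> / (1 + \<delta>) * G - w) * ((1 - p) * (2 / qm * (p * sum d P)
      - (p * sum d P + (p\<^sup>2 * (sum d P * sum c P) + p * (1 - p) * (w * sum c P)) / s) / qm\<^sup>2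
      - binomial_excess p n (sum d P / real n) (\<delta> * G) / (1 + \<delta>)\<^sup>2) - w)
    \<le> subset_mean p X \<beta> - w"
proof -
  let ?X = "\<delta> / (1 + \<delta>) * G"
  define \<kappa> where "\<kappa> = (a * G - w) / (?X - w)"
  let ?m = "\<lambda>T. min (sum d T / (1 + sum c T / s)) ?X"
  have aG: "a * G \<le> ?X" using w pos by (intro mult_right_mono) auto
  have \<kappa>: "0 \<le> \<kappa>" using w aG by (auto simp: \<kappa>_def)
  have finP: "finite P" using fin PX finite_subset by auto
  have inner: "\<kappa> * ((1 - p) * ?m T - w) \<le> subset_mean p (X - P) (\<lambda>Q. \<beta> (T \<union> Q) - w)"
    if T: "T \<subseteq> P" for T
  proof -
    from \<beta>[OF T] obtain k where k: "\<And>z. z \<in> X - P \<Longrightarrow> 0 \<le> k z" "sum k (X - P) \<le> 1"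
      "\<And>Q. Q \<subseteq> X - P \<Longrightarrow> min (a * G) (sum d T / (1 + sum c T / s) * (1 - sum k Q)) \<le> \<beta> (T \<union> Q)"
      by blast
    have dT: "0 \<le> sum d T" "0 \<le> sum c T" using T d c by (auto intro!: sum_nonneg)
    have z: "0 \<le> sum d T / (1 + sum c T / s)" using dT pos by simp
    have m0: "0 \<le> ?m T" using z pos by simp
    have "\<kappa> * ((1 - p) * ?m T - w) \<le> \<kappa> * ((1 - p * sum k (X - P)) * ?m T - w)"
      using \<kappa> p k(2) m0 mult_left_mono[OF k(2) p(1)]
      by (intro mult_left_mono diff_right_mono mult_right_mono) auto
    also have "\<dots> = subset_mean p (X - P) (\<lambda>Q. (- \<kappa> * ?m T) * sum k Q + (\<kappa> * ?m T - \<kappa> * w))"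
      using fin p subset_mean_sum[of "X - P" p k]
      by (subst subset_mean_affine) (simp_all add: left_diff_distrib right_diff_distrib)
    also have "\<dots> \<le> subset_mean p (X - P) (\<lambda>Q. \<beta> (T \<union> Q) - w)"
    proof (rule subset_mean_mono)
      fix Q assume Q: "Q \<subseteq> X - P"
      have "sum k Q \<le> sum k (X - P)" using Q fin k(1) by (intro sum_mono2) auto
      moreover have "0 \<le> sum k Q" using Q k(1) by (intro sum_nonneg) auto
      ultimately have "\<kappa> * (?m T * (1 - sum k Q) - w) \<le> \<beta> (T \<union> Q) - w"
        unfolding \<kappa>_def using w aG k(2,3) Q z T PX by (intro chord_min \<beta>w) auto
      then show "(- \<kappa> * ?m T) * sum k Q + (\<kappa> * ?m T - \<kappa> * w) \<le> \<beta> (T \<union> Q) - w"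
        by (simp add: algebra_simps)
    qed (use fin in auto)
    finally show ?thesis .
  qed
  let ?E = "2 / qm * (p * sum d P)
      - (p * sum d P + (p\<^sup>2 * (sum d P * sum c P) + p * (1 - p) * (w * sum c P)) / s) / qm\<^sup>2
      - binomial_excess p n (sum d P / real n) (\<delta> * G) / (1 + \<delta>)\<^sup>2"
  have E: "?E \<le> subset_mean p P ?m"
  proof -
    have dcs: "(\<Sum>x\<in>P. d x * c x) \<le> w * sum c P"
      unfolding sum_distrib_left using d c by (intro sum_mono mult_right_mono) auto
    have "?E \<le> 2 / qm * (p * sum d P)
      - (p * sum d P + (p\<^sup>2 * (sum d P * sum c P) + p * (1 - p) * (\<Sum>x\<in>P. d x * c x)) / s) / qm\<^sup>2
      - subset_mean p P (\<lambda>T. max 0 (sum d T - \<delta> * G)) / (1 + \<delta>)\<^sup>2"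
      using subset_mean_excess_le[of P p d n "\<delta> * G"] finP p d n dcs pos
      by (intro diff_mono divide_right_mono add_mono mult_left_mono order_refl) auto
    also have "\<dots> = subset_mean p P (\<lambda>T. 2 / qm * sum d T - 1 / qm\<^sup>2 * (sum d T + 1 / s * (sum d T * sum c T))
        - 1 / (1 + \<delta>)\<^sup>2 * max 0 (sum d T - \<delta> * G))"
      using finP p
      by (simp only: subset_mean_diff subset_mean_add subset_mean_cmult subset_mean_sum
            subset_mean_sum_mult_sum) simp
    also have "\<dots> \<le> subset_mean p P ?m"
    proof (rule subset_mean_mono[OF finP])
      fix T assume T: "T \<subseteq> P"
      have "s * sum d T \<le> G * sum c T"
        unfolding sum_distrib_left using T dc by (intro sum_mono) auto
      moreover have "0 \<le> sum d T" "0 \<le> sum c T" using T d c by (auto intro!: sum_nonneg)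
      ultimately show "2 / qm * sum d T - 1 / qm\<^sup>2 * (sum d T + 1 / s * (sum d T * sum c T))
        - 1 / (1 + \<delta>)\<^sup>2 * max 0 (sum d T - \<delta> * G) \<le> ?m T"
        using capped_ratio_bound[of "sum d T" "sum c T" s G \<delta> qm] pos by simp
    qed
    finally show ?thesis .
  qed
  have "\<kappa> * ((1 - p) * ?E - w) \<le> \<kappa> * ((1 - p) * subset_mean p P ?m - w)"
    using \<kappa> p E by (intro mult_left_mono diff_right_mono) auto
  also have "\<dots> = subset_mean p P (\<lambda>T. (\<kappa> * (1 - p)) * ?m T + (- \<kappa> * w))"
    using finP by (subst subset_mean_affine) (simp_all add: right_diff_distrib)
  also have "\<dots> \<le> subset_mean p P (\<lambda>T. subset_mean p (X - P) (\<lambda>Q. \<beta> (T \<union> Q) - w))"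
  proof (rule subset_mean_mono[OF finP])
    fix T assume T: "T \<subseteq> P"
    have "(\<kappa> * (1 - p)) * y + (- \<kappa> * w) = \<kappa> * ((1 - p) * y - w)" for y
      by (simp add: algebra_simps)
    then show "(\<kappa> * (1 - p)) * ?m T + (- \<kappa> * w) \<le> subset_mean p (X - P) (\<lambda>Q. \<beta> (T \<union> Q) - w)"
      using inner[OF T] by simp
  qed
  also have "\<dots> = subset_mean p (P \<union> (X - P)) (\<lambda>H. \<beta> H - w)"
    using fin finP p by (intro subset_mean_union[symmetric]) auto
  also have "P \<union> (X - P) = X" using PX by auto
  also have "subset_mean p X (\<lambda>H. \<beta> H - w) = subset_mean p X \<beta> - w"
    using fin by (simp add: subset_mean_diff subset_mean_const)
  finally show ?thesis unfolding \<kappa>_def .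
qed

text \<open>The slope of the chord increases with \<open>G\<close> because \<open>a < u\<close>, so
  \<open>G\<close> can be replaced by its worst-case value, \<open>1 - w\<close> or 1.\<close>

lemma chord_factor_mono:
  fixes a u w g G y Y :: real
  assumes "0 \<le> w" "w < a * g" "a < u" "0 < g" "g \<le> G" "0 \<le> y" "y \<le> Y"
  shows "(a * g - w) / (u * g - w) * y \<le> (a * G - w) / (u * G - w) * Y"
proof -
  have "0 < a * g" using assms by linarith
  then have "0 < a" using assms(4) by (simp add: zero_less_mult_iff)
  then have G: "a * g \<le> a * G" using assms by (intro mult_left_mono) auto
  have u: "a * g < u * g" "a * G < u * G" using assms by auto
  have X: "0 < u * g - w" "0 < u * G - w" using u G assms by linarith+
  have "w * ((u - a) * g) \<le> w * ((u - a) * G)" using assms by (intro mult_left_mono) auto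
  then have "(a * g - w) * (u * G - w) \<le> (a * G - w) * (u * g - w)"
    by (simp add: algebra_simps)
  then have "(a * g - w) / (u * g - w) \<le> (a * G - w) / (u * G - w)"
    using X by (simp add: pos_divide_le_eq pos_le_divide_eq)
  moreover have "0 \<le> (a * G - w) / (u * G - w)"
    using X(2) G assms(2) by (intro divide_nonneg_pos) linarith+
  ultimately show ?thesis using assms by (intro mult_mono) auto
qed

lemma chord_ratio:
  fixes a k A y X :: real
  assumes "0 < X" "a * X \<le> k * (A * y)" "0 < k"
  shows "a / k \<le> A / X * y"
proof -
  have "a * X \<le> (A * y) * k" using assms(2) by (simp add: mult_ac)
  then have "a / k * X \<le> A * y" using assms(3) by (simp add: pos_divide_le_eq)
  then have "a / k \<le> A * y / X" using assms(1) by (simp add: pos_le_divide_eq)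
  then show ?thesis by simp
qed

text \<open>Budget and total weight are scaled to 1, so the estimate depends only on
  \<open>w = max v W\<close>. \<open>family_bound\<close> is applied either to all of
  \<open>I\<close> or to \<open>I\<close> without its most expensive element.\<close>

lemma averaging_normalized:
  fixes \<beta> :: "'a set \<Rightarrow> real" and d c :: "'a \<Rightarrow> real"
  assumes p: "0.36602 \<le> p" "p \<le> 0.36603" "2 * p\<^sup>2 = 1 - 2 * p"
    and fin: "finite X" and IX: "I \<subseteq> X"
    and d: "\<And>x. x \<in> I \<Longrightarrow> 0 < d x" "\<And>x. x \<in> I \<Longrightarrow> d x \<le> W" "sum d I = 1"
    and c: "\<And>x. x \<in> I \<Longrightarrow> 1 \<le> N * c x" "sum c I \<le> 1" and N: "0 < N" and v: "0 \<le> v"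
    and \<beta>vW: "\<And>H. H \<subseteq> X \<Longrightarrow> v \<le> \<beta> H" "\<And>H. H \<subseteq> X \<Longrightarrow> W \<le> \<beta> H"
    and \<beta>: "\<And>P T \<gamma>. P \<subseteq> I \<Longrightarrow> T \<subseteq> P \<Longrightarrow> (\<And>x. x \<in> P \<Longrightarrow> c x \<le> \<gamma>) \<Longrightarrow> 0 < \<gamma> \<Longrightarrow> \<gamma> < 1 \<Longrightarrow>
      \<exists>k. (\<forall>z\<in>X - P. 0 \<le> k z) \<and> sum k (X - P) \<le> 1 \<and>
      (\<forall>Q\<subseteq>X - P. min ((1 - 2 * p) * (N * W * (1 - \<gamma>)))
         (sum d T / (1 + sum c T / (1 - \<gamma>)) * (1 - sum k Q)) \<le> \<beta> (T \<union> Q))"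
  shows "2 * v + 1 \<le> 9.465 * subset_mean p X \<beta>"
proof -
  define w where "w = max v W"
  have finI: "finite I" using fin IX finite_subset by auto
  have c0: "0 < c x" if "x \<in> I" for x
    using c(1)[OF that] N by (smt (verit) mult_nonneg_nonpos)
  have p01: "0 \<le> p" "p \<le> 1" using p by auto
  have \<beta>w: "w \<le> \<beta> H" if "H \<subseteq> X" for H using \<beta>vW[OF that] by (simp add: w_def)
  have mean_w: "w \<le> subset_mean p X \<beta>"
    using subset_mean_mono[OF fin, of "\<lambda>_. w" \<beta> p] \<beta>w by (simp add: subset_mean_const)
  show ?thesis
  \<comment> \<open>\<open>200 / 1493\<close> is the reciprocal of \<open>7.465 = 9.465 - 2\<close>;
    from there on \<open>2 * w + 1 \<le> 9.465 * w\<close>.\<close>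
  proof (cases "200 / 1493 \<le> w")
    case True
    then have "2 * v + 1 \<le> 9.465 * w" by (simp add: w_def)
    then show ?thesis using mean_w by simp
  next
    case False
    then have w: "0 \<le> w" "w < 200 / 1493" using v by (auto simp: w_def)
    have dw: "d x \<le> w" if "x \<in> I" for x using d(2)[OF that] by (simp add: w_def)
    \<comment> \<open>Every element of \<open>I\<close> costs at least \<open>1 / N\<close>, so
      \<open>d x \<le> W \<le> K * c x\<close>: this \<open>K\<close> bounds the value per cost.
      With remaining room \<open>s\<close>, the product \<open>K * s\<close> plays the role of
      \<open>G\<close>.\<close>
    define K where "K = N * W"
    have "I \<noteq> {}" using d(3) by auto
    have W: "0 < W" using \<open>I \<noteq> {}\<close> d(1,2) by fastforce
    have K: "0 < K" using W N by (simp add: K_def)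
    have Kc: "d x \<le> K * c x" if "x \<in> I" for x
    proof -
      have "W * 1 \<le> W * (N * c x)" using c(1)[OF that] W by (intro mult_left_mono) auto
      then show ?thesis using d(2)[OF that] by (simp add: K_def mult_ac)
    qed
    have sumKc: "sum d A \<le> K * sum c A" if "A \<subseteq> I" for A
      unfolding sum_distrib_left using that Kc by (intro sum_mono) auto
    obtain o1 where o1: "o1 \<in> I" "\<And>x. x \<in> I \<Longrightarrow> c x \<le> c o1"
    proof -
      have "Max (c ` I) \<in> c ` I" using finI \<open>I \<noteq> {}\<close> by (intro Max_in) auto
      then obtain y where "y \<in> I" "c y = Max (c ` I)" by auto
      then show ?thesis using that[of y] finI by auto
    qed
    define J where "J = I - {o1}"
    have J: "J \<subseteq> I" "finite J" "sum d I = d o1 + sum d J" "sum c I = c o1 + sum c J"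
      using o1(1) finI by (auto simp: J_def intro!: sum.remove)
    have dJ: "1 - w \<le> sum d J" using J(3) d(3) dw[OF o1(1)] by linarith
    then have "J \<noteq> {}" using w by auto
    have finish: "2 * v + 1 \<le> 9.465 * subset_mean p X \<beta>"
      if "(1 - 7.465 * w) / 9.465 \<le> subset_mean p X \<beta> - w"
    proof -
      have "v \<le> w" by (simp add: w_def)
      then show ?thesis using that by (simp add: field_simps)
    qed
    show ?thesis
    \<comment> \<open>If \<open>o1\<close> is cheap in this sense, leaving room for it costs little,
      as \<open>1 / s \<le> (1 + w) / (1 - w)\<close>. Otherwise dropping it loses weight at most
      \<open>w\<close>, while the budget that it occupied lifts \<open>G\<close> to at least
      1.\<close>
    proof (cases "K * c o1 \<le> 2 * w")
      case True
      from parameters_keep[OF p w] obtain \<delta> n where \<delta>: "0 < \<delta>" "0 < n" "real n * w \<le> 1"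
        "1 - 2 * p < \<delta> / (1 + \<delta>)"
        "(1 - 7.465 * w) * (\<delta> / (1 + \<delta>) * (1 - w) - w) \<le> 9.465 * (((1 - 2 * p) * (1 - w) - w) *
          ((1 - p) * (p * (1 - w) / (1 + p + (1 - p) * w\<^sup>2)
            - binomial_excess p n (1 / real n) (\<delta> * (1 - w)) / (1 + \<delta>)\<^sup>2) - w))" by blast
      define s where "s = 1 - c o1"
      define G where "G = K * s"
      have "sum c J \<le> s" using J(4) c(2) by (simp add: s_def)
      moreover have "0 < sum c J" using J(1,2) \<open>J \<noteq> {}\<close> c0 by (intro sum_pos) auto
      ultimately have s: "0 < s" by simp
      have "1 - w \<le> K * sum c J" using dJ sumKc[OF J(1)] by linarith
      also have "\<dots> \<le> G" unfolding G_def using \<open>sum c J \<le> s\<close> K by (intro mult_left_mono) auto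
      finally have G: "1 - w \<le> G" .
      have G0: "0 < G" using G w by simp
      \<comment> \<open>The best tangent point is the mean of \<open>1 + sum c T / s\<close>
        weighted by \<open>sum d T\<close>. This \<open>qm\<close> is that mean after inserting the
        bounds on \<open>sum c I\<close>, on the diagonal sum and on \<open>1 / s\<close>; the
        tangent estimate then collapses to \<open>p / qm\<close>.\<close>
      define qm where "qm = (1 + p + (1 - p) * w\<^sup>2) / (1 - w)"
      have qm0: "0 < qm" using p w by (auto simp: qm_def intro!: divide_pos_pos add_pos_nonneg)
      have inv_s: "1 / s \<le> (1 + w) / (1 - w)"
      proof -
        have "K * (c o1 * (1 - w)) = (K * c o1) * (1 - w)" by simp
        also have "\<dots> \<le> 2 * w * G" by (rule mult_mono[OF True G]) (use w in auto)
        also have "\<dots> = K * (2 * w * s)" by (simp add: G_def)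
        finally have "c o1 * (1 - w) \<le> 2 * w * s" using K by simp
        then have "1 - w \<le> (1 + w) * s" by (simp add: s_def algebra_simps)
        then show ?thesis using s w by (simp add: divide_simps)
      qed
      have qm_ge: "1 + (p + (1 - p) * w) / s \<le> qm"
      proof -
        have "(p + (1 - p) * w) * (1 / s) \<le> (p + (1 - p) * w) * ((1 + w) / (1 - w))"
          using inv_s p w by (intro mult_left_mono) auto
        moreover have "1 + (p + (1 - p) * w) * ((1 + w) / (1 - w)) = qm"
          using w by (simp add: qm_def divide_simps) (simp add: algebra_simps power2_eq_square)
        ultimately show ?thesis by simp
      qed
      let ?Y = "(1 - p) * (2 / qm * (p * sum d I)
        - (p * sum d I + (p\<^sup>2 * (sum d I * sum c I) + p * (1 - p) * (w * sum c I)) / s) / qm\<^sup>2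
        - binomial_excess p n (sum d I / real n) (\<delta> * G) / (1 + \<delta>)\<^sup>2) - w"
      let ?y = "(1 - p) * (p * (1 - w) / (1 + p + (1 - p) * w\<^sup>2)
            - binomial_excess p n (1 / real n) (\<delta> * (1 - w)) / (1 + \<delta>)\<^sup>2) - w"
      have mean: "((1 - 2 * p) * G - w) / (\<delta> / (1 + \<delta>) * G - w) * ?Y \<le> subset_mean p X \<beta> - w"
      proof (rule family_bound[OF fin IX p01])
        show "s * d x \<le> G * c x" if "x \<in> I" for x
          using Kc[OF that] s unfolding G_def by (simp add: mult.commute mult.left_commute)
        show "real n * d x \<le> sum d I" if "x \<in> I" for x
          using mult_left_mono[OF dw[OF that], of "real n"] \<delta>(3) d(3) by simp
        have "0.26794 * (1 - w) \<le> (1 - 2 * p) * G" using p G w by (intro mult_mono) auto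
        then show "w < (1 - 2 * p) * G" using w by simp
        show "\<exists>k. (\<forall>z\<in>X - I. 0 \<le> k z) \<and> sum k (X - I) \<le> 1 \<and>
            (\<forall>Q\<subseteq>X - I. min ((1 - 2 * p) * G) (sum d T / (1 + sum c T / s) * (1 - sum k Q)) \<le> \<beta> (T \<union> Q))"
          if "T \<subseteq> I" for T
          using \<beta>[OF order_refl that, of "c o1"] o1 c0[OF o1(1)] s by (simp add: G_def K_def s_def)
      qed (use d dw c0 s G0 qm0 w \<delta> \<beta>w in \<open>auto simp: less_imp_le\<close>)
      have "p * (1 - w) / (1 + p + (1 - p) * w\<^sup>2) = p / qm" by (simp add: qm_def)
      also have "\<dots> = 2 / qm * p - (p * qm) / qm\<^sup>2"
        using qm0 by (simp add: power2_eq_square divide_simps)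
      also have "\<dots> \<le> 2 / qm * p - (p * (1 + (p + (1 - p) * w) / s)) / qm\<^sup>2"
        using qm_ge p by (intro diff_left_mono divide_right_mono mult_left_mono) auto
      also have "\<dots> \<le> 2 / qm * (p * sum d I)
        - (p * sum d I + (p\<^sup>2 * (sum d I * sum c I) + p * (1 - p) * (w * sum c I)) / s) / qm\<^sup>2"
      proof -
        have "p\<^sup>2 * (1 * sum c I) + p * (1 - p) * (w * sum c I) = (p\<^sup>2 + p * (1 - p) * w) * sum c I"
          by (simp add: algebra_simps)
        also have "\<dots> \<le> (p\<^sup>2 + p * (1 - p) * w) * 1"
          using c(2) p w by (intro mult_left_mono) auto
        finally have "p + (p\<^sup>2 * (1 * sum c I) + p * (1 - p) * (w * sum c I)) / s \<le>
            p + (p\<^sup>2 + p * (1 - p) * w) / s"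
          using s by (intro add_left_mono divide_right_mono) auto
        also have "\<dots> = p * (1 + (p + (1 - p) * w) / s)"
          by (simp add: distrib_left power2_eq_square add_divide_distrib mult.assoc)
        finally show ?thesis
          unfolding d(3) by (intro diff_mono divide_right_mono) auto
      qed
      finally have E: "p * (1 - w) / (1 + p + (1 - p) * w\<^sup>2) \<le> 2 / qm * (p * sum d I)
        - (p * sum d I + (p\<^sup>2 * (sum d I * sum c I) + p * (1 - p) * (w * sum c I)) / s) / qm\<^sup>2" .
      have "binomial_excess p n (sum d I / real n) (\<delta> * G) \<le> binomial_excess p n (1 / real n) (\<delta> * (1 - w))"
        unfolding d(3) using p01 G \<delta> by (intro binomial_excess_antimono) auto
      then have yY: "?y \<le> ?Y"
        using E p by (intro diff_right_mono mult_left_mono diff_mono divide_right_mono) auto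
      have A: "w < (1 - 2 * p) * (1 - w)"
      proof -
        have "0.26794 * (1 - w) \<le> (1 - 2 * p) * (1 - w)" using p w by (intro mult_right_mono) auto
        then show ?thesis using w by simp
      qed
      have X: "0 < \<delta> / (1 + \<delta>) * (1 - w) - w"
        using A mult_strict_right_mono[OF \<delta>(4), of "1 - w"] w by linarith
      have "0 < (1 - 7.465 * w) * (\<delta> / (1 + \<delta>) * (1 - w) - w)"
        using X w by (intro mult_pos_pos) auto
      then have "0 < 9.465 * (((1 - 2 * p) * (1 - w) - w) * ?y)"
        using \<delta>(5) by (rule order.strict_trans2)
      then have y: "0 \<le> ?y" using A by (simp add: zero_less_mult_iff)
      have "(1 - 7.465 * w) / 9.465 \<le> ((1 - 2 * p) * (1 - w) - w) / (\<delta> / (1 + \<delta>) * (1 - w) - w) * ?y"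
        by (rule chord_ratio[OF X \<delta>(5)]) simp
      also have "\<dots> \<le> ((1 - 2 * p) * G - w) / (\<delta> / (1 + \<delta>) * G - w) * ?Y"
        using w A \<delta>(4) G y yY by (intro chord_factor_mono) auto
      also note mean
      finally show ?thesis by (rule finish)
    next
      case False
      from parameters_drop[OF p w] obtain \<delta> n where \<delta>: "0 < \<delta>" "0 < n" "real n * w \<le> 1 - w"
        "1 - 2 * p < \<delta> / (1 + \<delta>)"
        "(1 - 7.465 * w) * (\<delta> / (1 + \<delta>) - w) \<le> 9.465 * ((1 - 2 * p - w) *
          ((1 - p) * (p * (1 - w)\<^sup>2 / (1 + p - 2 * p * w)
            - binomial_excess p n ((1 - w) / real n) \<delta> / (1 + \<delta>)\<^sup>2) - w))" by blast
      obtain o2 where o2: "o2 \<in> J" "\<And>x. x \<in> J \<Longrightarrow> c x \<le> c o2"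
      proof -
        have "Max (c ` J) \<in> c ` J" using J(2) \<open>J \<noteq> {}\<close> by (intro Max_in) auto
        then obtain y where "y \<in> J" "c y = Max (c ` J)" by auto
        then show ?thesis using that[of y] J(2) by auto
      qed
      have o2I: "o2 \<in> I" using o2 J by auto
      define L where "L = J - {o2}"
      have L: "L \<subseteq> I" "sum d J = d o2 + sum d L" "sum c J = c o2 + sum c L"
        using o2(1) J by (auto simp: L_def intro!: sum.remove)
      have cL: "0 \<le> sum c L" using L(1) c0 by (intro sum_nonneg) (auto simp: less_imp_le)
      define s where "s = 1 - c o2"
      define G where "G = K * s"
      have s_ge: "c o1 + sum c L \<le> s" using J(4) L(3) c(2) by (simp add: s_def)
      then have s: "0 < s" using cL c0[OF o1(1)] by linarith
      have cJ: "sum c J \<le> s" using J(4) c(2) o1(2)[OF o2I] by (simp add: s_def)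
      have cJ0: "0 \<le> sum c J" using J(1) c0 by (intro sum_nonneg) (auto simp: less_imp_le)
      \<comment> \<open>Removing \<open>o1\<close> and \<open>o2\<close> loses weight at most
        \<open>2 * w\<close>, and \<open>K * c o1 > 2 * w\<close> makes up for it.\<close>
      have "1 - 2 * w \<le> sum d L" using dJ L(2) dw[OF o2I] by linarith
      then have "1 \<le> K * c o1 + K * sum c L" using False sumKc[OF L(1)] by linarith
      also have "\<dots> = K * (c o1 + sum c L)" by (simp add: distrib_left)
      also have "\<dots> \<le> G" unfolding G_def using s_ge K by (intro mult_left_mono) auto
      finally have G: "1 \<le> G" .
      \<comment> \<open>The remaining weights are scaled down to total exactly \<open>1 - w\<close>,
        so that the estimates depend on \<open>w\<close> alone.\<close>
      define \<theta> where "\<theta> = (1 - w) / sum d J"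
      have \<theta>: "0 < \<theta>" "\<theta> \<le> 1" using dJ w by (auto simp: \<theta>_def)
      define e where "e = (\<lambda>x. \<theta> * d x)"
      have se: "sum e T = \<theta> * sum d T" for T by (simp add: e_def sum_distrib_left)
      have seJ: "sum e J = 1 - w" using dJ w by (simp add: se \<theta>_def)
      have e: "0 \<le> e x" "e x \<le> d x" if "x \<in> I" for x
        using \<theta> d(1)[OF that] mult_right_mono[OF \<theta>(2), of "d x"] by (auto simp: e_def)
      have ew: "e x \<le> w" if "x \<in> I" for x using e(2)[OF that] dw[OF that] by simp
      \<comment> \<open>The weighted mean again, now with total weight \<open>1 - w\<close> and
        \<open>sum c J \<le> s\<close>: it is \<open>1 + p + (1 - p) * w / (1 - w)\<close>.\<close>
      define qm where "qm = (1 + p - 2 * p * w) / (1 - w)"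
      have pw: "p * w \<le> 0.37 * w" using p w by (intro mult_right_mono) auto
      have num: "0 < 1 + p - 2 * p * w" using p w pw by (simp add: mult.assoc)
      have qm0: "0 < qm" using num w by (simp add: qm_def)
      let ?Y = "(1 - p) * (2 / qm * (p * sum e J)
        - (p * sum e J + (p\<^sup>2 * (sum e J * sum c J) + p * (1 - p) * (w * sum c J)) / s) / qm\<^sup>2
        - binomial_excess p n (sum e J / real n) (\<delta> * G) / (1 + \<delta>)\<^sup>2) - w"
      let ?y = "(1 - p) * (p * (1 - w)\<^sup>2 / (1 + p - 2 * p * w)
            - binomial_excess p n ((1 - w) / real n) \<delta> / (1 + \<delta>)\<^sup>2) - w"
      have aw: "w < 1 - 2 * p" using p w by simp
      have mean: "((1 - 2 * p) * G - w) / (\<delta> / (1 + \<delta>) * G - w) * ?Y \<le> subset_mean p X \<beta> - w"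
      proof (rule family_bound[OF fin _ p01])
        show "J \<subseteq> X" using J(1) IX by auto
        show "0 \<le> e x" "e x \<le> w" "0 \<le> c x" if "x \<in> J" for x
          using that J(1) e ew c0[of x] by auto
        show "s * e x \<le> G * c x" if "x \<in> J" for x
        proof -
          have "e x \<le> K * c x" using that J(1) e(2)[of x] Kc[of x] by force
          then show ?thesis using s unfolding G_def by (simp add: mult.commute mult.left_commute)
        qed
        show "real n * e x \<le> sum e J" if "x \<in> J" for x
          using mult_left_mono[OF ew, of x "real n"] that J(1) \<delta>(3) seJ by auto
        show "0 < sum e J" using seJ w by simp
        have "(1 - 2 * p) * 1 \<le> (1 - 2 * p) * G" using p G by (intro mult_left_mono) auto
        then show "w < (1 - 2 * p) * G" using aw by simp
        show "\<exists>k. (\<forall>z\<in>X - J. 0 \<le> k z) \<and> sum k (X - J) \<le> 1 \<and>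
            (\<forall>Q\<subseteq>X - J. min ((1 - 2 * p) * G) (sum e T / (1 + sum c T / s) * (1 - sum k Q)) \<le> \<beta> (T \<union> Q))"
          if T: "T \<subseteq> J" for T
        proof -
          have "\<exists>k. (\<forall>z\<in>X - J. 0 \<le> k z) \<and> sum k (X - J) \<le> 1 \<and>
            (\<forall>Q\<subseteq>X - J. min ((1 - 2 * p) * (N * W * (1 - c o2)))
              (sum d T / (1 + sum c T / (1 - c o2)) * (1 - sum k Q)) \<le> \<beta> (T \<union> Q))"
            using J(1) T o2 c0[OF o2I] s by (intro \<beta>) (auto simp: s_def)
          then obtain k where k: "\<forall>z\<in>X - J. 0 \<le> k z" "sum k (X - J) \<le> 1"
            "\<And>Q. Q\<subseteq>X - J \<Longrightarrow> min ((1 - 2 * p) * G) (sum d T / (1 + sum c T / s) * (1 - sum k Q)) \<le> \<beta> (T \<union> Q)"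
            unfolding G_def K_def s_def by blast
          have "min ((1 - 2 * p) * G) (sum e T / (1 + sum c T / s) * (1 - sum k Q)) \<le> \<beta> (T \<union> Q)"
            if Q: "Q \<subseteq> X - J" for Q
          proof -
            have "sum k Q \<le> sum k (X - J)" using Q fin k(1) by (intro sum_mono2) auto
            moreover have "sum e T \<le> sum d T" using T J(1) e by (intro sum_mono) auto
            moreover have "0 \<le> sum c T" using T J(1) c0 by (intro sum_nonneg) (auto simp: less_imp_le)
            ultimately have "sum e T / (1 + sum c T / s) * (1 - sum k Q) \<le>
                sum d T / (1 + sum c T / s) * (1 - sum k Q)"
              using k(2) s by (intro mult_right_mono divide_right_mono) auto
            then show ?thesis using k(3)[OF Q] by linarith
          qed
          then show ?thesis using k(1,2) by blast
        qed
      qed (use s G qm0 w \<delta> \<beta>w in \<open>auto simp: less_imp_le\<close>)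
      have "p * (1 - w)\<^sup>2 / (1 + p - 2 * p * w) = p * (1 - w) / qm"
        using w by (simp add: qm_def power2_eq_square)
      also have "\<dots> = 2 / qm * (p * (1 - w)) - (p * (1 - w) * qm) / qm\<^sup>2"
        using qm0 by (simp add: power2_eq_square divide_simps)
      also have "p * (1 - w) * qm = p * (1 - w) + (p\<^sup>2 * (1 - w) + p * (1 - p) * w)"
        using w by (simp add: qm_def) (simp add: algebra_simps power2_eq_square)
      also have "2 / qm * (p * (1 - w)) - (p * (1 - w) + (p\<^sup>2 * (1 - w) + p * (1 - p) * w)) / qm\<^sup>2 \<le>
        2 / qm * (p * sum e J)
        - (p * sum e J + (p\<^sup>2 * (sum e J * sum c J) + p * (1 - p) * (w * sum c J)) / s) / qm\<^sup>2"
      proof -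
        have "p\<^sup>2 * ((1 - w) * sum c J) + p * (1 - p) * (w * sum c J) =
            (p\<^sup>2 * (1 - w) + p * (1 - p) * w) * sum c J" by (simp add: algebra_simps)
        also have "\<dots> \<le> (p\<^sup>2 * (1 - w) + p * (1 - p) * w) * s"
          using cJ p w by (intro mult_left_mono) auto
        finally have "(p\<^sup>2 * ((1 - w) * sum c J) + p * (1 - p) * (w * sum c J)) / s \<le>
            p\<^sup>2 * (1 - w) + p * (1 - p) * w"
          using s by (simp add: pos_divide_le_eq)
        then show ?thesis
          unfolding seJ by (intro diff_mono divide_right_mono add_left_mono) auto
      qed
      finally have E: "p * (1 - w)\<^sup>2 / (1 + p - 2 * p * w) \<le> 2 / qm * (p * sum e J)
        - (p * sum e J + (p\<^sup>2 * (sum e J * sum c J) + p * (1 - p) * (w * sum c J)) / s) / qm\<^sup>2" .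
      have "binomial_excess p n (sum e J / real n) (\<delta> * G) \<le> binomial_excess p n ((1 - w) / real n) \<delta>"
        unfolding seJ using p01 G \<delta> by (intro binomial_excess_antimono) auto
      then have yY: "?y \<le> ?Y"
        using E p by (intro diff_right_mono mult_left_mono diff_mono divide_right_mono) auto
      have X: "0 < \<delta> / (1 + \<delta>) - w" using aw \<delta>(4) by linarith
      have "0 < (1 - 7.465 * w) * (\<delta> / (1 + \<delta>) - w)" using X w by (intro mult_pos_pos) auto
      then have "0 < 9.465 * ((1 - 2 * p - w) * ?y)" using \<delta>(5) by (rule order.strict_trans2)
      then have y: "0 \<le> ?y" using aw by (simp add: zero_less_mult_iff)
      have "(1 - 7.465 * w) / 9.465 \<le> (1 - 2 * p - w) / (\<delta> / (1 + \<delta>) - w) * ?y"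
        by (rule chord_ratio[OF X \<delta>(5)]) simp
      also have "\<dots> = ((1 - 2 * p) * 1 - w) / (\<delta> / (1 + \<delta>) * 1 - w) * ?y" by simp
      also have "\<dots> \<le> ((1 - 2 * p) * G - w) / (\<delta> / (1 + \<delta>) * G - w) * ?Y"
        using w aw \<delta>(4) G y yY by (intro chord_factor_mono) auto
      also note mean
      finally show ?thesis by (rule finish)
    qed
  qed
qed

section \<open>The threshold subroutine\<close>

lemma draw_ask_bind:
  "(draw P \<bind>\<^sub>q (\<lambda>A. ask (Q A) \<bind>\<^sub>q k A)) f =
     bind_pmf P (\<lambda>A. map_pmf (\<lambda>(y, r, q). (y, Suc r, card (Q A) + q)) (k A (restrict f (Q A)) f))"
  by (simp add: qbind_def draw_def ask_def bind_map_pmf bind_return_pmf map_pmf_comp case_prod_beta')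

lemma thresh_loop_unfold:
  "thresh_loop c B \<tau> \<epsilon> l S ctr X f =
     (if finite X \<and> X \<noteq> {} \<and> real ctr < l then
        bind_pmf (sample_seq c B S [] X) (\<lambda>A.
          let v = restrict f (thresh_queries c B S X A) in
          map_pmf (\<lambda>(y, r, q). (y, Suc r, card (thresh_queries c B S X A) + q))
            (thresh_loop c B \<tau> \<epsilon> l (S \<union> prefix_set A (k_star v c B \<tau> \<epsilon> S X A))
              (if j_star v c B \<tau> \<epsilon> S X A < i_star v c B \<tau> \<epsilon> S X A then ctr + 1 else ctr)
              (G_set v c B \<tau> S X A (k_star v c B \<tau> \<epsilon> S X A)) f))
      else return_pmf (S, 0, 0))"
proof (cases "finite X \<and> X \<noteq> {} \<and> real ctr < l")
  case True
  show ?thesis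
    unfolding thresh_loop.simps[of c B \<tau> \<epsilon> l S ctr X] if_P[OF True] draw_ask_bind Let_def by (rule refl)
next
  case False
  show ?thesis
    unfolding thresh_loop.simps[of c B \<tau> \<epsilon> l S ctr X] if_not_P[OF False] qreturn_def by (rule refl)
qed

lemma finite_sample_seq: "finite X \<Longrightarrow> finite (set_pmf (sample_seq c B S A X))"
proof (induction c B S A X rule: sample_seq.induct)
  case (1 c B S A X)
  then show ?case by (subst sample_seq.simps) auto
qed

lemma sample_seq_budget:
  assumes "A' \<in> set_pmf (sample_seq c B S A X)" "finite X" "distinct A" "set A \<inter> X = {}"
    "sum c (set A) + sum c S \<le> B" "\<And>x. x \<in> X \<Longrightarrow> c x + sum c (set A) + sum c S \<le> B"
  shows "distinct A' \<and> sum c (set A') + sum c S \<le> B"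
  using assms
proof (induction c B S A X rule: sample_seq.induct)
  case (1 c B S A X)
  show ?case
  proof (cases "X = {}")
    case True
    then show ?thesis using 1 by (simp add: sample_seq.simps)
  next
    case False
    let ?X = "\<lambda>a. {x \<in> X - {a}. c x + sum c (set (A @ [a])) + sum c S \<le> B}"
    from 1(2) False 1(3) obtain a where a: "a \<in> X"
      "A' \<in> set_pmf (sample_seq c B S (A @ [a]) (?X a))"
      by (subst (asm) sample_seq.simps) auto
    have "a \<notin> set A" using a 1 by auto
    show ?thesis
      by (rule 1(1)[of a]) (use 1(3-) a False \<open>a \<notin> set A\<close> in \<open>auto simp: add_ac\<close>)
  qed
qed

lemma prefix_set_append: "i \<le> length A \<Longrightarrow> prefix_set (A @ zs) i = prefix_set A i"
  by (simp add: prefix_set_def)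

lemma prefix_set_subset: "prefix_set A i \<subseteq> set A"
  by (simp add: prefix_set_def set_take_subset)

lemma finite_prefix_set [simp]: "finite (prefix_set A i)"
  by (simp add: prefix_set_def)

lemma prefix_set_length [simp]: "prefix_set A (length A) = set A"
  by (simp add: prefix_set_def)

text \<open>Naming the conditions behind \<open>i_star\<close> and \<open>j_star\<close> lets
  \<open>k_star\<close> be read as the first prefix length at which either holds, which suits an
  induction along the sampled sequence.\<close>

definition cost_stop where
  "cost_stop v c B \<tau> \<epsilon> S X A i \<longleftrightarrow> sum c (G_set v c B \<tau> S X A i) \<le> (1 - \<epsilon>) * sum c X"

definition loss_stop where
  "loss_stop v c B \<tau> \<epsilon> S X A j \<longleftrightarrow>
     \<epsilon> * (\<Sum>x \<in> G_set v c B \<tau> S X A j. marginal v {x} (S \<union> prefix_set A j))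
     \<le> (\<Sum>x \<in> E_set v c B S X A j. \<bar>marginal v {x} (S \<union> prefix_set A j)\<bar>)"

lemma i_star_alt: "i_star v c B \<tau> \<epsilon> S X A = Min (insert (length A) {i \<in> {1..length A}. cost_stop v c B \<tau> \<epsilon> S X A i})"
  by (simp add: i_star_def cost_stop_def)

lemma j_star_alt: "j_star v c B \<tau> \<epsilon> S X A = Min (insert (length A) {i \<in> {1..length A}. loss_stop v c B \<tau> \<epsilon> S X A i})"
  by (simp add: j_star_def loss_stop_def)

lemma k_star_alt: "k_star v c B \<tau> \<epsilon> S X A =
  Min (insert (length A) {i \<in> {1..length A}. cost_stop v c B \<tau> \<epsilon> S X A i \<or> loss_stop v c B \<tau> \<epsilon> S X A i})"
proof -
  let ?P = "{i \<in> {1..length A}. cost_stop v c B \<tau> \<epsilon> S X A i}"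
  let ?Q = "{i \<in> {1..length A}. loss_stop v c B \<tau> \<epsilon> S X A i}"
  have "{i \<in> {1..length A}. cost_stop v c B \<tau> \<epsilon> S X A i \<or> loss_stop v c B \<tau> \<epsilon> S X A i} = ?P \<union> ?Q" by auto
  moreover have "insert (length A) (?P \<union> ?Q) = insert (length A) ?P \<union> insert (length A) ?Q" by auto
  moreover have "Min (insert (length A) ?P \<union> insert (length A) ?Q) =
      min (Min (insert (length A) ?P)) (Min (insert (length A) ?Q))"
    by (intro Min_Un) auto
  ultimately show ?thesis unfolding k_star_def i_star_alt j_star_alt by simp
qed

lemma k_star_le: "k_star v c B \<tau> \<epsilon> S X A \<le> length A"
  unfolding k_star_alt by (intro Min_le) auto

lemma k_star_eqI:
  assumes "1 \<le> m" "m \<le> length A"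
    "cost_stop v c B \<tau> \<epsilon> S X A m \<or> loss_stop v c B \<tau> \<epsilon> S X A m"
    "\<And>i. 1 \<le> i \<Longrightarrow> i < m \<Longrightarrow> \<not> cost_stop v c B \<tau> \<epsilon> S X A i \<and> \<not> loss_stop v c B \<tau> \<epsilon> S X A i"
  shows "k_star v c B \<tau> \<epsilon> S X A = m"
  unfolding k_star_alt
proof (rule Min_eqI)
  fix y assume "y \<in> insert (length A) {i \<in> {1..length A}. cost_stop v c B \<tau> \<epsilon> S X A i \<or> loss_stop v c B \<tau> \<epsilon> S X A i}"
  then show "m \<le> y" using assms(2) assms(4)[of y] by (auto simp flip: not_less)
qed (use assms in auto)

lemma star_sets_cong:
  assumes "prefix_set A i = prefix_set A' i'"
  shows "X_set c B S X A i = X_set c B S X A' i'" "G_set v c B \<tau> S X A i = G_set v c B \<tau> S X A' i'"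
    "E_set v c B S X A i = E_set v c B S X A' i'"
    "cost_stop v c B \<tau> \<epsilon> S X A i = cost_stop v c B \<tau> \<epsilon> S X A' i'"
    "loss_stop v c B \<tau> \<epsilon> S X A i = loss_stop v c B \<tau> \<epsilon> S X A' i'"
  by (simp_all add: X_set_def G_set_def E_set_def cost_stop_def loss_stop_def assms)

text \<open>The queries cover every set consulted at the indices 1 to \<open>length A\<close>. Index
  0 is not covered, so the last claim needs \<open>A \<noteq> []\<close>, which forces
  \<open>k_star\<close> to be at least 1.\<close>

lemma restrict_star:
  fixes f :: "'a set \<Rightarrow> real"
  shows "i_star (restrict f (thresh_queries c B S X A)) c B \<tau> \<epsilon> S X A = i_star f c B \<tau> \<epsilon> S X A"
    and "j_star (restrict f (thresh_queries c B S X A)) c B \<tau> \<epsilon> S X A = j_star f c B \<tau> \<epsilon> S X A"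
    and "k_star (restrict f (thresh_queries c B S X A)) c B \<tau> \<epsilon> S X A = k_star f c B \<tau> \<epsilon> S X A"
    and "A \<noteq> [] \<Longrightarrow> G_set (restrict f (thresh_queries c B S X A)) c B \<tau> S X A (k_star f c B \<tau> \<epsilon> S X A) =
      G_set f c B \<tau> S X A (k_star f c B \<tau> \<epsilon> S X A)"
proof -
  let ?v = "restrict f (thresh_queries c B S X A)"
  have m: "marginal ?v {x} (S \<union> prefix_set A i) = marginal f {x} (S \<union> prefix_set A i)"
    if "i \<in> {1..length A}" "x \<in> X_set c B S X A i" for x i
  proof -
    have "{x} \<union> (S \<union> prefix_set A i) \<in> thresh_queries c B S X A"
      "S \<union> prefix_set A i \<in> thresh_queries c B S X A"
      using that unfolding thresh_queries_def by blast+
    then show ?thesis unfolding marginal_def by simp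
  qed
  have G: "G_set ?v c B \<tau> S X A i = G_set f c B \<tau> S X A i" if "i \<in> {1..length A}" for i
    unfolding G_set_def using m[OF that] by auto
  have E: "E_set ?v c B S X A i = E_set f c B S X A i" if "i \<in> {1..length A}" for i
    unfolding E_set_def using m[OF that] by auto
  have cs: "cost_stop ?v c B \<tau> \<epsilon> S X A i = cost_stop f c B \<tau> \<epsilon> S X A i" if "i \<in> {1..length A}" for i
    unfolding cost_stop_def G[OF that] ..
  have ls: "loss_stop ?v c B \<tau> \<epsilon> S X A i = loss_stop f c B \<tau> \<epsilon> S X A i" if i: "i \<in> {1..length A}" for i
  proof -
    have "(\<Sum>x \<in> G_set f c B \<tau> S X A i. marginal ?v {x} (S \<union> prefix_set A i)) =
        (\<Sum>x \<in> G_set f c B \<tau> S X A i. marginal f {x} (S \<union> prefix_set A i))"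
      using m[OF i] by (intro sum.cong) (auto simp: G_set_def)
    moreover have "(\<Sum>x \<in> E_set f c B S X A i. \<bar>marginal ?v {x} (S \<union> prefix_set A i)\<bar>) =
        (\<Sum>x \<in> E_set f c B S X A i. \<bar>marginal f {x} (S \<union> prefix_set A i)\<bar>)"
      using m[OF i] by (intro sum.cong) (auto simp: E_set_def)
    ultimately show ?thesis unfolding loss_stop_def G[OF i] E[OF i] by simp
  qed
  have "{i \<in> {1..length A}. cost_stop ?v c B \<tau> \<epsilon> S X A i} = {i \<in> {1..length A}. cost_stop f c B \<tau> \<epsilon> S X A i}"
    using cs by blast
  then show i: "i_star ?v c B \<tau> \<epsilon> S X A = i_star f c B \<tau> \<epsilon> S X A" unfolding i_star_alt by simp
  have "{i \<in> {1..length A}. loss_stop ?v c B \<tau> \<epsilon> S X A i} = {i \<in> {1..length A}. loss_stop f c B \<tau> \<epsilon> S X A i}"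
    using ls by blast
  then show j: "j_star ?v c B \<tau> \<epsilon> S X A = j_star f c B \<tau> \<epsilon> S X A" unfolding j_star_alt by simp
  show "k_star ?v c B \<tau> \<epsilon> S X A = k_star f c B \<tau> \<epsilon> S X A" unfolding k_star_def i j ..
  show "G_set ?v c B \<tau> S X A (k_star f c B \<tau> \<epsilon> S X A) = G_set f c B \<tau> S X A (k_star f c B \<tau> \<epsilon> S X A)"
    if "A \<noteq> []"
    using k_star_pos[OF that] k_star_le by (intro G) auto
qed

lemma sample_seq_nonempty:
  assumes "A \<in> set_pmf (sample_seq c B S [] X)" "finite X" "X \<noteq> {}"
  shows "A \<noteq> []" "set A \<subseteq> X"
  using sample_seq_support[OF assms(1,2)] assms(3) by auto

lemma thresh_loop_step:
  assumes "finite X" "X \<noteq> {}" "real ctr < l"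
  shows "thresh_loop c B \<tau> \<epsilon> l S ctr X f =
    bind_pmf (sample_seq c B S [] X) (\<lambda>A.
      map_pmf (\<lambda>(y, r, q). (y, Suc r, card (thresh_queries c B S X A) + q))
        (thresh_loop c B \<tau> \<epsilon> l (S \<union> prefix_set A (k_star f c B \<tau> \<epsilon> S X A))
          (if j_star f c B \<tau> \<epsilon> S X A < i_star f c B \<tau> \<epsilon> S X A then ctr + 1 else ctr)
          (G_set f c B \<tau> S X A (k_star f c B \<tau> \<epsilon> S X A)) f))"
proof -
  have C: "finite X \<and> X \<noteq> {} \<and> real ctr < l" using assms by simp
  show ?thesis
    unfolding thresh_loop_unfold[of c B \<tau> \<epsilon> l S ctr X f] if_P[OF C] Let_def restrict_star(1-3)
    by (intro bind_pmf_cong refl) (simp add: restrict_star(4) sample_seq_nonempty(1)[OF _ assms(1,2)])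
qed

lemma thresh_loop_done:
  assumes "\<not> (finite X \<and> X \<noteq> {} \<and> real ctr < l)"
  shows "thresh_loop c B \<tau> \<epsilon> l S ctr X f = return_pmf (S, 0, 0)"
  by (subst thresh_loop_unfold) (use assms in auto)

text \<open>Every query contains a sampled prefix of length at least 1, hence is nonempty.\<close>

lemma thresh_loop_cong_nonempty:
  assumes "\<And>A. A \<noteq> {} \<Longrightarrow> f A = g A"
  shows "thresh_loop c B \<tau> \<epsilon> l S ctr X f = thresh_loop c B \<tau> \<epsilon> l S ctr X g"
proof (induction "card X" arbitrary: S ctr X rule: less_induct)
  case less
  show ?case
  proof (cases "finite X \<and> X \<noteq> {} \<and> real ctr < l")
    case True
    have eq: "restrict f (thresh_queries c B S X A) = restrict g (thresh_queries c B S X A)" for A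
    proof (rule restrict_ext)
      fix Q assume "Q \<in> thresh_queries c B S X A"
      then obtain i where "i \<in> {1..length A}" "prefix_set A i \<subseteq> Q"
        unfolding thresh_queries_def by blast
      then have "Q \<noteq> {}" by (auto simp: prefix_set_def)
      then show "f Q = g Q" by (rule assms)
    qed
    have fin: "finite X" "X \<noteq> {}" using True by auto
    show ?thesis
      unfolding thresh_loop_unfold[of c B \<tau> \<epsilon> l S ctr X] if_P[OF True] Let_def eq
      by (intro bind_pmf_cong map_pmf_cong refl less psubset_card_mono G_set_psubset fin)
  next
    case False
    then show ?thesis by (simp add: thresh_loop_done)
  qed
qed

lemma thresh_seq_unfold:
  "thresh_seq c H \<tau> \<epsilon> l B f = map_pmf (\<lambda>(y, r, q). (y, Suc r, card ((\<lambda>x. {x}) ` H) + q))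
     (thresh_loop c B \<tau> \<epsilon> l {} 0 {x \<in> H. \<tau> * c x \<le> f {x}} f)"
proof -
  have "{x \<in> H. \<tau> * c x \<le> restrict f ((\<lambda>x. {x}) ` H) {x}} = {x \<in> H. \<tau> * c x \<le> f {x}}" by auto
  then show ?thesis
    by (simp add: thresh_seq_def qbind_def ask_def bind_return_pmf)
qed

lemma thresh_seq_ground:
  "thresh_seq c H \<tau> \<epsilon> l B f = thresh_seq c H \<tau> \<epsilon> l B (ground f)"
  unfolding thresh_seq_unfold using thresh_loop_cong_nonempty[of f "ground f"] by (simp add: ground_def)

text \<open>The threshold may be 0, since the best singleton may have value 0.\<close>

locale threshold_setting =
  fixes N :: "'a set" and f :: "'a set \<Rightarrow> real" and c :: "'a \<Rightarrow> real" and B \<tau> \<epsilon> :: real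
  assumes fin: "finite N" and nonneg: "nonneg_on N f" and submod: "submodular_on N f"
    and cpos: "\<And>x. x \<in> N \<Longrightarrow> 0 < c x" and \<tau>: "0 \<le> \<tau>" and \<epsilon>: "0 < \<epsilon>" "\<epsilon> < 1"
begin

definition loop_inv :: "'a set \<Rightarrow> 'a set \<Rightarrow> bool" where
  "loop_inv S X \<longleftrightarrow> S \<subseteq> N \<and> X \<subseteq> N \<and> S \<inter> X = {} \<and> sum c S \<le> B \<and>
     (\<forall>x\<in>X. c x + sum c S \<le> B) \<and> (\<forall>x\<in>X. \<tau> * c x \<le> marginal f {x} S)"

lemma loop_invD:
  assumes "loop_inv S X"
  shows "S \<subseteq> N" "X \<subseteq> N" "S \<inter> X = {}" "finite S" "finite X" "sum c S \<le> B"
    "\<And>x. x \<in> X \<Longrightarrow> c x + sum c S \<le> B" "\<And>x. x \<in> X \<Longrightarrow> \<tau> * c x \<le> marginal f {x} S"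
  using assms fin finite_subset by (auto simp: loop_inv_def)

lemma loop_inv_marginal_nonneg:
  assumes "loop_inv S X" "x \<in> X"
  shows "0 \<le> marginal f {x} S"
proof -
  have "0 \<le> \<tau> * c x" using \<tau> cpos[of x] loop_invD(2)[OF assms(1)] assms(2) by auto
  then show ?thesis using loop_invD(8)[OF assms] by linarith
qed

lemma sum_c_mono: "A \<subseteq> A' \<Longrightarrow> A' \<subseteq> N \<Longrightarrow> sum c A \<le> sum c A'"
  using fin cpos by (intro sum_mono2) (auto intro: finite_subset less_imp_le)

lemma sample_run:
  assumes "loop_inv S X" "A \<in> set_pmf (sample_seq c B S [] X)"
  shows "set A \<subseteq> X" "distinct A" "sum c (set A) + sum c S \<le> B" "S \<inter> set A = {}"
    "sum c (S \<union> prefix_set A i) = sum c S + sum c (prefix_set A i)" "S \<union> prefix_set A i \<subseteq> N"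
    "S \<union> set A \<subseteq> N"
proof -
  note inv = loop_invD[OF assms(1)]
  show 1: "set A \<subseteq> X" using sample_seq_support[OF assms(2) inv(5)] by auto
  show "distinct A" "sum c (set A) + sum c S \<le> B"
    using sample_seq_budget[OF assms(2)] inv by auto
  show 2: "S \<inter> set A = {}" using 1 inv(3) by auto
  show "sum c (S \<union> prefix_set A i) = sum c S + sum c (prefix_set A i)"
    using 2 prefix_set_subset[of A i] inv(4) by (intro sum.union_disjoint) auto
  show 3: "S \<union> set A \<subseteq> N" using 1 inv by auto
  show "S \<union> prefix_set A i \<subseteq> N" using 3 prefix_set_subset[of A i] by auto
qed

lemma loop_inv_step:
  assumes inv: "loop_inv S X" and A: "A \<in> set_pmf (sample_seq c B S [] X)"
  shows "loop_inv (S \<union> prefix_set A k) (G_set f c B \<tau> S X A k)"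
proof -
  have "sum c (S \<union> prefix_set A k) \<le> sum c (S \<union> set A)"
    using sample_run[OF inv A] prefix_set_subset[of A k] by (intro sum_c_mono) auto
  also have "\<dots> \<le> B" using sample_run(3)[OF inv A] sample_run(5)[OF inv A, of "length A"] by simp
  finally have "sum c (S \<union> prefix_set A k) \<le> B" .
  moreover have "S \<union> prefix_set A k \<subseteq> N" using sample_run[OF inv A] by blast
  ultimately show ?thesis
    using loop_invD(2,3)[OF inv] by (auto simp: loop_inv_def G_set_def X_set_def)
qed

text \<open>Without a loss stop, the negative marginals cancel at most a fraction
  \<open>\<epsilon>\<close> of the gain of \<open>G_set\<close>; without a cost stop,
  \<open>G_set\<close> keeps a fraction \<open>1 - \<epsilon>\<close> of the cost of
  \<open>X\<close>, hence at least that fraction of the cost of \<open>X'\<close>. As the next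
  element is uniform on \<open>X'\<close>, its expected gain is compared here with its expected
  cost.\<close>

lemma marginal_sum_ge:
  assumes inv: "loop_inv S X" and A: "set A \<subseteq> X" "A \<noteq> []"
    and X': "X' = {x \<in> X - set A. c x + sum c (set A) + sum c S \<le> B}"
    and stop: "\<not> cost_stop f c B \<tau> \<epsilon> S X A (length A)" "\<not> loss_stop f c B \<tau> \<epsilon> S X A (length A)"
  shows "(1 - \<epsilon>)\<^sup>2 * \<tau> * sum c X' \<le> (\<Sum>x\<in>X'. marginal f {x} (S \<union> set A))"
proof -
  note i = loop_invD[OF inv]
  let ?m = "\<lambda>x. marginal f {x} (S \<union> set A)"
  define G where "G = G_set f c B \<tau> S X A (length A)"
  define E where "E = E_set f c B S X A (length A)"
  have "sum c (S \<union> set A) = sum c S + sum c (set A)"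
    using A i by (intro sum.union_disjoint) auto
  then have "X_set c B S X A (length A) = X'" unfolding X_set_def X' by (auto simp: add_ac)
  then have GE: "G = {a \<in> X'. \<tau> * c a \<le> ?m a}" "E = {a \<in> X'. ?m a < 0}"
    by (simp_all add: G_def E_def G_set_def E_set_def)
  have X'X: "X' \<subseteq> X" using X' by auto
  have finX': "finite X'" using X'X i(5) finite_subset by auto
  have tc: "0 \<le> \<tau> * c a" if "a \<in> X" for a using that i(2) cpos[of a] \<tau> by (auto simp: less_imp_le)
  have dis: "G \<inter> E = {}" using GE tc X'X by fastforce
  have sub: "G \<union> E \<subseteq> X'" using GE by auto
  have "sum ?m (G \<union> E) \<le> sum ?m X'"
    using finX' sub GE by (intro sum_mono2) (auto simp: not_less)
  moreover have "sum ?m (G \<union> E) = sum ?m G + sum ?m E"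
    using finX' sub dis by (intro sum.union_disjoint) (auto intro: finite_subset)
  moreover have "(\<Sum>x\<in>E. \<bar>?m x\<bar>) = - sum ?m E"
    unfolding sum_negf[symmetric] using GE by (intro sum.cong) auto
  moreover have "(\<Sum>x\<in>E. \<bar>?m x\<bar>) < \<epsilon> * sum ?m G"
    using stop(2) by (simp add: loss_stop_def G_def E_def)
  ultimately have 1: "(1 - \<epsilon>) * sum ?m G \<le> sum ?m X'" by (simp add: algebra_simps)
  have "\<tau> * sum c G \<le> sum ?m G"
    unfolding sum_distrib_left using GE by (intro sum_mono) auto
  then have 2: "(1 - \<epsilon>) * (\<tau> * sum c G) \<le> (1 - \<epsilon>) * sum ?m G"
    using \<epsilon> by (intro mult_left_mono) auto
  have "(1 - \<epsilon>) * sum c X \<le> sum c G" using stop(1) by (simp add: cost_stop_def G_def)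
  moreover have "(1 - \<epsilon>) * sum c X' \<le> (1 - \<epsilon>) * sum c X"
    using sum_c_mono[OF X'X i(2)] \<epsilon> by (intro mult_left_mono) auto
  ultimately have "(1 - \<epsilon>) * sum c X' \<le> sum c G" by simp
  then have "((1 - \<epsilon>) * \<tau>) * ((1 - \<epsilon>) * sum c X') \<le> ((1 - \<epsilon>) * \<tau>) * sum c G"
    using \<epsilon> \<tau> by (intro mult_left_mono) auto
  then show ?thesis using 1 2 by (simp add: power2_eq_square mult_ac)
qed

text \<open>An optional stopping argument: along the growing prefix, \<open>h\<close> does not
  decrease in expectation until \<open>k_star\<close>. It is proved by induction on the remaining
  candidates, for prefixes at which no stopping condition has held so far. The element that triggers
  the stop is still covered, because its draw is judged by the prefix before it.\<close>

lemma sample_gain: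
  assumes inv: "loop_inv S X"
  defines "h \<equiv> \<lambda>P. f (S \<union> P) - (1 - \<epsilon>)\<^sup>2 * \<tau> * sum c P"
  shows "X' = {x \<in> X - set A. c x + sum c (set A) + sum c S \<le> B} \<Longrightarrow> set A \<subseteq> X \<Longrightarrow>
    (\<And>i. 1 \<le> i \<Longrightarrow> i \<le> length A \<Longrightarrow> \<not> cost_stop f c B \<tau> \<epsilon> S X A i \<and> \<not> loss_stop f c B \<tau> \<epsilon> S X A i) \<Longrightarrow>
    h (set A) \<le> measure_pmf.expectation (sample_seq c B S A X')
      (\<lambda>A'. h (prefix_set A' (k_star f c B \<tau> \<epsilon> S X A')))"
proof (induction "card X'" arbitrary: A X' rule: less_induct)
  case less
  note i = loop_invD[OF inv]
  let ?h = "\<lambda>A'. h (prefix_set A' (k_star f c B \<tau> \<epsilon> S X A'))"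
  have X'X: "X' \<subseteq> X" using less.prems(1) by auto
  have finX': "finite X'" using X'X i(5) finite_subset by auto
  have disj: "S \<inter> set A = {}" using less.prems(2) i(3) by auto
  show ?case
  proof (cases "X' = {}")
    case True
    \<comment> \<open>Without candidates both sums of the loss condition are empty, so a nonempty
      \<open>A\<close> would already have stopped.\<close>
    have "A = []"
    proof (rule ccontr)
      assume "A \<noteq> []"
      have "sum c (S \<union> set A) = sum c S + sum c (set A)"
        using less.prems(2) i disj by (intro sum.union_disjoint) auto
      then have "X_set c B S X A (length A) = X'"
        unfolding X_set_def less.prems(1) by (auto simp: add_ac)
      then have "G_set f c B \<tau> S X A (length A) = {}" "E_set f c B S X A (length A) = {}"
        using True by (simp_all add: G_set_def E_set_def)
      then have "loss_stop f c B \<tau> \<epsilon> S X A (length A)" by (simp add: loss_stop_def)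
      then show False using less.prems(3)[of "length A"] \<open>A \<noteq> []\<close> by (simp add: Suc_le_eq)
    qed
    then show ?thesis using True
      by (simp add: sample_seq.simps prefix_set_def k_star_def i_star_def)
  next
    case False
    let ?X = "\<lambda>a. {x \<in> X' - {a}. c x + sum c (set (A @ [a])) + sum c S \<le> B}"
    have each: "h (insert a (set A)) \<le> measure_pmf.expectation (sample_seq c B S (A @ [a]) (?X a)) ?h"
      if a: "a \<in> X'" for a
    proof -
      have aX: "a \<in> X" "a \<notin> set A" using a less.prems(1) by auto
      have ca: "0 < c x" if "x \<in> X" for x using that i(2) cpos by auto
      have canon: "?X a = {x \<in> X - set (A @ [a]). c x + sum c (set (A @ [a])) + sum c S \<le> B}"
        using aX ca[OF aX(1)] less.prems(1) by auto
      show ?thesis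
      proof (cases "cost_stop f c B \<tau> \<epsilon> S X (A @ [a]) (length (A @ [a])) \<or>
          loss_stop f c B \<tau> \<epsilon> S X (A @ [a]) (length (A @ [a]))")
        case True
        \<comment> \<open>Once a prefix stops, every completion of it has the same
          \<open>k_star\<close>.\<close>
        have "?h A' = h (insert a (set A))" if A': "A' \<in> set_pmf (sample_seq c B S (A @ [a]) (?X a))" for A'
        proof -
          from sample_seq_support[OF A'] finX' obtain zs where zs: "A' = (A @ [a]) @ zs" by auto
          have pre: "prefix_set A' i = prefix_set (A @ [a]) i" if "i \<le> length (A @ [a])" for i
            unfolding zs using that by (intro prefix_set_append) auto
          have pre': "prefix_set A' i = prefix_set A i" if "i \<le> length A" for i
            unfolding zs append_assoc using that by (intro prefix_set_append) auto
          have "k_star f c B \<tau> \<epsilon> S X A' = length (A @ [a])"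
          proof (rule k_star_eqI)
            show "cost_stop f c B \<tau> \<epsilon> S X A' (length (A @ [a])) \<or> loss_stop f c B \<tau> \<epsilon> S X A' (length (A @ [a]))"
              using True star_sets_cong(4,5)[OF pre[OF order_refl], of f c B \<tau> \<epsilon> S X] by blast
            show "\<not> cost_stop f c B \<tau> \<epsilon> S X A' i \<and> \<not> loss_stop f c B \<tau> \<epsilon> S X A' i"
              if "1 \<le> i" "i < length (A @ [a])" for i
              using that less.prems(3)[of i] star_sets_cong(4,5)[OF pre', of i f c B \<tau> \<epsilon> S X] by auto
          qed (auto simp: zs)
          then show ?thesis using pre[OF order_refl] by (simp add: prefix_set_def)
        qed
        then have "measure_pmf.expectation (sample_seq c B S (A @ [a]) (?X a)) ?h =
            measure_pmf.expectation (sample_seq c B S (A @ [a]) (?X a)) (\<lambda>_. h (insert a (set A)))"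
          by (intro integral_cong_AE) (auto simp: AE_measure_pmf_iff)
        then show ?thesis by simp
      next
        case False
        have "card (?X a) < card X'" using a finX' by (intro psubset_card_mono) auto
        then have "h (set (A @ [a])) \<le> measure_pmf.expectation (sample_seq c B S (A @ [a]) (?X a)) ?h"
        proof (rule less.hyps[OF _ canon])
          show "set (A @ [a]) \<subseteq> X" using less.prems(2) aX by auto
          fix i assume i: "1 \<le> i" "i \<le> length (A @ [a])"
          show "\<not> cost_stop f c B \<tau> \<epsilon> S X (A @ [a]) i \<and> \<not> loss_stop f c B \<tau> \<epsilon> S X (A @ [a]) i"
          proof (cases "i = length (A @ [a])")
            case True
            then show ?thesis using False by simp
          next
            case ne: False
            then have "i \<le> length A" using i by auto
            then show ?thesis
              using less.prems(3)[of i] i(1) star_sets_cong(4,5)[OF prefix_set_append[of i A "[a]"], of f c B \<tau> \<epsilon> S X]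
              by auto
          qed
        qed
        then show ?thesis by simp
      qed
    qed
    have "(\<Sum>a\<in>X'. h (set A)) \<le> (\<Sum>a\<in>X'. h (insert a (set A)))"
    proof -
      have eq: "h (insert a (set A)) = h (set A) + (marginal f {a} (S \<union> set A) - (1 - \<epsilon>)\<^sup>2 * \<tau> * c a)"
        if "a \<in> X'" for a
        using that less.prems(1) by (simp add: h_def marginal_def algebra_simps)
      have "0 \<le> (\<Sum>a\<in>X'. marginal f {a} (S \<union> set A) - (1 - \<epsilon>)\<^sup>2 * \<tau> * c a)"
      \<comment> \<open>Before the first draw there is no prefix to test, but the loop invariant
        gives every candidate a marginal value of at least \<open>\<tau>\<close> times its
        cost.\<close>
      proof (cases "A = []")
        case True
        have "0 \<le> marginal f {a} (S \<union> set A) - (1 - \<epsilon>)\<^sup>2 * \<tau> * c a" if "a \<in> X'" for a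
        proof -
          have aX: "a \<in> X" using that X'X by auto
          have "(1 - \<epsilon>)\<^sup>2 * (\<tau> * c a) \<le> 1 * (\<tau> * c a)"
            using \<epsilon> \<tau> aX i(2) cpos[of a] by (intro mult_right_mono) (auto simp: power_le_one less_imp_le)
          then show ?thesis using i(8)[OF aX] True by (simp add: mult.assoc)
        qed
        then show ?thesis by (intro sum_nonneg) auto
      next
        case False
        then have "1 \<le> length A" by (simp add: Suc_le_eq)
        then show ?thesis
          using marginal_sum_ge[OF inv less.prems(2) False less.prems(1)] less.prems(3)[of "length A"]
          by (simp add: sum_subtractf sum_distrib_left)
      qed
      then show ?thesis by (simp add: eq sum.distrib)
    qed
    then have "real (card X') * h (set A) \<le> (\<Sum>a\<in>X'. h (insert a (set A)))" by simp
    also have "\<dots> \<le> (\<Sum>a\<in>X'. measure_pmf.expectation (sample_seq c B S (A @ [a]) (?X a)) ?h)"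
      using each by (intro sum_mono) auto
    finally have "h (set A) \<le> (\<Sum>a\<in>X'. measure_pmf.expectation (sample_seq c B S (A @ [a]) (?X a)) ?h) / real (card X')"
      using False finX' by (simp add: pos_le_divide_eq card_gt_0_iff mult.commute)
    also have "\<dots> = measure_pmf.expectation (pmf_of_set X' \<bind> (\<lambda>a. sample_seq c B S (A @ [a]) (?X a))) ?h"
      using False finX'
      by (subst pmf_expectation_bind_pmf_of_set) (auto simp: finite_sample_seq sum_distrib_left divide_inverse mult.commute)
    also have "pmf_of_set X' \<bind> (\<lambda>a. sample_seq c B S (A @ [a]) (?X a)) = sample_seq c B S A X'"
      using False finX' by (subst sample_seq.simps[of c B S A X']) simp
    finally show ?thesis .
  qed
qed

end

lemma expectation_bind_ge:
  fixes g :: "'b \<Rightarrow> real" and u :: "'a \<Rightarrow> real"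
  assumes "finite (set_pmf M)" "\<And>x. x \<in> set_pmf M \<Longrightarrow> finite (set_pmf (k x))"
    "\<And>x. x \<in> set_pmf M \<Longrightarrow> u x \<le> measure_pmf.expectation (k x) g"
  shows "measure_pmf.expectation M u \<le> measure_pmf.expectation (bind_pmf M k) g"
proof -
  have "measure_pmf.expectation M u = (\<Sum>x\<in>set_pmf M. pmf M x * u x)"
    using assms(1) by (subst integral_measure_pmf[of "set_pmf M"]) auto
  also have "\<dots> \<le> (\<Sum>x\<in>set_pmf M. pmf M x * measure_pmf.expectation (k x) g)"
    using assms(3) by (intro sum_mono mult_left_mono) auto
  also have "\<dots> = measure_pmf.expectation (bind_pmf M k) g"
    using assms by (subst pmf_expectation_bind[of "set_pmf M"]) auto
  finally show ?thesis .
qed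

lemma finite_thresh_loop: "finite (set_pmf (thresh_loop c B \<tau> \<epsilon> l S ctr X f))"
proof (induction "card X" arbitrary: S ctr X rule: less_induct)
  case less
  show ?case
  proof (cases "finite X \<and> X \<noteq> {} \<and> real ctr < l")
    case True
    then have X: "finite X" "X \<noteq> {}" "real ctr < l" by auto
    show ?thesis
      unfolding thresh_loop_step[OF X] set_bind_pmf set_map_pmf
      by (intro finite_UN_I finite_imageI less finite_sample_seq psubset_card_mono G_set_psubset X)
  next
    case False
    then show ?thesis by (simp add: thresh_loop_done)
  qed
qed

lemma finite_thresh_seq: "finite (set_pmf (thresh_seq c H \<tau> \<epsilon> l B f))"
  unfolding thresh_seq_unfold by (simp add: finite_thresh_loop)

context threshold_setting
begin

lemma loop_gain:
  assumes "loop_inv S X"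
  shows "f S - (1 - \<epsilon>)\<^sup>2 * \<tau> * sum c S \<le> measure_pmf.expectation (thresh_loop c B \<tau> \<epsilon> l S ctr X f)
    (\<lambda>o'. f (fst o') - (1 - \<epsilon>)\<^sup>2 * \<tau> * sum c (fst o'))"
  using assms
proof (induction "card X" arbitrary: S ctr X rule: less_induct)
  case less
  note inv = loop_invD[OF less.prems]
  let ?g = "\<lambda>o'. f (fst o') - (1 - \<epsilon>)\<^sup>2 * \<tau> * sum c (fst o')"
  show ?case
  proof (cases "finite X \<and> X \<noteq> {} \<and> real ctr < l")
    case True
    then have X: "finite X" "X \<noteq> {}" "real ctr < l" by auto
    let ?h = "\<lambda>P. f (S \<union> P) - (1 - \<epsilon>)\<^sup>2 * \<tau> * sum c P"
    let ?k = "\<lambda>A. k_star f c B \<tau> \<epsilon> S X A"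
    have "?h (set []) \<le> measure_pmf.expectation (sample_seq c B S [] X) (\<lambda>A. ?h (prefix_set A (?k A)))"
      by (rule sample_gain[OF less.prems]) (use inv in auto)
    then have "f S - (1 - \<epsilon>)\<^sup>2 * \<tau> * sum c S \<le>
        measure_pmf.expectation (sample_seq c B S [] X) (\<lambda>A. ?h (prefix_set A (?k A)))
        - (1 - \<epsilon>)\<^sup>2 * \<tau> * sum c S" by simp
    also have "\<dots> = measure_pmf.expectation (sample_seq c B S [] X)
        (\<lambda>A. ?h (prefix_set A (?k A)) - (1 - \<epsilon>)\<^sup>2 * \<tau> * sum c S)"
      using X by (subst Bochner_Integration.integral_diff) (auto intro!: integrable_measure_pmf_finite finite_sample_seq)
    also have "\<dots> \<le> measure_pmf.expectation (thresh_loop c B \<tau> \<epsilon> l S ctr X f) ?g"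
      unfolding thresh_loop_step[OF X]
    proof (rule expectation_bind_ge)
      fix A assume A: "A \<in> set_pmf (sample_seq c B S [] X)"
      let ?S = "S \<union> prefix_set A (?k A)"
      have "f ?S - (1 - \<epsilon>)\<^sup>2 * \<tau> * sum c ?S \<le> measure_pmf.expectation
          (thresh_loop c B \<tau> \<epsilon> l ?S (if j_star f c B \<tau> \<epsilon> S X A < i_star f c B \<tau> \<epsilon> S X A then ctr + 1 else ctr)
            (G_set f c B \<tau> S X A (?k A)) f) ?g"
        using A X by (intro less.hyps loop_inv_step less.prems psubset_card_mono G_set_psubset) auto
      moreover have "sum c ?S = sum c S + sum c (prefix_set A (?k A))" by (rule sample_run(5)[OF less.prems A])
      ultimately show "?h (prefix_set A (?k A)) - (1 - \<epsilon>)\<^sup>2 * \<tau> * sum c S \<le> measure_pmf.expectation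
        (map_pmf (\<lambda>(y, r, q). (y, Suc r, card (thresh_queries c B S X A) + q))
          (thresh_loop c B \<tau> \<epsilon> l ?S (if j_star f c B \<tau> \<epsilon> S X A < i_star f c B \<tau> \<epsilon> S X A then ctr + 1 else ctr)
            (G_set f c B \<tau> S X A (?k A)) f)) ?g"
        by (simp add: case_prod_beta' distrib_left)
    qed (use X in \<open>auto intro!: finite_sample_seq finite_thresh_loop\<close>)
    finally show ?thesis .
  next
    case False
    then show ?thesis by (simp add: thresh_loop_done)
  qed
qed

text \<open>\<open>D\<close> collects the elements of negative marginal value from all rounds
  counted by \<open>ctr\<close>. By submodularity their losses only grow, and the gains of
  \<open>X\<close> only shrink, as \<open>S\<close> grows; so a high counter forces the gains left
  in \<open>X\<close> to be small compared with the loss of \<open>D\<close>, which nonnegativity of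
  \<open>f\<close> limits.\<close>

definition progress :: "'a set \<Rightarrow> 'a set \<Rightarrow> nat \<Rightarrow> 'a set \<Rightarrow> bool" where
  "progress H S ctr X \<longleftrightarrow> loop_inv S X \<and>
     (\<forall>x\<in>H - S - X. B < c x + sum c S \<or> marginal f {x} S < \<tau> * c x) \<and>
     (\<exists>D\<subseteq>N. D \<inter> (S \<union> X) = {} \<and> (\<forall>x\<in>D. marginal f {x} S < 0) \<and>
       real ctr * (\<epsilon> * (\<Sum>x\<in>X. marginal f {x} S)) \<le> (\<Sum>x\<in>D. \<bar>marginal f {x} S\<bar>))"

lemma progress_step:
  assumes pr: "progress H S ctr X" and HN: "H \<subseteq> N" and A: "A \<in> set_pmf (sample_seq c B S [] X)"
    and X: "X \<noteq> {}"
  defines "k \<equiv> k_star f c B \<tau> \<epsilon> S X A"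
  shows "progress H (S \<union> prefix_set A k)
    (if j_star f c B \<tau> \<epsilon> S X A < i_star f c B \<tau> \<epsilon> S X A then ctr + 1 else ctr)
    (G_set f c B \<tau> S X A k)"
proof -
  define S' where "S' = S \<union> prefix_set A k"
  define X1 where "X1 = G_set f c B \<tau> S X A k"
  define E where "E = E_set f c B S X A k"
  have inv: "loop_inv S X" using pr by (simp add: progress_def)
  note i = loop_invD[OF inv]
  note run = sample_run[OF inv A]
  have inv': "loop_inv S' X1" unfolding S'_def X1_def by (rule loop_inv_step[OF inv A])
  note i' = loop_invD[OF inv']
  have S': "S \<subseteq> S'" "S' \<subseteq> N" "S' \<subseteq> S \<union> X"
    using run(1,6) prefix_set_subset[of A k] by (auto simp: S'_def)
  have anti: "marginal f {x} S' \<le> marginal f {x} S" if "x \<in> N" "x \<notin> S'" for x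
    using that S' by (intro submodular_onD[OF submod]) auto
  have X1: "X1 \<subseteq> X" "X1 \<inter> S' = {}" using i'(3) by (auto simp: X1_def G_set_def X_set_def)
  have mX: "0 \<le> marginal f {x} S" if "x \<in> X" for x
    by (rule loop_inv_marginal_nonneg[OF inv that])
  have cover: "\<forall>x\<in>H - S' - X1. B < c x + sum c S' \<or> marginal f {x} S' < \<tau> * c x"
  proof
    fix x assume x: "x \<in> H - S' - X1"
    then have xN: "x \<in> N" using HN by auto
    show "B < c x + sum c S' \<or> marginal f {x} S' < \<tau> * c x"
    proof (cases "x \<in> X")
      case True
      then show ?thesis using x
        by (auto simp: X1_def S'_def G_set_def X_set_def not_le)
    next
      case False
      then have "B < c x + sum c S \<or> marginal f {x} S < \<tau> * c x"
        using pr x S'(1) by (auto simp: progress_def)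
      moreover have "marginal f {x} S' \<le> marginal f {x} S" using anti[OF xN] x by simp
      ultimately show ?thesis using sum_c_mono[OF S'(1,2)] by linarith
    qed
  qed
  from pr obtain D where D: "D \<subseteq> N" "D \<inter> (S \<union> X) = {}" "\<forall>x\<in>D. marginal f {x} S < 0"
    "real ctr * (\<epsilon> * (\<Sum>x\<in>X. marginal f {x} S)) \<le> (\<Sum>x\<in>D. \<bar>marginal f {x} S\<bar>)"
    by (auto simp: progress_def)
  have finD: "finite D" using D(1) fin finite_subset by auto
  have DS': "D \<inter> S' = {}" using D(2) S'(3) by auto
  have D': "\<forall>x\<in>D. marginal f {x} S' < 0" 
  proof
    fix x assume x: "x \<in> D"
    then have "marginal f {x} S' \<le> marginal f {x} S" using anti[of x] D(1) DS' by blast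
    then show "marginal f {x} S' < 0" using D(3) x by force
  qed
  have "(\<Sum>x\<in>X1. marginal f {x} S') \<le> (\<Sum>x\<in>X1. marginal f {x} S)"
    using anti X1 i(2) by (intro sum_mono) auto
  also have "\<dots> \<le> (\<Sum>x\<in>X. marginal f {x} S)"
    using X1(1) i(5) mX by (intro sum_mono2) auto
  finally have "real ctr * (\<epsilon> * (\<Sum>x\<in>X1. marginal f {x} S')) \<le> real ctr * (\<epsilon> * (\<Sum>x\<in>X. marginal f {x} S))"
    using \<epsilon> by (intro mult_left_mono) auto
  also have "\<dots> \<le> (\<Sum>x\<in>D. \<bar>marginal f {x} S\<bar>)" by (rule D(4))
  also have "\<dots> \<le> (\<Sum>x\<in>D. \<bar>marginal f {x} S'\<bar>)"
  proof (rule sum_mono)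
    fix x assume x: "x \<in> D"
    then have "marginal f {x} S' \<le> marginal f {x} S" using anti[of x] D(1) DS' by blast
    moreover have "marginal f {x} S < 0" using D(3) x by blast
    ultimately show "\<bar>marginal f {x} S\<bar> \<le> \<bar>marginal f {x} S'\<bar>" by linarith
  qed
  finally have Dsum: "real ctr * (\<epsilon> * (\<Sum>x\<in>X1. marginal f {x} S')) \<le> (\<Sum>x\<in>D. \<bar>marginal f {x} S'\<bar>)" .
  show ?thesis
  proof (cases "j_star f c B \<tau> \<epsilon> S X A < i_star f c B \<tau> \<epsilon> S X A")
    case True
    let ?J = "insert (length A) {i \<in> {1..length A}. loss_stop f c B \<tau> \<epsilon> S X A i}"
    have kj: "k = j_star f c B \<tau> \<epsilon> S X A" using True by (simp add: k_def k_star_def)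
    have "i_star f c B \<tau> \<epsilon> S X A \<le> length A" unfolding i_star_alt by (intro Min_le) auto
    \<comment> \<open>\<open>length A\<close> enters both minima as a default value; since
      \<open>k\<close> is smaller, the loss condition really holds at \<open>k\<close>.\<close>
    then have "k \<noteq> length A" using True kj by simp
    moreover have "k \<in> ?J" unfolding kj j_star_alt by (intro Min_in) auto
    ultimately have "loss_stop f c B \<tau> \<epsilon> S X A k" by auto
    then have Esum: "\<epsilon> * (\<Sum>x\<in>X1. marginal f {x} S') \<le> (\<Sum>x\<in>E. \<bar>marginal f {x} S'\<bar>)"
      by (simp add: loss_stop_def X1_def E_def S'_def)
    have E: "E \<subseteq> X" "E \<inter> S' = {}" "\<forall>x\<in>E. marginal f {x} S' < 0"
      using i(3) by (auto simp: E_def E_set_def X_set_def S'_def)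
    have EX1: "E \<inter> X1 = {}"
    proof -
      have "0 \<le> marginal f {x} S'" if "x \<in> X1" for x
        by (rule loop_inv_marginal_nonneg[OF inv' that])
      then show ?thesis using E(3) by force
    qed
    \<comment> \<open>\<open>D\<close> avoids \<open>X\<close> and \<open>E\<close> lies in
      \<open>X\<close>, so every counted round contributes new elements.\<close>
    have DE: "D \<inter> E = {}" using D(2) E(1) by auto
    have finE: "finite E" using E(1) i(5) finite_subset by auto
    have "real (ctr + 1) * (\<epsilon> * (\<Sum>x\<in>X1. marginal f {x} S')) \<le> (\<Sum>x\<in>D \<union> E. \<bar>marginal f {x} S'\<bar>)"
      using Dsum Esum by (simp add: sum.union_disjoint[OF finD finE DE] distrib_right)
    moreover have "D \<union> E \<subseteq> N" "(D \<union> E) \<inter> (S' \<union> X1) = {}" "\<forall>x\<in>D \<union> E. marginal f {x} S' < 0"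
      using D(1,2) E EX1 i(2) DS' X1(1) D' by auto
    ultimately have "progress H S' (ctr + 1) X1"
      unfolding progress_def by (intro conjI inv' cover exI[of _ "D \<union> E"])
    then show ?thesis using True by (simp add: S'_def X1_def)
  next
    case False
    have "D \<inter> (S' \<union> X1) = {}" using DS' D(2) X1(1) by auto
    then have "progress H S' ctr X1"
      unfolding progress_def by (intro conjI inv' cover exI[of _ D] D(1) D' Dsum)
    then show ?thesis using False by (simp add: S'_def X1_def)
  qed
qed

lemma progress_outcome:
  assumes "(y, r, q) \<in> set_pmf (thresh_loop c B \<tau> \<epsilon> l S ctr X f)" "progress H S ctr X" "H \<subseteq> N"
    "S \<union> X \<subseteq> H"
  shows "\<exists>ctr' X'. progress H y ctr' X' \<and> y \<subseteq> H \<and> (X' = {} \<or> l \<le> real ctr')"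
  using assms
proof (induction "card X" arbitrary: S ctr X r q rule: less_induct)
  case less
  have inv: "loop_inv S X" using less.prems(2) by (simp add: progress_def)
  show ?case
  proof (cases "finite X \<and> X \<noteq> {} \<and> real ctr < l")
    case True
    then have X: "finite X" "X \<noteq> {}" "real ctr < l" by auto
    from less.prems(1) obtain A r' q' where A: "A \<in> set_pmf (sample_seq c B S [] X)"
      and y: "(y, r', q') \<in> set_pmf (thresh_loop c B \<tau> \<epsilon> l (S \<union> prefix_set A (k_star f c B \<tau> \<epsilon> S X A))
          (if j_star f c B \<tau> \<epsilon> S X A < i_star f c B \<tau> \<epsilon> S X A then ctr + 1 else ctr)
          (G_set f c B \<tau> S X A (k_star f c B \<tau> \<epsilon> S X A)) f)"
      unfolding thresh_loop_step[OF X] by auto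
    show ?thesis
    proof (rule less.hyps[OF _ y])
      show "card (G_set f c B \<tau> S X A (k_star f c B \<tau> \<epsilon> S X A)) < card X"
        using A X by (intro psubset_card_mono G_set_psubset) auto
      show "S \<union> prefix_set A (k_star f c B \<tau> \<epsilon> S X A) \<union> G_set f c B \<tau> S X A (k_star f c B \<tau> \<epsilon> S X A) \<subseteq> H"
        using less.prems(4) sample_run(1)[OF inv A] prefix_set_subset[of A "k_star f c B \<tau> \<epsilon> S X A"]
        by (auto simp: G_set_def X_set_def)
    qed (use progress_step[OF less.prems(2,3) A X(2)] less.prems in auto)
  next
    case False
    then have "y = S" using less.prems(1) by (simp add: thresh_loop_done)
    moreover have "finite X" using loop_invD(5)[OF inv] .
    ultimately show ?thesis using less.prems False by (intro exI[of _ ctr] exI[of _ X]) auto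
  qed
qed

lemma progress_start:
  assumes "H \<subseteq> N" "f {} = 0" "0 \<le> B" "\<And>x. x \<in> H \<Longrightarrow> c x \<le> B"
  shows "progress H {} 0 {x \<in> H. \<tau> * c x \<le> f {x}}"
  using assms unfolding progress_def loop_inv_def by (auto simp: marginal_def intro!: exI[of _ "{}"])

text \<open>For the last claim: elements of \<open>T\<close> outside \<open>y\<close> and
  \<open>X\<close> fit into the budget, so they must be below the threshold. If \<open>X\<close> is
  nonempty, the counter has reached \<open>1 / \<epsilon>\<^sup>2\<close>; as
  \<open>f (D \<union> y)\<close> is nonnegative, the losses of \<open>D\<close> total at most
  \<open>f y\<close>, and hence \<open>X\<close> can gain at most
  \<open>\<epsilon> * f y\<close>.\<close>

lemma thresh_seq_outcome:
  assumes H: "H \<subseteq> N" "f {} = 0" "0 \<le> B" "\<And>x. x \<in> H \<Longrightarrow> c x \<le> B"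
    and y: "(y, r, q) \<in> set_pmf (thresh_seq c H \<tau> \<epsilon> (1 / \<epsilon>\<^sup>2) B f)"
  shows "y \<subseteq> H" "sum c y \<le> B"
    "\<And>T \<gamma>. T \<subseteq> H \<Longrightarrow> (\<And>x. x \<in> T \<Longrightarrow> c x \<le> \<gamma>) \<Longrightarrow> sum c y \<le> B - \<gamma> \<Longrightarrow>
       f (y \<union> T) \<le> (1 + \<epsilon>) * f y + \<tau> * sum c T"
proof -
  let ?X0 = "{x \<in> H. \<tau> * c x \<le> f {x}}"
  from y obtain r' q' where "(y, r', q') \<in> set_pmf (thresh_loop c B \<tau> \<epsilon> (1 / \<epsilon>\<^sup>2) {} 0 ?X0 f)"
    unfolding thresh_seq_unfold by auto
  from progress_outcome[OF this progress_start[OF H] H(1)]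
  obtain ctr X where pr: "progress H y ctr X" "y \<subseteq> H" "X = {} \<or> 1 / \<epsilon>\<^sup>2 \<le> real ctr" by auto
  show "y \<subseteq> H" by fact
  have inv: "loop_inv y X" using pr(1) by (simp add: progress_def)
  note i = loop_invD[OF inv]
  show "sum c y \<le> B" by fact
  fix T \<gamma> assume T: "T \<subseteq> H" "\<And>x. x \<in> T \<Longrightarrow> c x \<le> \<gamma>" "sum c y \<le> B - \<gamma>"
  let ?m = "\<lambda>x. marginal f {x} y"
  have mX: "0 \<le> ?m x" if "x \<in> X" for x
    by (rule loop_inv_marginal_nonneg[OF inv that])
  from pr(1) obtain D where D: "D \<subseteq> N" "D \<inter> (y \<union> X) = {}" "\<forall>x\<in>D. ?m x < 0"
    "real ctr * (\<epsilon> * (\<Sum>x\<in>X. ?m x)) \<le> (\<Sum>x\<in>D. \<bar>?m x\<bar>)"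
    by (auto simp: progress_def)
  have finT: "finite T" using T(1) H(1) fin by (meson finite_subset order.trans)
  have fy: "0 \<le> f y" using nonneg i(1) by (auto simp: nonneg_on_def)
  have sX: "(\<Sum>x\<in>X. ?m x) \<le> \<epsilon> * f y"
  proof (cases "X = {}")
    case True
    then show ?thesis using fy \<epsilon> by simp
  next
    case False
    have s0: "0 \<le> (\<Sum>x\<in>X. ?m x)" using mX by (intro sum_nonneg) auto
    have "marginal f D y \<le> (\<Sum>x\<in>D. ?m x)"
      using D i(1) fin by (intro marginal_le_sum[OF submod]) (auto intro: finite_subset)
    moreover have "(\<Sum>x\<in>D. \<bar>?m x\<bar>) = - (\<Sum>x\<in>D. ?m x)"
      unfolding sum_negf[symmetric] using D(3) by (intro sum.cong) auto
    moreover have "D \<union> y \<subseteq> N" using D(1) i(1) by auto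
    then have "0 \<le> f (D \<union> y)" using nonneg by (auto simp: nonneg_on_def)
    ultimately have "(\<Sum>x\<in>D. \<bar>?m x\<bar>) \<le> f y" by (simp add: marginal_def)
    moreover have "1 / \<epsilon>\<^sup>2 * (\<epsilon> * (\<Sum>x\<in>X. ?m x)) \<le> real ctr * (\<epsilon> * (\<Sum>x\<in>X. ?m x))"
      using pr(3) False \<epsilon> s0 by (intro mult_right_mono) auto
    ultimately have "1 / \<epsilon>\<^sup>2 * (\<epsilon> * (\<Sum>x\<in>X. ?m x)) \<le> f y" using D(4) by linarith
    then show ?thesis using \<epsilon> by (simp add: field_simps power2_eq_square)
  qed
  have "marginal f (T - y) y \<le> (\<Sum>x\<in>T - y. ?m x)"
    using T(1) H(1) i(1) finT by (intro marginal_le_sum[OF submod]) auto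
  also have "\<dots> = (\<Sum>x\<in>(T - y) \<inter> X. ?m x) + (\<Sum>x\<in>(T - y) - X. ?m x)"
    using finT by (subst sum.union_disjoint[symmetric]) (auto intro!: sum.cong)
  also have "(\<Sum>x\<in>(T - y) \<inter> X. ?m x) \<le> (\<Sum>x\<in>X. ?m x)"
    using mX i(5) by (intro sum_mono2) auto
  also have "(\<Sum>x\<in>(T - y) - X. ?m x) \<le> (\<Sum>x\<in>(T - y) - X. \<tau> * c x)"
  proof (rule sum_mono)
    fix x assume x: "x \<in> (T - y) - X"
    then have "B < c x + sum c y \<or> ?m x < \<tau> * c x" using pr(1) T(1) by (auto simp: progress_def)
    moreover have "c x + sum c y \<le> B" using x T(2)[of x] T(3) by auto
    ultimately show "?m x \<le> \<tau> * c x" by auto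
  qed
  also have "\<dots> = \<tau> * sum c ((T - y) - X)" by (simp add: sum_distrib_left)
  also have "\<dots> \<le> \<tau> * sum c T"
    using \<tau> T(1) H(1) by (intro mult_left_mono sum_c_mono) auto
  finally have "marginal f (T - y) y \<le> \<epsilon> * f y + \<tau> * sum c T" using sX by linarith
  moreover have "(T - y) \<union> y = y \<union> T" by auto
  ultimately show "f (y \<union> T) \<le> (1 + \<epsilon>) * f y + \<tau> * sum c T"
    by (simp add: marginal_def distrib_right)
qed

lemma thresh_seq_gain:
  assumes H: "H \<subseteq> N" "f {} = 0" "0 \<le> B" "\<And>x. x \<in> H \<Longrightarrow> c x \<le> B"
  shows "0 \<le> measure_pmf.expectation (thresh_seq c H \<tau> \<epsilon> l B f)
    (\<lambda>o'. f (fst o') - (1 - \<epsilon>)\<^sup>2 * \<tau> * sum c (fst o'))"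
proof -
  have "loop_inv {} {x \<in> H. \<tau> * c x \<le> f {x}}"
    using progress_start[OF H] by (simp add: progress_def)
  from loop_gain[OF this, where ctr = 0 and l = l] show ?thesis
    unfolding thresh_seq_unfold by (simp add: case_prod_beta' assms(2))
qed

end

section \<open>Rounds and queries of the threshold subroutine\<close>

context threshold_setting
begin

lemma card_thresh_queries:
  assumes inv: "loop_inv S X" and A: "A \<in> set_pmf (sample_seq c B S [] X)"
  shows "card (thresh_queries c B S X A) \<le> card N * (card N + 1)"
proof -
  note i = loop_invD[OF inv]
  let ?F = "\<lambda>j. insert (S \<union> prefix_set A j)
        ((\<lambda>a. {a} \<union> (S \<union> prefix_set A j)) ` X_set c B S X A j)"
  have F: "card (?F j) \<le> card N + 1" for j
  proof -
    have fin': "finite (X_set c B S X A j)" using i(5) by (simp add: X_set_def)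
    have "card (?F j) \<le> Suc (card ((\<lambda>a. {a} \<union> (S \<union> prefix_set A j)) ` X_set c B S X A j))"
      by (rule card_insert_le_m1) auto
    also have "card ((\<lambda>a. {a} \<union> (S \<union> prefix_set A j)) ` X_set c B S X A j) \<le> card (X_set c B S X A j)"
      by (rule card_image_le[OF fin'])
    also have "\<dots> \<le> card N" using i(2) fin by (intro card_mono) (auto simp: X_set_def)
    finally show ?thesis by simp
  qed
  have "card (thresh_queries c B S X A) \<le> (\<Sum>j\<in>{1..length A}. card (?F j))"
    unfolding thresh_queries_def by (rule card_UN_le) simp
  also have "\<dots> \<le> (\<Sum>j\<in>{1..length A}. card N + 1)" using F by (intro sum_mono)
  also have "\<dots> = length A * (card N + 1)" by simp
  also have "length A = card (set A)" using sample_run(2)[OF inv A] by (simp add: distinct_card)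
  also have "card (set A) * (card N + 1) \<le> card N * (card N + 1)"
    using sample_run(1)[OF inv A] i(2) fin by (intro mult_right_mono card_mono) auto
  finally show ?thesis .
qed

text \<open>If \<open>i_star\<close> is only the default \<open>length A\<close>, the claim still
  holds, because no candidate is left there (\<open>X_set_last\<close>).\<close>

lemma cost_shrinks:
  assumes inv: "loop_inv S X" and A: "A \<in> set_pmf (sample_seq c B S [] X)" and X: "X \<noteq> {}"
    and "\<not> j_star f c B \<tau> \<epsilon> S X A < i_star f c B \<tau> \<epsilon> S X A"
  shows "sum c (G_set f c B \<tau> S X A (k_star f c B \<tau> \<epsilon> S X A)) \<le> (1 - \<epsilon>) * sum c X"
proof -
  note i = loop_invD[OF inv]
  let ?k = "i_star f c B \<tau> \<epsilon> S X A"
  have k: "k_star f c B \<tau> \<epsilon> S X A = ?k" using assms(4) by (simp add: k_star_def)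
  have "?k \<in> insert (length A) {j \<in> {1..length A}. cost_stop f c B \<tau> \<epsilon> S X A j}"
    unfolding i_star_alt by (intro Min_in) auto
  then consider "?k = length A" | "cost_stop f c B \<tau> \<epsilon> S X A ?k" by auto
  then show ?thesis
  proof cases
    case 1
    have "X_set c B S X A (length A) = {}"
      using i cpos by (intro X_set_last[OF A]) auto
    then have "G_set f c B \<tau> S X A ?k = {}" unfolding 1 by (simp add: G_set_def)
    moreover have "0 \<le> (1 - \<epsilon>) * sum c X"
      using \<epsilon> i(2) cpos by (intro mult_nonneg_nonneg sum_nonneg) (auto intro: less_imp_le)
    ultimately show ?thesis unfolding k by simp
  next
    case 2
    then show ?thesis unfolding k by (simp add: cost_stop_def)
  qed
qed

text \<open>A round either raises the counter or shrinks the cost of \<open>X\<close> by the factor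
  \<open>1 - \<epsilon>\<close>, that is, lowers \<open>ln (sum c X / cm)\<close> by at least
  \<open>\<epsilon>\<close>. The logarithm is nonnegative while \<open>X\<close> is nonempty,
  because one element already costs \<open>cm\<close>. The \<open>l + 1\<close> allows for the last
  increment, from a counter below \<open>l\<close>.\<close>

lemma thresh_loop_complexity:
  assumes "(y, r, q) \<in> set_pmf (thresh_loop c B \<tau> \<epsilon> l S ctr X f)" "loop_inv S X" "0 < cm"
    "\<And>x. x \<in> X \<Longrightarrow> cm \<le> c x" "real ctr \<le> l + 1"
  shows "real r \<le> (if X = {} then 0 else 1 + ln (sum c X / cm) / \<epsilon>) + (l + 1 - real ctr) \<and>
    q \<le> r * (card N * (card N + 1))"
  using assms
proof (induction "card X" arbitrary: S ctr X r q rule: less_induct)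
  case less
  show ?case
  proof (cases "finite X \<and> X \<noteq> {} \<and> real ctr < l")
    case True
    then have X: "finite X" "X \<noteq> {}" "real ctr < l" by auto
    note i = loop_invD[OF less.prems(2)]
    let ?k = "\<lambda>A. k_star f c B \<tau> \<epsilon> S X A"
    from less.prems(1) obtain A r' q' where A: "A \<in> set_pmf (sample_seq c B S [] X)"
      and y: "(y, r', q') \<in> set_pmf (thresh_loop c B \<tau> \<epsilon> l (S \<union> prefix_set A (?k A))
          (if j_star f c B \<tau> \<epsilon> S X A < i_star f c B \<tau> \<epsilon> S X A then ctr + 1 else ctr)
          (G_set f c B \<tau> S X A (?k A)) f)"
      and rq: "r = Suc r'" "q = card (thresh_queries c B S X A) + q'"
      unfolding thresh_loop_step[OF X] by auto
    define X1 where "X1 = G_set f c B \<tau> S X A (?k A)"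
    define ctr1 where "ctr1 = (if j_star f c B \<tau> \<epsilon> S X A < i_star f c B \<tau> \<epsilon> S X A then ctr + 1 else ctr)"
    have X1: "X1 \<subset> X" unfolding X1_def by (rule G_set_psubset[OF A X(1,2)])
    have IH: "real r' \<le> (if X1 = {} then 0 else 1 + ln (sum c X1 / cm) / \<epsilon>) + (l + 1 - real ctr1) \<and>
        q' \<le> r' * (card N * (card N + 1))"
      unfolding X1_def ctr1_def
    proof (rule less.hyps[OF _ y])
      show "card (G_set f c B \<tau> S X A (?k A)) < card X"
        using A X by (intro psubset_card_mono G_set_psubset) auto
      show "loop_inv (S \<union> prefix_set A (?k A)) (G_set f c B \<tau> S X A (?k A))"
        by (rule loop_inv_step[OF less.prems(2) A])
      show "cm \<le> c x" if "x \<in> G_set f c B \<tau> S X A (?k A)" for x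
        using that less.prems(4)[of x] by (auto simp: G_set_def X_set_def)
    qed (use less.prems(3) X(3) in auto)
    have cX: "cm \<le> sum c X"
    proof -
      obtain x where x: "x \<in> X" using X by auto
      have "c x \<le> sum c X"
        using x X(1) i(2) cpos by (intro member_le_sum) (auto intro: less_imp_le)
      then show ?thesis using less.prems(4)[OF x] by simp
    qed
    have lnX: "0 \<le> ln (sum c X / cm) / \<epsilon>" using cX less.prems(3) \<epsilon> by auto
    have r': "real r' + 1 \<le> 1 + ln (sum c X / cm) / \<epsilon> + (l + 1 - real ctr)"
    proof (cases "j_star f c B \<tau> \<epsilon> S X A < i_star f c B \<tau> \<epsilon> S X A")
      case True
      have "(if X1 = {} then 0 else 1 + ln (sum c X1 / cm) / \<epsilon>) \<le> 1 + ln (sum c X / cm) / \<epsilon>"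
      proof (cases "X1 = {}")
        case False
        have "0 < sum c X1" using False X1 X(1) i(2) cpos by (intro sum_pos) (auto intro: finite_subset)
        moreover have "sum c X1 \<le> sum c X" using X1 i(2) by (intro sum_c_mono) auto
        ultimately have "ln (sum c X1 / cm) \<le> ln (sum c X / cm)"
          using less.prems(3) by (intro ln_mono divide_right_mono) auto
        then show ?thesis using False \<epsilon> by (simp add: divide_right_mono)
      qed (use lnX in auto)
      then show ?thesis using IH True by (simp add: ctr1_def)
    next
      case False
      have le: "sum c X1 \<le> (1 - \<epsilon>) * sum c X"
        unfolding X1_def by (rule cost_shrinks[OF less.prems(2) A X(2) False])
      have "(if X1 = {} then 0 else 1 + ln (sum c X1 / cm) / \<epsilon>) \<le> ln (sum c X / cm) / \<epsilon>"
      proof (cases "X1 = {}")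
        case ne: False
        have p1: "0 < sum c X1" using ne X1 X(1) i(2) cpos by (intro sum_pos) (auto intro: finite_subset)
        have p2: "0 < sum c X" using cX less.prems(3) by linarith
        have "ln (sum c X1 / cm) \<le> ln ((1 - \<epsilon>) * (sum c X / cm))"
          using le p1 less.prems(3) by (intro ln_mono) (auto simp: divide_right_mono)
        also have "\<dots> = ln (1 - \<epsilon>) + ln (sum c X / cm)"
          using \<epsilon> p2 less.prems(3) by (intro ln_mult_pos) auto
        also have "ln (1 - \<epsilon>) \<le> - \<epsilon>" using ln_add_one_self_le_self2[of "- \<epsilon>"] \<epsilon> by simp
        finally have "ln (sum c X1 / cm) / \<epsilon> \<le> (- \<epsilon> + ln (sum c X / cm)) / \<epsilon>"
          using \<epsilon> by (intro divide_right_mono) auto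
        then show ?thesis using ne \<epsilon> by (simp add: diff_divide_distrib)
      qed (use lnX in auto)
      then show ?thesis using IH False by (simp add: ctr1_def)
    qed
    moreover have "q \<le> r * (card N * (card N + 1))"
      using card_thresh_queries[OF less.prems(2) A] IH by (simp add: rq)
    ultimately show ?thesis using X(2) by (simp add: rq)
  next
    case False
    then have "r = 0" "q = 0" using less.prems(1) by (simp_all add: thresh_loop_done)
    moreover have "0 \<le> (if X = {} then 0 else 1 + ln (sum c X / cm) / \<epsilon>)"
    proof (cases "X = {}")
      case ne: False
      note i = loop_invD[OF less.prems(2)]
      obtain x where x: "x \<in> X" using ne by auto
      have "c x \<le> sum c X"
        using x i(2,5) cpos by (intro member_le_sum) (auto intro: less_imp_le)
      then have "cm \<le> sum c X" using less.prems(4)[OF x] by simp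
      then have "0 \<le> ln (sum c X / cm) / \<epsilon>" using less.prems(3) \<epsilon> by auto
      then show ?thesis using ne by simp
    qed simp
    ultimately show ?thesis using less.prems(5) by simp
  qed
qed

text \<open>Sampled elements cost between \<open>B / n\<close> and \<open>B\<close>, so the cost of
  \<open>X\<close> is at most \<open>n * n\<close> times the smallest cost, hence the factor 2 of
  the logarithm. The 3 collects the round of the initial filter and the two additive ones of
  \<open>thresh_loop_complexity\<close>.\<close>

lemma thresh_seq_complexity:
  assumes H: "H \<subseteq> N" "f {} = 0" "0 < B" "\<And>x. x \<in> H \<Longrightarrow> c x \<le> B"
    and cm: "\<And>x. x \<in> H \<Longrightarrow> B / real (card N) \<le> c x" and l: "0 \<le> l"
    and y: "(y, r, q) \<in> set_pmf (thresh_seq c H \<tau> \<epsilon> l B f)"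
  shows "real r \<le> 3 + 2 * ln (real (card N)) / \<epsilon> + l \<and>
    real q \<le> real (card N) + real r * (real (card N) * (real (card N) + 1))"
proof -
  let ?n = "real (card N)"
  let ?X0 = "{x \<in> H. \<tau> * c x \<le> f {x}}"
  have inv: "loop_inv {} ?X0"
    using progress_start[of H] H by (simp add: progress_def)
  from y obtain r' q' where y': "(y, r', q') \<in> set_pmf (thresh_loop c B \<tau> \<epsilon> l {} 0 ?X0 f)"
    and rq: "r = Suc r'" "q = card ((\<lambda>x. {x}) ` H) + q'"
    unfolding thresh_seq_unfold by auto
  have n0: "0 < ?n" if "x \<in> H" for x using that H(1) fin by (auto simp: card_gt_0_iff)
  have "real r' \<le> 1 + 2 * ln ?n / \<epsilon> + (l + 1) \<and> q' \<le> r' * (card N * (card N + 1))"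
  proof (cases "?X0 = {}")
    case True
    then have "r' = 0" "q' = 0" using y' by (simp_all add: thresh_loop_done)
    moreover have "0 \<le> ln ?n" using ln_ge_zero[of ?n] by (cases "card N = 0") auto
    ultimately show ?thesis using l \<epsilon> by simp
  next
    case False
    then obtain x where x: "x \<in> H" by auto
    have cm0: "0 < B / ?n" using n0[OF x] H(3) by simp
    have *: "real r' \<le> (if ?X0 = {} then 0 else 1 + ln (sum c ?X0 / (B / ?n)) / \<epsilon>) + (l + 1 - real 0) \<and>
      q' \<le> r' * (card N * (card N + 1))"
      using cm l by (intro thresh_loop_complexity[OF y' inv cm0]) auto
    have "sum c ?X0 \<le> (\<Sum>x\<in>?X0. B)" using H(4) by (intro sum_mono) auto
    also have "\<dots> \<le> ?n * B" using H(1,3) fin by (auto intro!: mult_right_mono card_mono)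
    finally have "sum c ?X0 / (B / ?n) \<le> ?n * B / (B / ?n)" using cm0 by (intro divide_right_mono) auto
    also have "\<dots> = ?n * ?n" using H(3) by simp
    finally have "ln (sum c ?X0 / (B / ?n)) \<le> ln (?n * ?n)"
    proof (intro ln_mono)
      have "0 < sum c ?X0" using False H(1) fin cpos by (intro sum_pos) (auto intro: finite_subset)
      then show "0 < sum c ?X0 / (B / ?n)" using cm0 by (rule divide_pos_pos)
    qed
    also have "\<dots> = 2 * ln ?n" using n0[OF x] by (simp add: ln_mult)
    finally have "ln (sum c ?X0 / (B / ?n)) / \<epsilon> \<le> 2 * ln ?n / \<epsilon>" using \<epsilon> by (intro divide_right_mono) auto
    then show ?thesis
      using conjunct1[OF *] conjunct2[OF *] unfolding if_not_P[OF False] by (intro conjI) linarith+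
  qed
  moreover have "card ((\<lambda>x. {x}) ` H) \<le> card N"
    using H(1) fin by (meson card_image_le card_mono finite_subset order.trans)
  moreover have "real q' \<le> real r' * (?n * (?n + 1))" if "q' \<le> r' * (card N * (card N + 1))"
    using of_nat_mono[OF that, where 'a = real] by (simp add: algebra_simps)
  moreover have "real r' * (?n * (?n + 1)) \<le> real r * (?n * (?n + 1))"
    unfolding rq by (intro mult_right_mono) auto
  ultimately show ?thesis unfolding rq by force
qed

end

section \<open>Results and costs of composed algorithms\<close>

definition result :: "('a, 'r) qalg \<Rightarrow> ('a set \<Rightarrow> real) \<Rightarrow> 'r pmf" where
  "result m f = map_pmf fst (m f)"

lemma set_result: "set_pmf (result m f) = output_set m f"
  by (simp add: result_def output_set_def outcomes_def)

lemma expected_value_result: "expected_value m f = measure_pmf.expectation (result m f) f"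
  by (simp add: expected_value_def result_def)

lemma result_qreturn [simp]: "result (qreturn x) f = return_pmf x"
  by (simp add: result_def qreturn_def)

lemma result_draw [simp]: "result (draw P) f = P"
  by (simp add: result_def draw_def map_pmf_comp)

lemma result_ask [simp]: "result (ask Q) f = return_pmf (restrict f Q)"
  by (simp add: result_def ask_def)

lemma result_qbind [simp]: "result (m \<bind>\<^sub>q k) f = bind_pmf (result m f) (\<lambda>x. result (k x) f)"
  by (simp add: result_def qbind_def map_bind_pmf bind_map_pmf map_pmf_comp case_prod_beta')

lemma result_par_Nil [simp]: "result (par []) f = return_pmf []"
  by simp

lemma result_par_Cons [simp]:
  "result (par (m # ms)) f = bind_pmf (result m f) (\<lambda>x. map_pmf (\<lambda>xs. x # xs) (result (par ms) f))"
  by (simp add: result_def map_bind_pmf bind_map_pmf map_pmf_comp case_prod_beta')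

lemma outcomes_qreturn: "outcomes (qreturn x) f = {(x, 0, 0)}"
  by (simp add: outcomes_def qreturn_def)

lemma outcomes_ask: "outcomes (ask Q) f = {(restrict f Q, 1, card Q)}"
  by (simp add: outcomes_def ask_def)

lemma outcomes_draw: "outcomes (draw P) f = (\<lambda>x. (x, 0, 0)) ` set_pmf P"
  by (simp add: outcomes_def draw_def)

lemma outcomes_qbindE:
  assumes "(y, r, q) \<in> outcomes (m \<bind>\<^sub>q k) f"
  obtains x r1 q1 r2 q2 where "(x, r1, q1) \<in> outcomes m f" "(y, r2, q2) \<in> outcomes (k x) f"
    "r = r1 + r2" "q = q1 + q2"
  using assms by (auto simp: outcomes_def qbind_def)

section \<open>Values reached by independent parallel runs\<close>

lemma finite_result_par:
  assumes "\<And>m. m \<in> set ms \<Longrightarrow> finite (set_pmf (result m f))"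
  shows "finite (set_pmf (result (par ms) f))"
  using assms
proof (induction ms)
  case (Cons m ms)
  then show ?case
    unfolding result_par_Cons set_bind_pmf set_map_pmf
    by (intro finite_UN_I finite_imageI) auto
qed (simp del: par.simps)

lemma expectation_ge_const:
  fixes g :: "'b \<Rightarrow> real"
  assumes "finite (set_pmf M)" "\<And>x. x \<in> set_pmf M \<Longrightarrow> a \<le> g x"
  shows "a \<le> measure_pmf.expectation M g"
proof -
  have "measure_pmf.expectation M (\<lambda>_. a) \<le> measure_pmf.expectation M g"
    using assms by (intro integral_mono_AE integrable_measure_pmf_finite) (auto simp: AE_measure_pmf_iff)
  then show ?thesis by simp
qed

lemma par_expectation_ge:
  fixes F :: "'r \<Rightarrow> real" and \<Phi> :: "'r list \<Rightarrow> real"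
  assumes "\<And>m. m \<in> set ms \<Longrightarrow> finite (set_pmf (result m f))" "m \<in> set ms"
    "\<And>xs x. xs \<in> set_pmf (result (par ms) f) \<Longrightarrow> x \<in> set xs \<Longrightarrow> F x \<le> \<Phi> xs"
  shows "measure_pmf.expectation (result m f) F \<le> measure_pmf.expectation (result (par ms) f) \<Phi>"
  using assms
proof (induction ms arbitrary: \<Phi>)
  case (Cons m0 ms)
  have fin: "finite (set_pmf (result m0 f))" "finite (set_pmf (result (par ms) f))"
    using Cons.prems(1) finite_result_par[of ms f] by auto
  have ge: "F z \<le> \<Phi> (x # xs)"
    if "x \<in> set_pmf (result m0 f)" "xs \<in> set_pmf (result (par ms) f)" "z \<in> set (x # xs)" for x xs z
    using that by (intro Cons.prems(3)) (auto simp del: par.simps)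
  show ?case
  proof (cases "m = m0")
    case True
    show ?thesis unfolding result_par_Cons True
    proof (rule expectation_bind_ge)
      fix x assume x: "x \<in> set_pmf (result m0 f)"
      show "F x \<le> measure_pmf.expectation (map_pmf (\<lambda>xs. x # xs) (result (par ms) f)) \<Phi>"
        unfolding integral_map_pmf using fin ge[OF x] by (intro expectation_ge_const) auto
    qed (use fin in auto)
  next
    case False
    have "measure_pmf.expectation (result m f) F =
        measure_pmf.expectation (result m0 f) (\<lambda>_. measure_pmf.expectation (result m f) F)" by simp
    also have "\<dots> \<le> measure_pmf.expectation (result (par (m0 # ms)) f) \<Phi>"
      unfolding result_par_Cons
    proof (rule expectation_bind_ge)
      fix x assume x: "x \<in> set_pmf (result m0 f)"
      show "measure_pmf.expectation (result m f) F \<le>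
          measure_pmf.expectation (map_pmf (\<lambda>xs. x # xs) (result (par ms) f)) \<Phi>"
        unfolding integral_map_pmf using Cons.prems False ge[OF x] by (intro Cons.IH) auto
    qed (use fin in auto)
    finally show ?thesis .
  qed
qed simp

text \<open>By independence the probability that every run misses \<open>\<theta>\<close> is the
  product of the single ones; in that event only \<open>0 \<le> \<Phi> xs\<close> is used.\<close>

lemma par_hit:
  fixes F :: "'r \<Rightarrow> real" and \<Phi> :: "'r list \<Rightarrow> real"
  assumes "\<And>m. m \<in> set ms \<Longrightarrow> finite (set_pmf (result m f))" "0 \<le> \<theta>"
    "\<And>xs. xs \<in> set_pmf (result (par ms) f) \<Longrightarrow> 0 \<le> \<Phi> xs"
    "\<And>xs x. xs \<in> set_pmf (result (par ms) f) \<Longrightarrow> x \<in> set xs \<Longrightarrow> \<theta> \<le> F x \<Longrightarrow> \<theta> \<le> \<Phi> xs"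
  shows "\<theta> * (1 - prod_list (map (\<lambda>m. measure_pmf.prob (result m f) {x. F x < \<theta>}) ms))
    \<le> measure_pmf.expectation (result (par ms) f) \<Phi>"
  using assms
proof (induction ms arbitrary: \<Phi>)
  case Nil
  then show ?case by simp
next
  case (Cons m0 ms)
  let ?M = "result m0 f"
  let ?\<pi> = "prod_list (map (\<lambda>m. measure_pmf.prob (result m f) {x. F x < \<theta>}) ms)"
  have fin: "finite (set_pmf ?M)" "finite (set_pmf (result (par ms) f))"
    using Cons.prems(1) finite_result_par[of ms f] by auto
  have "\<theta> * (1 - measure_pmf.prob ?M {x. F x < \<theta>} * ?\<pi>) =
      \<theta> - \<theta> * ?\<pi> * measure_pmf.expectation ?M (indicator {x. F x < \<theta>})"
    by (simp add: algebra_simps)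
  also have "\<dots> = measure_pmf.expectation ?M (\<lambda>x. \<theta> - \<theta> * ?\<pi> * indicator {x. F x < \<theta>} x)"
    using fin by (subst Bochner_Integration.integral_diff) (auto intro!: integrable_measure_pmf_finite)
  also have "\<dots> \<le> measure_pmf.expectation (result (par (m0 # ms)) f) \<Phi>"
    unfolding result_par_Cons
  proof (rule expectation_bind_ge)
    fix x assume x: "x \<in> set_pmf ?M"
    have in_par: "x # xs \<in> set_pmf (result (par (m0 # ms)) f)" if "xs \<in> set_pmf (result (par ms) f)" for xs
      using x that by (auto simp del: par.simps)
    show "\<theta> - \<theta> * ?\<pi> * indicator {x. F x < \<theta>} x \<le>
        measure_pmf.expectation (map_pmf (\<lambda>xs. x # xs) (result (par ms) f)) \<Phi>"
    proof (cases "F x < \<theta>")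
      case True
      have "\<theta> * (1 - ?\<pi>) \<le> measure_pmf.expectation (result (par ms) f) (\<lambda>xs. \<Phi> (x # xs))"
      proof (rule Cons.IH)
        show "\<theta> \<le> \<Phi> (x # xs)" if "xs \<in> set_pmf (result (par ms) f)" "z \<in> set xs" "\<theta> \<le> F z" for xs z
          using Cons.prems(4)[OF in_par[OF that(1)], of z] that by auto
      qed (use Cons.prems in_par in auto)
      then show ?thesis using True by (simp add: algebra_simps)
    next
      case False
      have "\<theta> \<le> measure_pmf.expectation (result (par ms) f) (\<lambda>xs. \<Phi> (x # xs))"
        using fin False Cons.prems(4)[OF in_par, of _ x] by (intro expectation_ge_const) auto
      then show ?thesis using False by simp
    qed
  qed (use fin in auto)
  finally show ?case by simp
qed

lemma set_par_result:
  "xs \<in> set_pmf (result (par ms) f) \<Longrightarrow> x \<in> set xs \<Longrightarrow> \<exists>m\<in>set ms. x \<in> set_pmf (result m f)"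
proof (induction ms arbitrary: xs)
  case (Cons m ms)
  then obtain y ys where "y \<in> set_pmf (result m f)" "ys \<in> set_pmf (result (par ms) f)" "xs = y # ys"
    by (auto simp del: par.simps)
  then show ?case using Cons.IH[of ys] Cons.prems(2) by auto
qed simp

lemma par_complexity:
  assumes "(xs, r, q) \<in> outcomes (par ms) f" "0 \<le> R" "0 \<le> Q"
    "\<And>m x r q. m \<in> set ms \<Longrightarrow> (x, r, q) \<in> outcomes m f \<Longrightarrow> real r \<le> R \<and> real q \<le> Q"
  shows "length xs = length ms \<and> real r \<le> R \<and> real q \<le> real (length ms) * Q"
  using assms
proof (induction ms arbitrary: xs r q)
  case Nil
  then show ?case by (simp add: outcomes_qreturn)
next
  case (Cons m ms)
  from Cons.prems(1) obtain x r1 q1 xs' r2 q2 where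
    "(x, r1, q1) \<in> outcomes m f" "(xs', r2, q2) \<in> outcomes (par ms) f"
    "xs = x # xs'" "r = max r1 r2" "q = q1 + q2"
    by (auto simp: outcomes_def)
  moreover from this have "length xs' = length ms \<and> real r2 \<le> R \<and> real q2 \<le> real (length ms) * Q"
    using Cons.prems by (intro Cons.IH) auto
  moreover have "real r1 \<le> R \<and> real q1 \<le> Q" using Cons.prems(4)[of m x r1 q1] calculation by auto
  ultimately show ?case by (auto simp: distrib_right)
qed

text \<open>From the product over the whole grid of runs only the block of one threshold is
  retained; all other factors are at most 1.\<close>

lemma prod_list_replicates_le:
  fixes g :: "'m \<Rightarrow> real"
  assumes "\<And>m. 0 \<le> g m" "\<And>m. g m \<le> 1" "i \<in> set js"
  shows "prod_list (map g (concat (map (\<lambda>i. map (\<lambda>_. M i) ks) js))) \<le> g (M i) ^ length ks"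
  using assms(3)
proof (induction js)
  case (Cons j js)
  have blk: "prod_list (map g (map (\<lambda>_. M j) ks)) = g (M j) ^ length ks" for j
    by (induction ks) auto
  let ?rest = "prod_list (map g (concat (map (\<lambda>i. map (\<lambda>_. M i) ks) js)))"
  have rest: "0 \<le> ?rest" "?rest \<le> 1"
  proof -
    have "0 \<le> prod_list (map g xs) \<and> prod_list (map g xs) \<le> 1" for xs
      by (induction xs) (auto simp: assms mult_le_one)
    then show "0 \<le> ?rest" "?rest \<le> 1" by blast+
  qed
  have eq: "prod_list (map g (concat (map (\<lambda>i. map (\<lambda>_. M i) ks) (j # js)))) = g (M j) ^ length ks * ?rest"
    using blk[of j] by simp
  show ?case
  proof (cases "i = j")
    case True
    then show ?thesis unfolding eq using rest assms(1) by (simp add: mult_left_le)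
  next
    case False
    then have "?rest \<le> g (M i) ^ length ks" using Cons by auto
    moreover have "g (M j) ^ length ks * ?rest \<le> ?rest"
      using rest assms(1,2) by (intro mult_left_le_one_le) (auto intro: power_le_one)
    ultimately show ?thesis unfolding eq by linarith
  qed
qed simp

section \<open>Approximation guarantee\<close>

lemma expectation_ge_tail:
  fixes u :: "'b \<Rightarrow> real"
  assumes "finite (set_pmf M)" "0 \<le> s" "\<And>y. y \<in> set_pmf M \<Longrightarrow> 0 \<le> u y"
    "measure_pmf.prob M {y. u y \<le> s} \<le> e"
  shows "s * (1 - e) \<le> measure_pmf.expectation M u"
proof -
  have "s * (1 - e) \<le> s * (1 - measure_pmf.prob M {y. u y \<le> s})"
    using assms by (intro mult_left_mono) auto
  also have "\<dots> = s - s * measure_pmf.expectation M (indicator {y. u y \<le> s})"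
    by (simp add: algebra_simps)
  also have "\<dots> = measure_pmf.expectation M (\<lambda>y. s - s * indicator {y. u y \<le> s} y)"
    using assms(1) by (subst Bochner_Integration.integral_diff) (auto intro!: integrable_measure_pmf_finite)
  also have "\<dots> \<le> measure_pmf.expectation M u"
    using assms by (intro integral_mono_AE integrable_measure_pmf_finite)
      (auto simp: AE_measure_pmf_iff indicator_def)
  finally show ?thesis .
qed

lemma finite_result_thresh_seq: "finite (set_pmf (result (thresh_seq c H \<tau> \<epsilon> l B) f))"
  by (simp add: result_def finite_thresh_seq)

context threshold_setting
begin

text \<open>One factor \<open>1 - \<epsilon>\<close> accounts for the chance of a cheap outcome; the
  other two come from the expected gain per cost in \<open>thresh_seq_gain\<close>.\<close>

lemma expensive_value:
  assumes H: "H \<subseteq> N" "f {} = 0" "0 \<le> B" "\<And>x. x \<in> H \<Longrightarrow> c x \<le> B" and s: "0 \<le> s"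
    and pr: "measure_pmf.prob (result (thresh_seq c H \<tau> \<epsilon> (1 / \<epsilon>\<^sup>2) B) f) {y. sum c y \<le> s} \<le> \<epsilon>"
  shows "(1 - \<epsilon>) ^ 3 * (\<tau> * s) \<le> measure_pmf.expectation (result (thresh_seq c H \<tau> \<epsilon> (1 / \<epsilon>\<^sup>2) B) f) f"
proof -
  let ?M = "result (thresh_seq c H \<tau> \<epsilon> (1 / \<epsilon>\<^sup>2) B) f"
  have fin': "finite (set_pmf ?M)" by (rule finite_result_thresh_seq)
  have "0 \<le> sum c y" if y: "y \<in> set_pmf ?M" for y
  proof -
    from y obtain r q where "(y, r, q) \<in> set_pmf (thresh_seq c H \<tau> \<epsilon> (1 / \<epsilon>\<^sup>2) B f)"
      by (auto simp: result_def)
    then have "y \<subseteq> N" using thresh_seq_outcome(1)[OF H] H(1) by blast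
    then show ?thesis using cpos by (intro sum_nonneg) (auto intro: less_imp_le)
  qed
  then have "s * (1 - \<epsilon>) \<le> measure_pmf.expectation ?M (sum c)"
    using expectation_ge_tail[OF fin' s _ pr] by blast
  then have "((1 - \<epsilon>)\<^sup>2 * \<tau>) * (s * (1 - \<epsilon>)) \<le> ((1 - \<epsilon>)\<^sup>2 * \<tau>) * measure_pmf.expectation ?M (sum c)"
    using \<tau> by (intro mult_left_mono) auto
  also have "\<dots> \<le> measure_pmf.expectation ?M f"
  proof -
    have "0 \<le> measure_pmf.expectation ?M (\<lambda>y. f y - (1 - \<epsilon>)\<^sup>2 * \<tau> * sum c y)"
      using thresh_seq_gain[OF H, of "1 / \<epsilon>\<^sup>2"] by (simp add: result_def)
    also have "\<dots> = measure_pmf.expectation ?M f - (1 - \<epsilon>)\<^sup>2 * \<tau> * measure_pmf.expectation ?M (sum c)"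
      using fin' by (subst Bochner_Integration.integral_diff) (auto intro!: integrable_measure_pmf_finite)
    finally show ?thesis by simp
  qed
  finally show ?thesis by (simp add: power2_eq_square power3_eq_cube mult_ac)
qed

text \<open>A cheap outcome \<open>y\<close> leaves room for every element of \<open>T\<close>, so
  \<open>z \<le> f (y \<union> T) \<le> (1 + \<epsilon>) * f y + \<tau> * sum c T\<close>. A
  probability as small as \<open>\<epsilon>\<close> is useful, because the repeated runs then find
  such an outcome almost surely.\<close>

lemma cheap_value:
  assumes H: "H \<subseteq> N" "f {} = 0" "0 \<le> B" "\<And>x. x \<in> H \<Longrightarrow> c x \<le> B"
    and T: "T \<subseteq> H" "\<And>x. x \<in> T \<Longrightarrow> c x \<le> \<gamma>" and z: "\<And>S. S \<subseteq> H \<Longrightarrow> z \<le> f (S \<union> T)"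
    and pr: "\<epsilon> \<le> measure_pmf.prob (result (thresh_seq c H \<tau> \<epsilon> (1 / \<epsilon>\<^sup>2) B) f) {y. sum c y \<le> B - \<gamma>}"
  shows "\<epsilon> \<le> measure_pmf.prob (result (thresh_seq c H \<tau> \<epsilon> (1 / \<epsilon>\<^sup>2) B) f)
    {y. (z - \<tau> * sum c T) / (1 + \<epsilon>) \<le> f y}"
proof -
  let ?M = "result (thresh_seq c H \<tau> \<epsilon> (1 / \<epsilon>\<^sup>2) B) f"
  have "measure_pmf.prob ?M {y. sum c y \<le> B - \<gamma>} =
      measure_pmf.prob ?M ({y. sum c y \<le> B - \<gamma>} \<inter> set_pmf ?M)" by (rule measure_Int_set_pmf[symmetric])
  also have "\<dots> \<le> measure_pmf.prob ?M {y. (z - \<tau> * sum c T) / (1 + \<epsilon>) \<le> f y}"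
  proof (rule measure_pmf.finite_measure_mono)
    show "{y. sum c y \<le> B - \<gamma>} \<inter> set_pmf ?M \<subseteq> {y. (z - \<tau> * sum c T) / (1 + \<epsilon>) \<le> f y}"
    proof
      fix y assume y: "y \<in> {y. sum c y \<le> B - \<gamma>} \<inter> set_pmf ?M"
      then obtain r q where *: "(y, r, q) \<in> set_pmf (thresh_seq c H \<tau> \<epsilon> (1 / \<epsilon>\<^sup>2) B f)"
        by (auto simp: result_def)
      have "f (y \<union> T) \<le> (1 + \<epsilon>) * f y + \<tau> * sum c T"
        using y T by (intro thresh_seq_outcome(3)[OF H *]) auto
      moreover have "z \<le> f (y \<union> T)" by (rule z[OF thresh_seq_outcome(1)[OF H *]])
      ultimately show "y \<in> {y. (z - \<tau> * sum c T) / (1 + \<epsilon>) \<le> f y}"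
        using \<epsilon> by (simp add: pos_divide_le_eq mult.commute)
    qed
  qed simp
  finally show ?thesis using pr by simp
qed

end

text \<open>A discrete intermediate value argument, used for the property that a threshold often
  yields cheap outcomes.\<close>

lemma transition_index:
  fixes L :: "nat \<Rightarrow> bool"
  obtains "\<not> L 0" | "L k" | i where "Suc i \<le> k" "L i" "\<not> L (Suc i)"
proof -
  have "\<not> L 0 \<or> L k \<or> (\<exists>i. Suc i \<le> k \<and> L i \<and> \<not> L (Suc i))"
  proof (induction k)
    case (Suc k)
    then show ?case by (metis le_SucI order_refl)
  qed auto
  then show ?thesis using that by blast
qed

text \<open>
  The value \<open>\<omega>\<close> is what the runs for all thresholds achieve together on a fixed sample \<open>H\<close>.  Either
  the largest threshold already produces expensive solutions, or there is a threshold with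
  cheap solutions whose successor produces expensive ones (or all are cheap).
\<close>

lemma sample_value:
  fixes g :: "'a set \<Rightarrow> real" and c :: "'a \<Rightarrow> real"
  defines "M \<equiv> \<lambda>H \<tau> e B. result (thresh_seq c H \<tau> e (1 / e\<^sup>2) B) g"
  assumes fin: "finite N" and nn: "nonneg_on N g" and sub: "submodular_on N g" and g0: "g {} = 0"
    and cpos: "\<And>x. x \<in> N \<Longrightarrow> 0 < c x" and e: "0 < e" "e < 1" and B: "0 < B"
    and H: "H \<subseteq> N" "\<And>x. x \<in> H \<Longrightarrow> c x \<le> B" and W: "0 \<le> W" and a: "0 \<le> a" "a \<le> 1" and n: "0 < n"
    and last: "(1 - e) ^ k \<le> 1 / n"
    and \<omega>W: "W \<le> \<omega>"
    and \<omega>E: "\<And>i. i \<le> k \<Longrightarrow> measure_pmf.expectation (M H (a * n * W / B * (1 - e) ^ i) e B) g \<le> \<omega>"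
    and \<omega>P: "\<And>i \<theta>. i \<le> k \<Longrightarrow> 0 \<le> \<theta> \<Longrightarrow>
      e \<le> measure_pmf.prob (M H (a * n * W / B * (1 - e) ^ i) e B) {y. \<theta> \<le> g y} \<Longrightarrow> (1 - e) * \<theta> \<le> \<omega>"
    and T: "T \<subseteq> H" "\<And>x. x \<in> T \<Longrightarrow> c x \<le> \<gamma>" and \<gamma>: "\<gamma> < B" "0 \<le> \<gamma>"
    and z: "\<And>S. S \<subseteq> H \<Longrightarrow> z \<le> g (S \<union> T)"
  shows "(1 - e) ^ 4 * min (a * (n * W * (1 - \<gamma> / B))) (z / (1 + sum c T / (B - \<gamma>))) \<le> \<omega>"
proof -
  define s where "s = B - \<gamma>"
  define \<tau> where "\<tau> = (\<lambda>i. a * n * W / B * (1 - e) ^ i)"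
  define q where "q = 1 + sum c T / s"
  have s: "0 < s" "s \<le> B" using \<gamma> by (auto simp: s_def)
  have cT: "0 \<le> sum c T" using T(1) H(1) cpos by (intro sum_nonneg) (auto intro: less_imp_le)
  have q: "1 \<le> q" using cT s by (simp add: q_def)
  have \<omega>0: "0 \<le> \<omega>" using W \<omega>W by simp
  have ts: "threshold_setting N g c (\<tau> i) e" for i
    using fin nn sub cpos e a n W B by unfold_locales (auto simp: \<tau>_def)
  let ?low = "\<lambda>i. e \<le> measure_pmf.prob (M H (\<tau> i) e B) {y. sum c y \<le> s}"
  have high: "(1 - e) ^ 3 * (\<tau> i * s) \<le> \<omega>" if "i \<le> k" "\<not> ?low i" for i
  proof -
    have "(1 - e) ^ 3 * (\<tau> i * s) \<le> measure_pmf.expectation (M H (\<tau> i) e B) g"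
      unfolding M_def using H g0 B s that(2)
      by (intro threshold_setting.expensive_value[OF ts]) (auto simp: M_def)
    then show ?thesis using \<omega>E[OF that(1)] by (simp add: \<tau>_def)
  qed
  have low: "z \<le> \<omega> * ((1 + e) / (1 - e)) + \<tau> i * sum c T" if "i \<le> k" "?low i" for i
  proof (cases "z \<le> \<tau> i * sum c T")
    case True
    have "0 \<le> \<omega> * ((1 + e) / (1 - e))" using \<omega>0 e by simp
    then show ?thesis using True by linarith
  next
    case False
    let ?\<theta> = "(z - \<tau> i * sum c T) / (1 + e)"
    have "e \<le> measure_pmf.prob (M H (\<tau> i) e B) {y. ?\<theta> \<le> g y}"
      unfolding M_def using H g0 B T z that(2)
      by (intro threshold_setting.cheap_value[OF ts]) (auto simp: M_def s_def)
    moreover have "0 \<le> ?\<theta>" using False e by simp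
    ultimately have "(1 - e) * ?\<theta> \<le> \<omega>" using \<omega>P[OF that(1)] unfolding \<tau>_def by blast
    then show ?thesis using e by (simp add: field_simps)
  qed
  have e4: "(1 - e) ^ 4 * ((1 + e) / (1 - e)) \<le> 1"
  proof -
    have "(1 - e) ^ 4 * ((1 + e) / (1 - e)) = (1 - e) ^ 2 * ((1 - e) * (1 + e))"
      using e by (simp add: power4_eq_xxxx power2_eq_square)
    also have "\<dots> \<le> 1 * 1"
    proof (rule mult_mono)
      show "(1 - e) * (1 + e) \<le> 1" using e by (simp add: algebra_simps)
    qed (use e in \<open>auto intro: power_le_one\<close>)
    finally show ?thesis by simp
  qed
  \<comment> \<open>The bound from cheap outcomes is
    \<open>z \<le> \<omega> * ((1 + e) / (1 - e)) + \<tau> i * sum c T\<close>. Bounding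
    \<open>\<tau> i\<close> by \<open>\<omega> / s\<close> up to the power of \<open>1 - e\<close>
    and solving for \<open>\<omega>\<close> creates the denominator
    \<open>q = 1 + sum c T / s\<close>.\<close>
  have finish: "(1 - e) ^ 4 * min (a * (n * W * (1 - \<gamma> / B))) (z / q) \<le> \<omega>"
    if t: "i \<le> k" "?low i" "(1 - e) ^ 4 * \<tau> i * s \<le> \<omega>" for i
  proof -
    have "(1 - e) ^ 4 * z \<le> (1 - e) ^ 4 * (\<omega> * ((1 + e) / (1 - e)) + \<tau> i * sum c T)"
      using low[OF t(1,2)] e by (intro mult_left_mono) auto
    also have "\<dots> = \<omega> * ((1 - e) ^ 4 * ((1 + e) / (1 - e))) + ((1 - e) ^ 4 * \<tau> i * s) * (sum c T / s)"
      using s by (simp add: distrib_left)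
    also have "\<dots> \<le> \<omega> * 1 + \<omega> * (sum c T / s)"
      using e4 t(3) \<omega>0 cT s by (intro add_mono mult_left_mono mult_right_mono) auto
    also have "\<dots> = \<omega> * q" by (simp add: q_def distrib_left)
    finally have "(1 - e) ^ 4 * (z / q) \<le> \<omega>" using q by (simp add: pos_divide_le_eq)
    moreover have "(1 - e) ^ 4 * min (a * (n * W * (1 - \<gamma> / B))) (z / q) \<le> (1 - e) ^ 4 * (z / q)"
      using e by (intro mult_left_mono) auto
    ultimately show ?thesis by linarith
  qed
  consider "\<not> ?low 0" | "?low k" | i where "Suc i \<le> k" "?low i" "\<not> ?low (Suc i)"
    by (rule transition_index[where L = ?low and k = k])
  then have "(1 - e) ^ 4 * min (a * (n * W * (1 - \<gamma> / B))) (z / q) \<le> \<omega>"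
  proof cases
    case 1
    have A: "a * (n * W * (1 - \<gamma> / B)) = \<tau> 0 * s" using B by (simp add: \<tau>_def s_def field_simps)
    have A0: "0 \<le> \<tau> 0 * s" using a n W B s by (simp add: \<tau>_def)
    have "(1 - e) ^ 4 * min (a * (n * W * (1 - \<gamma> / B))) (z / q) \<le> (1 - e) ^ 4 * (\<tau> 0 * s)"
      unfolding A using e by (intro mult_left_mono) auto
    also have "\<dots> \<le> (1 - e) ^ 3 * (\<tau> 0 * s)"
      using e A0 by (intro mult_right_mono power_decreasing) auto
    also have "\<dots> \<le> \<omega>" using high[of 0] 1 by simp
    finally show ?thesis .
  next
    case 2
    \<comment> \<open>The last threshold is so small that the whole budget at this density is worth
      at most \<open>a * W\<close>, which the best singleton already covers.\<close>
    have "\<tau> k * s \<le> \<tau> k * B" using s a n W B e by (intro mult_left_mono) (auto simp: \<tau>_def)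
    also have "\<dots> = a * n * W * (1 - e) ^ k" using B by (simp add: \<tau>_def)
    also have "\<dots> \<le> a * n * W * (1 / n)" using last a n W by (intro mult_left_mono) auto
    also have "\<dots> = a * W" using n by simp
    also have "\<dots> \<le> 1 * \<omega>" using a W \<omega>W by (intro mult_mono) auto
    finally have t: "\<tau> k * s \<le> \<omega>" by simp
    have "(1 - e) ^ 4 * (\<tau> k * s) \<le> 1 * (\<tau> k * s)"
      using e a n W B s by (intro mult_right_mono power_le_one) (auto simp: \<tau>_def)
    then show ?thesis using t 2 by (intro finish[of k]) (auto simp: mult.assoc)
  next
    case 3
    \<comment> \<open>The fourth factor \<open>1 - e\<close> pays for the ratio of consecutive
      thresholds.\<close>
    have "(1 - e) ^ 4 * \<tau> i * s = (1 - e) ^ 3 * (\<tau> (Suc i) * s)"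
      by (simp add: \<tau>_def power4_eq_xxxx power3_eq_cube)
    then show ?thesis using high[OF 3(1,3)] 3 by (intro finish[of i]) auto
  qed
  then show ?thesis by (simp add: q_def s_def)
qed

text \<open>Transfers the bounds on single samples to \<open>averaging_normalized\<close>: values
  are divided by the total weight \<open>D\<close>, costs by \<open>B\<close>, and
  \<open>\<omega>\<close> in addition by \<open>\<mu>\<close>. \<open>additive_minorant\<close>
  supplies the weights on a part of \<open>Y\<close>, and \<open>damaged_value\<close> the losses
  caused by the rest of the sample.\<close>

lemma subset_average:
  fixes g :: "'a set \<Rightarrow> real" and c :: "'a \<Rightarrow> real" and \<omega> :: "'a set \<Rightarrow> real"
  assumes p: "0.36602 \<le> p" "p \<le> 0.36603" "2 * p\<^sup>2 = 1 - 2 * p"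
    and fin: "finite N" and nn: "nonneg_on N g" and sub: "submodular_on N g" and g0: "g {} = 0"
    and B: "0 < B" and XN: "X \<subseteq> N" and n: "0 < n" "\<And>x. x \<in> X \<Longrightarrow> B \<le> n * c x"
    and Y: "Y \<subseteq> X" "sum c Y \<le> B" and W: "\<And>x. x \<in> X \<Longrightarrow> g {x} \<le> W"
    and \<mu>: "0 < \<mu>" "\<mu> \<le> 1" and v: "0 \<le> v"
    and \<omega>vW: "\<And>H. H \<subseteq> X \<Longrightarrow> v \<le> \<omega> H" "\<And>H. H \<subseteq> X \<Longrightarrow> W \<le> \<omega> H"
    and \<omega>: "\<And>H T \<gamma> z. H \<subseteq> X \<Longrightarrow> T \<subseteq> H \<Longrightarrow> (\<And>x. x \<in> T \<Longrightarrow> c x \<le> \<gamma>) \<Longrightarrow> 0 \<le> \<gamma> \<Longrightarrow> \<gamma> < B \<Longrightarrow>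
      (\<And>S. S \<subseteq> H \<Longrightarrow> z \<le> g (S \<union> T)) \<Longrightarrow>
      \<mu> * min ((1 - 2 * p) * (n * W * (1 - \<gamma> / B))) (z / (1 + sum c T / (B - \<gamma>))) \<le> \<omega> H"
  shows "\<mu> * (2 * v + g Y) \<le> 9.465 * subset_mean p X \<omega>"
proof -
  have finX: "finite X" using XN fin finite_subset by auto
  obtain I d where I: "I \<subseteq> Y" "\<And>x. x \<in> I \<Longrightarrow> 0 < d x" "\<And>x. x \<in> I \<Longrightarrow> d x \<le> g {x}"
    "\<And>T. T \<subseteq> I \<Longrightarrow> sum d T \<le> g T" "g Y \<le> sum d I"
  proof -
    show thesis
      by (rule additive_minorant[OF sub finite_subset[OF Y(1) finX] subset_trans[OF Y(1) XN] g0])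
        (rule that)
  qed
  have c0: "0 < c x" if "x \<in> X" for x
  proof (rule ccontr)
    assume "\<not> 0 < c x"
    then have "n * c x \<le> 0" using n(1) by (intro mult_nonneg_nonpos) auto
    then show False using n(2)[OF that] B by linarith
  qed
  have finI: "finite I" using I(1) Y(1) finX by (meson finite_subset)
  show ?thesis
  proof (cases "I = {}")
    case True
    then have "g Y \<le> 0" using I(5) by simp
    then have "\<mu> * (2 * v + g Y) \<le> \<mu> * (2 * v)" using \<mu> by (intro mult_left_mono) auto
    also have "\<dots> \<le> 1 * (2 * v)" using \<mu> v by (intro mult_right_mono) auto
    also have "\<dots> \<le> 9.465 * v" using v by simp
    also have "v \<le> subset_mean p X \<omega>"
      using subset_mean_mono[OF finX, of "\<lambda>_. v" \<omega> p] \<omega>vW(1) by (simp add: subset_mean_const)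
    finally show ?thesis by simp
  next
    case False
    define D where "D = sum d I"
    have D: "0 < D" unfolding D_def using I(2) False finI by (intro sum_pos) auto
    have "2 * (v / D) + 1 \<le> 9.465 * subset_mean p X (\<lambda>H. \<omega> H / (\<mu> * D))"
    proof (rule averaging_normalized[where d = "\<lambda>x. d x / D" and c = "\<lambda>x. c x / B" and W = "W / D" and N = n and I = I])
      show "I \<subseteq> X" using I(1) Y(1) by auto
      show "0 < d x / D" if "x \<in> I" for x using I(2)[OF that] D by simp
      show "d x / D \<le> W / D" if "x \<in> I" for x
      proof -
        have "x \<in> X" using that I(1) Y(1) by auto
        then have "d x \<le> W" using I(3)[OF that] W[of x] by linarith
        then show ?thesis using D by (intro divide_right_mono) auto
      qed
      show "(\<Sum>x\<in>I. d x / D) = 1" using D by (simp add: D_def flip: sum_divide_distrib)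
      show "1 \<le> n * (c x / B)" if "x \<in> I" for x
        using n(2)[of x] that I(1) Y(1) B by (auto simp: pos_le_divide_eq)
      have "sum c I \<le> sum c Y"
      proof (rule sum_mono2)
        show "0 \<le> c b" if "b \<in> Y - I" for b using c0[of b] that Y(1) by auto
      qed (use I(1) Y(1) finX finite_subset in auto)
      then show "(\<Sum>x\<in>I. c x / B) \<le> 1" using Y(2) B by (simp flip: sum_divide_distrib)
      have scale: "u / D \<le> x / (\<mu> * D)" if "u \<le> x" "0 \<le> x" for u x
      proof -
        have "u * \<mu> \<le> x * \<mu>" using that \<mu> by (intro mult_right_mono) auto
        also have "\<dots> \<le> x * 1" using that \<mu> by (intro mult_left_mono) auto
        finally have "u \<le> x / \<mu>" using \<mu> by (simp add: pos_le_divide_eq)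
        then have "u / D \<le> x / \<mu> / D" using D by (intro divide_right_mono) auto
        then show ?thesis by simp
      qed
      show "v / D \<le> \<omega> H / (\<mu> * D)" if "H \<subseteq> X" for H
        using \<omega>vW(1)[OF that] v by (intro scale) auto
      show "W / D \<le> \<omega> H / (\<mu> * D)" if "H \<subseteq> X" for H
        using \<omega>vW[OF that] v by (intro scale) auto
      fix P T \<gamma>
      assume P: "P \<subseteq> I" and T: "T \<subseteq> P" and \<gamma>: "\<And>x. x \<in> P \<Longrightarrow> c x / B \<le> \<gamma>" "0 < \<gamma>" "\<gamma> < 1"
      have PX: "P \<subseteq> X" using P I(1) Y(1) by auto
      have dpos: "0 \<le> d x" if "x \<in> T" for x using I(2)[of x] that T P by auto
      have dT: "0 \<le> sum d T" "sum d T \<le> g T"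
        using dpos I(4)[of T] T P by (auto intro!: sum_nonneg)
      obtain k where k: "\<And>z. z \<in> X - P \<Longrightarrow> 0 \<le> k z" "sum k (X - P) \<le> 1"
        "\<And>S. S \<subseteq> X - P \<Longrightarrow> sum d T * (1 - sum k S) \<le> g (S \<union> T)"
      proof (rule damaged_value[OF sub nn fin, where T = T and U = "X - P" and t = "sum d T"])
        show "T \<subseteq> N" "X - P \<subseteq> N" "T \<inter> (X - P) = {}" using T PX XN by auto
      qed (use dT in auto)
      have "min ((1 - 2 * p) * (n * (W / D) * (1 - \<gamma>)))
          ((\<Sum>x\<in>T. d x / D) / (1 + (\<Sum>x\<in>T. c x / B) / (1 - \<gamma>)) * (1 - sum k Q)) \<le> \<omega> (T \<union> Q) / (\<mu> * D)"
        if Q: "Q \<subseteq> X - P" for Q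
      proof -
        let ?z = "sum d T * (1 - sum k Q)"
        \<comment> \<open>The bound is needed for every subset \<open>S\<close> of the sample.
          Elements of \<open>T\<close> in \<open>S\<close> do not change
          \<open>S \<union> T\<close>, so only \<open>S - T\<close> does damage.\<close>
        have z: "?z \<le> g (S \<union> T)" if S: "S \<subseteq> T \<union> Q" for S
        proof -
          have SQ: "S - T \<subseteq> Q" using S by auto
          have "sum k (S - T) \<le> sum k Q"
            using SQ Q finX k(1) by (intro sum_mono2) (auto intro: finite_subset)
          then have "?z \<le> sum d T * (1 - sum k (S - T))" using dT by (intro mult_left_mono) auto
          also have "\<dots> \<le> g ((S - T) \<union> T)" using SQ Q by (intro k(3)) auto
          also have "(S - T) \<union> T = S \<union> T" by auto
          finally show ?thesis .
        qed
        have "\<mu> * min ((1 - 2 * p) * (n * W * (1 - \<gamma> * B / B))) (?z / (1 + sum c T / (B - \<gamma> * B))) \<le> \<omega> (T \<union> Q)"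
        proof (rule \<omega>)
          show "T \<union> Q \<subseteq> X" using T PX Q by auto
          show "c x \<le> \<gamma> * B" if "x \<in> T" for x using \<gamma>(1)[of x] that T B by (auto simp: pos_divide_le_eq)
        qed (use \<gamma> B z in auto)
        moreover have "\<gamma> * B / B = \<gamma>" using B by simp
        moreover have "sum c T / (B - \<gamma> * B) = (\<Sum>x\<in>T. c x / B) / (1 - \<gamma>)"
        proof -
          have "B - \<gamma> * B = B * (1 - \<gamma>)" by (simp add: algebra_simps)
          then show ?thesis by (simp add: sum_divide_distrib[symmetric, of c])
        qed
        ultimately have "min ((1 - 2 * p) * (n * W * (1 - \<gamma>)))
            (?z / (1 + (\<Sum>x\<in>T. c x / B) / (1 - \<gamma>))) \<le> \<omega> (T \<union> Q) / \<mu>"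
          using \<mu> by (simp add: pos_le_divide_eq mult.commute)
        then have "min ((1 - 2 * p) * (n * W * (1 - \<gamma>)))
            (?z / (1 + (\<Sum>x\<in>T. c x / B) / (1 - \<gamma>))) / D \<le> \<omega> (T \<union> Q) / \<mu> / D"
          using D by (intro divide_right_mono) auto
        moreover have "min x y / D = min (x / D) (y / D)" for x y
          using D by (simp add: min_divide_distrib_right)
        moreover have "(1 - 2 * p) * (n * W * (1 - \<gamma>)) / D = (1 - 2 * p) * (n * (W / D) * (1 - \<gamma>))"
          by simp
        moreover have "?z / (1 + (\<Sum>x\<in>T. c x / B) / (1 - \<gamma>)) / D =
            (\<Sum>x\<in>T. d x / D) / (1 + (\<Sum>x\<in>T. c x / B) / (1 - \<gamma>)) * (1 - sum k Q)"
          by (simp add: sum_divide_distrib[symmetric, of d])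
        ultimately show ?thesis by (simp only: divide_divide_eq_left)
      qed
      then show "\<exists>k. (\<forall>z\<in>X - P. 0 \<le> k z) \<and> sum k (X - P) \<le> 1 \<and>
        (\<forall>Q\<subseteq>X - P. min ((1 - 2 * p) * (n * (W / D) * (1 - \<gamma>)))
          ((\<Sum>x\<in>T. d x / D) / (1 + (\<Sum>x\<in>T. c x / B) / (1 - \<gamma>)) * (1 - sum k Q)) \<le> \<omega> (T \<union> Q) / (\<mu> * D))"
        using k(1,2) by (intro exI[of _ k] conjI ballI allI impI)
    qed (use p finX n(1) v D in auto)
    also have "subset_mean p X (\<lambda>H. \<omega> H / (\<mu> * D)) = subset_mean p X \<omega> / (\<mu> * D)"
      using subset_mean_cmult[of p X "1 / (\<mu> * D)" \<omega>] by simp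
    finally have "2 * (v / D) + 1 \<le> 9.465 * subset_mean p X \<omega> / (\<mu> * D)" by simp
    then have "(2 * (v / D) + 1) * (\<mu> * D) \<le> 9.465 * subset_mean p X \<omega>"
      using \<mu> D by (simp add: pos_le_divide_eq)
    moreover have "(2 * (v / D) + 1) * (\<mu> * D) = \<mu> * (2 * v + D)" using D by (simp add: field_simps)
    moreover have "\<mu> * (2 * v + g Y) \<le> \<mu> * (2 * v + D)"
      using I(5) \<mu> by (intro mult_left_mono) (auto simp: D_def)
    ultimately show ?thesis by linarith
  qed
qed

section \<open>The final choice and the grid of thresholds and repetitions\<close>

lemma arg_max_on_finite:
  fixes v :: "'b \<Rightarrow> real"
  assumes "finite C" "C \<noteq> {}"
  shows "arg_max_on v C \<in> C" "\<And>A. A \<in> C \<Longrightarrow> v A \<le> v (arg_max_on v C)"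
proof -
  have "Max (v ` C) \<in> v ` C" using assms by (intro Max_in) auto
  then obtain x where "x \<in> C" "v x = Max (v ` C)" by force
  then have "is_arg_max v (\<lambda>x. x \<in> C) x" using assms(1)
    unfolding is_arg_max_linorder by (metis Max_ge finite_imageI imageI)
  then have m: "is_arg_max v (\<lambda>x. x \<in> C) (arg_max_on v C)"
    unfolding arg_max_on_def arg_max_def by (rule someI)
  then show "arg_max_on v C \<in> C" by (simp add: is_arg_max_linorder)
  show "v A \<le> v (arg_max_on v C)" if "A \<in> C" for A
    using m that unfolding is_arg_max_linorder by auto
qed

text \<open>The restricted oracle matches the final query round, whose answers are all that the
  algorithm compares.\<close>

definition best_of :: "('a set \<Rightarrow> real) \<Rightarrow> 'a set set \<Rightarrow> 'a set" where
  "best_of f C = arg_max_on (restrict f C) C"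

lemma best_of:
  assumes "finite C" "C \<noteq> {}"
  shows "best_of f C \<in> C" "\<And>A. A \<in> C \<Longrightarrow> f A \<le> f (best_of f C)"
  using arg_max_on_finite[OF assms, where v = "restrict f C"] by (auto simp: best_of_def)

definition threshold_runs ::
  "('a \<Rightarrow> real) \<Rightarrow> real \<Rightarrow> real \<Rightarrow> nat \<Rightarrow> nat \<Rightarrow> real \<Rightarrow> 'a set \<Rightarrow> ('a, 'a set) qalg list" where
  "threshold_runs c B e k m \<tau> H =
     [thresh_seq c H (\<tau> * (1 - e) ^ i) e (1 / e\<^sup>2) B. i \<leftarrow> [0..<k + 1], j \<leftarrow> [1..<m + 1]]"

lemma set_threshold_runs:
  "M \<in> set (threshold_runs c B e k m \<tau> H) \<longleftrightarrow>
    0 < m \<and> (\<exists>i\<le>k. M = thresh_seq c H (\<tau> * (1 - e) ^ i) e (1 / e\<^sup>2) B)"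
proof -
  have "M \<in> set (threshold_runs c B e k m \<tau> H) \<longleftrightarrow>
      (\<exists>i\<in>{0..<k + 1}. \<exists>j\<in>{1..<m + 1}. M = thresh_seq c H (\<tau> * (1 - e) ^ i) e (1 / e\<^sup>2) B)"
    unfolding threshold_runs_def by (simp add: image_iff del: upt_Suc)
  moreover have "(\<exists>j. j \<in> {1..<m + 1}) \<longleftrightarrow> 0 < m" by (auto intro: exI[of _ m])
  moreover have "i \<in> {0..<k + 1} \<longleftrightarrow> i \<le> k" for i by auto
  ultimately show ?thesis by blast
qed

lemma length_threshold_runs: "length (threshold_runs c B e k m \<tau> H) = (k + 1) * m"
  by (simp add: threshold_runs_def length_concat comp_def sum_list_triv del: upt_Suc)

text \<open>From \<open>1 - e \<le> exp (- e)\<close>. Used with \<open>y = n\<close> for the number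
  of thresholds and with \<open>y = 1 / e\<close> for the number of repetitions.\<close>

lemma power_ceiling_ln_le:
  fixes e y :: real
  assumes "0 < e" "e < 1" "0 < y"
  shows "(1 - e) ^ nat \<lceil>1 / e * ln y\<rceil> \<le> 1 / y"
proof -
  let ?m = "nat \<lceil>1 / e * ln y\<rceil>"
  have "1 / e * ln y \<le> real ?m" by linarith
  then have m: "ln y \<le> e * real ?m" using assms by (simp add: pos_divide_le_eq mult.commute)
  have "1 - e \<le> exp (- e)" using exp_ge_add_one_self[of "- e"] by simp
  then have "(1 - e) ^ ?m \<le> exp (- e) ^ ?m" using assms by (intro power_mono) auto
  also have "\<dots> = exp (- (e * real ?m))" by (simp flip: exp_of_nat_mult add: mult.commute)
  also have "\<dots> \<le> exp (- ln y)" using m by simp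
  also have "\<dots> = 1 / y" using assms by (simp add: exp_minus inverse_eq_divide)
  finally show ?thesis .
qed

text \<open>These are the hypotheses of \<open>sample_value\<close> on \<open>\<omega>\<close>,
  stated for \<open>ground f\<close>, which never exceeds \<open>f\<close>. In the last one,
  \<open>m\<close> independent repetitions all miss with probability at most
  \<open>(1 - e) ^ m \<le> e\<close>.\<close>

lemma threshold_runs_value:
  fixes f :: "'a set \<Rightarrow> real" and c :: "'a \<Rightarrow> real" and B e \<tau> :: real and k m :: nat and P S :: "'a set"
  defines "\<omega> \<equiv> \<lambda>H. measure_pmf.expectation (result (par (threshold_runs c B e k m \<tau> H)) f)
    (\<lambda>Ss. f (best_of f (insert P (insert S (set Ss)))))"
  assumes nn: "nonneg_on N f" and P: "P \<subseteq> N" and m: "0 < m" "(1 - e) ^ m \<le> e" and e: "0 < e" "e < 1"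
  shows "f S \<le> \<omega> H" "f P \<le> \<omega> H"
    "\<And>i. i \<le> k \<Longrightarrow> measure_pmf.expectation
      (result (thresh_seq c H (\<tau> * (1 - e) ^ i) e (1 / e\<^sup>2) B) (ground f)) (ground f) \<le> \<omega> H"
    "\<And>i \<theta>. i \<le> k \<Longrightarrow> 0 \<le> \<theta> \<Longrightarrow> e \<le> measure_pmf.prob
      (result (thresh_seq c H (\<tau> * (1 - e) ^ i) e (1 / e\<^sup>2) B) (ground f)) {y. \<theta> \<le> ground f y} \<Longrightarrow>
      (1 - e) * \<theta> \<le> \<omega> H"
proof -
  let ?ms = "threshold_runs c B e k m \<tau> H"
  let ?M = "\<lambda>i. thresh_seq c H (\<tau> * (1 - e) ^ i) e (1 / e\<^sup>2) B"
  have eq: "result (?M i) f = result (?M i) (ground f)" for i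
    unfolding result_def by (subst thresh_seq_ground) (rule refl)
  have fin: "finite (set_pmf (result M f))" if "M \<in> set ?ms" for M
    using that finite_result_thresh_seq by (auto simp: set_threshold_runs)
  note finp = finite_result_par[of ?ms f, OF fin]
  have best: "f A \<le> f (best_of f (insert P (insert S (set Ss))))"
    if "A \<in> insert P (insert S (set Ss))" for A Ss
    using that by (intro best_of(2)) auto
  show "f S \<le> \<omega> H" unfolding \<omega>_def using finp best by (intro expectation_ge_const) auto
  show "f P \<le> \<omega> H" unfolding \<omega>_def using finp best by (intro expectation_ge_const) auto
  have g: "ground f x \<le> f (best_of f (insert P (insert S (set Ss))))" if "x \<in> set Ss" for x Ss
    using ground_le[OF nn, of x] best[of x Ss] that by auto
  show "measure_pmf.expectation (result (?M i) (ground f)) (ground f) \<le> \<omega> H" if "i \<le> k" for i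
    unfolding \<omega>_def eq[symmetric]
    using that m(1) g fin by (intro par_expectation_ge) (auto simp: set_threshold_runs)
  fix i \<theta> assume i: "i \<le> k" and \<theta>: "0 \<le> \<theta>"
    and pr: "e \<le> measure_pmf.prob (result (?M i) (ground f)) {y. \<theta> \<le> ground f y}"
  let ?miss = "\<lambda>M. measure_pmf.prob (result M f) {x. ground f x < \<theta>}"
  have "prod_list (map ?miss ?ms) \<le> ?miss (?M i) ^ length [1..<m + 1]"
    unfolding threshold_runs_def using i by (intro prod_list_replicates_le) auto
  also have "\<dots> = ?miss (?M i) ^ m" by (simp del: upt_Suc)
  also have "?miss (?M i) = 1 - measure_pmf.prob (result (?M i) f) {y. \<theta> \<le> ground f y}"
  proof -
    have "{x. ground f x < \<theta>} = space (measure_pmf (result (?M i) f)) - {y. \<theta> \<le> ground f y}" by auto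
    then show ?thesis by (simp only: measure_pmf.prob_compl sets_measure_pmf UNIV_I)
  qed
  also have "\<dots> ^ m \<le> (1 - e) ^ m" using pr eq[of i] by (intro power_mono) auto
  also have "\<dots> \<le> e" by fact
  finally have "(1 - e) * \<theta> \<le> \<theta> * (1 - prod_list (map ?miss ?ms))"
    using \<theta> by (subst mult.commute) (intro mult_left_mono, auto)
  also have "\<dots> \<le> \<omega> H" unfolding \<omega>_def
  proof (rule par_hit)
    show "0 \<le> f (best_of f (insert P (insert S (set xs))))" for xs
      using best[of P xs] nn P by (auto simp: nonneg_on_def intro: order_trans)
    show "\<theta> \<le> f (best_of f (insert P (insert S (set xs))))" if "x \<in> set xs" "\<theta> \<le> ground f x" for xs x
      using g[OF that(1)] that(2) by linarith
  qed (use fin \<theta> in auto)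
  finally show "(1 - e) * \<theta> \<le> \<omega> H" .
qed

text \<open>To first order the power of \<open>1 - e\<close> costs \<open>4 * 9.465 * e\<close> and
  the factor on the left \<open>9.465 / 2 * e\<close>, well below \<open>125 * e\<close>; the bound
  \<open>1 / 375\<close>, which is \<open>\<epsilon> < 1 / 3\<close> divided by 125, controls the
  quadratic term.\<close>

lemma approximation_constants:
  fixes e :: real
  assumes e: "0 < e" "e \<le> 1 / 375"
  shows "9.465 * (1 + e / 2) \<le> (9.465 + 125 * e) * (1 - e) ^ 4"
proof -
  have "1 - 4 * e \<le> (1 - e) ^ 4" using Bernoulli_inequality[of "- e" 4] e by simp
  then have 1: "(9.465 + 125 * e) * (1 - 4 * e) \<le> (9.465 + 125 * e) * (1 - e) ^ 4"
    using e by (intro mult_left_mono) auto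
  have "e * e \<le> e * (1 / 375)" using e by (intro mult_left_mono) auto
  then have "9.465 * (1 + e / 2) \<le> 9.465 + (125 - 4 * 9.465) * e - 500 * (e * e)"
    using e by (simp add: field_simps)
  also have "9.465 + (125 - 4 * 9.465) * e - 500 * (e * e) = (9.465 + 125 * e) * (1 - 4 * e)"
    by (simp add: field_simps)
  also note 1
  finally show ?thesis .
qed

lemma cheap_cost_le:
  fixes B :: real
  assumes "finite N" "0 < B" and S: "S \<subseteq> {x \<in> N. c x < B / real (card N)}"
  shows "sum c S \<le> B"
proof -
  from S have SN: "S \<subseteq> N" by auto
  have "sum c S \<le> real (card S) * (B / real (card N))"
    using S by (intro sum_bounded_above) (auto intro: less_imp_le)
  also have "\<dots> \<le> real (card N) * (B / real (card N))"
    using card_mono[OF assms(1) SN] assms(2) by (intro mult_right_mono) auto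
  also have "\<dots> \<le> B" using assms(2) by (cases "card N = 0") auto
  finally show ?thesis .
qed

lemma par_knapsack_approximation:
  fixes sm :: "'a set \<Rightarrow> real \<Rightarrow> ('a, 'a set) qalg"
  assumes p: "0.36602 \<le> p" "p \<le> 0.36603" "2 * p\<^sup>2 = 1 - 2 * p"
    and \<epsilon>: "0 < \<epsilon>" "\<epsilon> < 1 / 3" and inst: "knapsack_instance N f c B"
    and out: "\<And>X. X \<subseteq> N \<Longrightarrow> output_set (sm X (\<epsilon> / 125)) f \<subseteq> Pow X"
    and val: "\<And>X. X \<subseteq> N \<Longrightarrow> Max (f ` Pow X) \<le> (2 + \<epsilon> / 125) * expected_value (sm X (\<epsilon> / 125)) f"
  shows "approximation_algorithm (9.465 + \<epsilon>) (par_knapsack sm c N \<epsilon> (1 - 2 * p) p B) N f c B"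
proof -
  define n where "n = real (card N)"
  define Nm where "Nm = {x \<in> N. c x < B / n}"
  define X where "X = N - Nm"
  define e where "e = \<epsilon> / 125"
  define k where "k = nat \<lceil>1 / e * ln n\<rceil>"
  define m where "m = nat \<lceil>1 / e * ln (1 / e)\<rceil>"
  define g where "g = ground f"
  define xs where "xs = arg_max_on (\<lambda>x. restrict f ((\<lambda>x. {x}) ` X) {x}) X"
  define \<tau> where "\<tau> = (1 - 2 * p) * n * f {xs} / B"
  define R where "R = result (sm Nm e) f"
  define PK where "PK = par_knapsack sm c N \<epsilon> (1 - 2 * p) p B"
  have fin: "finite N" and nn: "nonneg_on N f" and sub: "submodular_on N f" and B: "0 < B"
    and c0: "\<And>x. x \<in> N \<Longrightarrow> 0 < c x" and cB: "\<And>x. x \<in> N \<Longrightarrow> c x \<le> B"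
    using inst by (auto simp: knapsack_instance_def)
  have NmN: "Nm \<subseteq> N" and XN: "X \<subseteq> N" and dec: "N = Nm \<union> X" by (auto simp: Nm_def X_def)
  have e: "0 < e" "e \<le> 1 / 375" "e < 1" "\<epsilon> = 125 * e" using \<epsilon> by (auto simp: e_def)
  have f0: "0 \<le> f S" if "S \<subseteq> N" for S using nn that by (auto simp: nonneg_on_def)
  have setR: "set_pmf R \<subseteq> Pow Nm" using out[OF NmN] by (simp add: R_def set_result e_def)
  have finR: "finite (set_pmf R)" using setR NmN fin by (meson finite_Pow_iff finite_subset)
  have ER: "Max (f ` Pow Nm) \<le> (2 + e) * measure_pmf.expectation R f"
    using val[OF NmN] by (simp add: R_def expected_value_result e_def)
  have ER0: "0 \<le> measure_pmf.expectation R f"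
    using setR NmN f0 by (intro integral_nonneg_AE) (auto simp: AE_measure_pmf_iff)
  have feasR: "S \<in> feasible_sets N c B" if "S \<in> set_pmf R" for S
    using that setR NmN cheap_cost_le[OF fin B, of S c] by (auto simp: feasible_sets_def Nm_def n_def)
  have finF: "finite (feasible_sets N c B)" using fin by (auto simp: feasible_sets_def)
  have "{} \<in> feasible_sets N c B" using B by (simp add: feasible_sets_def)
  then have "OPT N f c B \<in> f ` feasible_sets N c B"
    unfolding OPT_def using finF by (intro Max_in) auto
  then obtain Z where Z: "Z \<subseteq> N" "sum c Z \<le> B" "OPT N f c B = f Z" by (auto simp: feasible_sets_def)
  have Vm: "f T \<le> (2 + e) * measure_pmf.expectation R f" if "T \<subseteq> Nm" for T
  proof -
    have "f T \<le> Max (f ` Pow Nm)" using that NmN fin by (intro Max_ge) (auto intro: finite_subset)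
    then show ?thesis using ER by linarith
  qed
  show ?thesis
  proof (cases "X = {}")
    case True
    have res: "result PK f = R"
      using True unfolding PK_def par_knapsack_def Let_def R_def X_def Nm_def n_def e_def
      by (simp add: bind_return_pmf')
    have "f Z \<le> (2 + e) * measure_pmf.expectation R f" using Z True dec by (intro Vm) auto
    also have "\<dots> \<le> (9.465 + \<epsilon>) * measure_pmf.expectation R f"
      using e ER0 by (intro mult_right_mono) auto
    finally have "OPT N f c B \<le> (9.465 + \<epsilon>) * measure_pmf.expectation R f" using Z(3) by simp
    then show ?thesis unfolding PK_def[symmetric] approximation_algorithm_def
      using feasR by (auto simp: expected_value_result res set_result[symmetric])
  next
    case False
    have finX: "finite X" using XN fin finite_subset by auto
    have n0: "0 < n" using False XN fin by (auto simp: n_def card_gt_0_iff)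
    have xsX: "xs \<in> X" unfolding xs_def by (rule arg_max_on_finite(1)[OF finX False])
    have xsmax: "f {x} \<le> f {xs}" if "x \<in> X" for x
      using arg_max_on_finite(2)[OF finX False that, of "\<lambda>x. restrict f ((\<lambda>x. {x}) ` X) {x}"]
        that xsX unfolding xs_def[symmetric] by simp
    have W0: "0 \<le> f {xs}" using xsX XN f0 by auto
    let ?runs = "threshold_runs c B e k m \<tau>"
    let ?best = "\<lambda>S Ss. best_of f (insert {xs} (insert S (set Ss)))"
    have res: "result PK f = bind_pmf R (\<lambda>S. bind_pmf (random_subset p X) (\<lambda>H.
        map_pmf (?best S) (result (par (?runs H)) f)))"
    proof -
      have 1: "restrict f ((\<lambda>x. {x}) ` X) {xs} = f {xs}" using xsX by simp
      show ?thesis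
        unfolding PK_def par_knapsack_def Let_def n_def[symmetric]
        unfolding Nm_def[symmetric] X_def[symmetric] e_def[symmetric] k_def[symmetric] m_def[symmetric]
        by (simp only: False if_False result_qbind result_ask result_draw result_qreturn bind_return_pmf
            xs_def[symmetric] 1 \<tau>_def[symmetric] best_of_def threshold_runs_def map_pmf_def R_def)
    qed
    have finpar: "finite (set_pmf (result (par (?runs H)) f))" for H
      by (intro finite_result_par) (auto simp: set_threshold_runs finite_result_thresh_seq)
    have gnn: "nonneg_on N g" and gsub: "submodular_on N g" and g0: "g {} = 0"
      using nonneg_ground[OF nn] submodular_ground[OF nn sub] by (auto simp: g_def)
    have p1: "0 \<le> 1 - 2 * p" "1 - 2 * p \<le> 1" using p by auto
    have \<tau>0: "0 \<le> \<tau>" using p1 n0 W0 B by (simp add: \<tau>_def)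
    have m: "0 < m" "(1 - e) ^ m \<le> e"
    proof -
      show "(1 - e) ^ m \<le> e" using power_ceiling_ln_le[of e "1 / e"] e by (simp add: m_def)
      then show "0 < m" using e by (cases m) auto
    qed
    have k: "(1 - e) ^ k \<le> 1 / n" using power_ceiling_ln_le[of e n] e n0 by (simp add: k_def)
    have feas: "y \<in> feasible_sets N c B"
      if "M \<in> set (?runs H)" "y \<in> set_pmf (result M f)" "H \<subseteq> X" for M y H
    proof -
      from that(1) obtain i where M: "M = thresh_seq c H (\<tau> * (1 - e) ^ i) e (1 / e\<^sup>2) B"
        by (auto simp: set_threshold_runs)
      have ts: "threshold_setting N g c (\<tau> * (1 - e) ^ i) e"
        using fin gnn gsub c0 e \<tau>0 by unfold_locales auto
      from that(2) obtain r q where "(y, r, q) \<in> set_pmf (thresh_seq c H (\<tau> * (1 - e) ^ i) e (1 / e\<^sup>2) B g)"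
        unfolding M g_def by (subst (asm) result_def, subst (asm) thresh_seq_ground) auto
      from threshold_setting.thresh_seq_outcome(1,2)[OF ts _ _ _ _ this]
      have "y \<subseteq> H" "sum c y \<le> B" using that(3) XN g0 B cB by auto
      then show ?thesis using that(3) XN by (auto simp: feasible_sets_def)
    qed
    have "set_pmf (result PK f) \<subseteq> feasible_sets N c B"
    proof
      fix y assume "y \<in> set_pmf (result PK f)"
      then obtain S H Ss where S: "S \<in> set_pmf R" and H: "H \<in> set_pmf (random_subset p X)"
        and Ss: "Ss \<in> set_pmf (result (par (?runs H)) f)" and y: "y = ?best S Ss"
        unfolding res by auto
      have HX: "H \<subseteq> X" using H set_random_subset by blast
      have "y \<in> insert {xs} (insert S (set Ss))" unfolding y by (intro best_of(1)) auto
      moreover have "{xs} \<in> feasible_sets N c B" using xsX XN cB by (auto simp: feasible_sets_def)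
      moreover have "A \<in> feasible_sets N c B" if "A \<in> set Ss" for A
        using set_par_result[OF Ss that] feas HX by auto
      ultimately show "y \<in> feasible_sets N c B" using feasR[OF S] by auto
    qed
    define Y where "Y = Z \<inter> X"
    define \<mu> where "\<mu> = (1 - e) ^ 4"
    define \<omega> where "\<omega> = (\<lambda>S H. measure_pmf.expectation (result (par (?runs H)) f) (\<lambda>Ss. f (?best S Ss)))"
    have \<mu>: "0 < \<mu>" "\<mu> \<le> 1" using e by (auto simp: \<mu>_def intro: power_le_one)
    have avg: "\<mu> * (2 * f S + g Y) \<le> 9.465 * subset_mean p X (\<omega> S)" if S: "S \<in> set_pmf R" for S
    proof (rule subset_average[OF p fin gnn gsub g0 B XN n0, where c = c and W = "f {xs}"])
      have xsN: "{xs} \<subseteq> N" using xsX XN by auto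
      note v = threshold_runs_value[OF nn xsN m e(1,3), where c = c and B = B and k = k and \<tau> = \<tau> and S = S,
          folded \<omega>_def g_def]
      show "f S \<le> \<omega> S H" "f {xs} \<le> \<omega> S H" for H unfolding \<omega>_def using v(1,2) by auto
      show "0 \<le> f S" using S setR NmN f0 by auto
      show "B \<le> n * c x" if "x \<in> X" for x
        using that n0 by (auto simp: X_def Nm_def not_less pos_divide_le_eq mult.commute)
      show "Y \<subseteq> X" by (simp add: Y_def)
      have "sum c Y \<le> sum c Z"
      proof (rule sum_mono2)
        show "0 \<le> c b" if "b \<in> Z - Y" for b using c0[of b] that Z(1) by auto
      qed (use Z(1) fin finite_subset in \<open>auto simp: Y_def\<close>)
      then show "sum c Y \<le> B" using Z(2) by linarith
      show "g {x} \<le> f {xs}" if "x \<in> X" for x using xsmax[OF that] by (simp add: g_def)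
      fix H T \<gamma> z
      assume H: "H \<subseteq> X" and T: "T \<subseteq> H" "\<And>x. x \<in> T \<Longrightarrow> c x \<le> \<gamma>" and \<gamma>: "0 \<le> \<gamma>" "\<gamma> < B"
        and z: "\<And>S. S \<subseteq> H \<Longrightarrow> z \<le> g (S \<union> T)"
      have HN: "H \<subseteq> N" "\<And>x. x \<in> H \<Longrightarrow> c x \<le> B" using H XN cB by auto
      show "\<mu> * min ((1 - 2 * p) * (n * f {xs} * (1 - \<gamma> / B))) (z / (1 + sum c T / (B - \<gamma>))) \<le> \<omega> S H"
        unfolding \<mu>_def
        by (rule sample_value[OF fin gnn gsub g0 c0 e(1,3) B HN W0 p1 n0 k _ _ _ T \<gamma>(2,1) z])
          (use v in \<open>auto simp: \<omega>_def \<tau>_def\<close>)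
    qed (use \<mu> in auto)
    \<comment> \<open>\<open>avg\<close> holds for each output \<open>S\<close> of the unconstrained
      subroutine and is linear in \<open>f S\<close>, so its randomness can be averaged
      last.\<close>
    have "measure_pmf.expectation R (\<lambda>S. \<mu> / 9.465 * (2 * f S + g Y)) \<le>
        measure_pmf.expectation (result PK f) f"
      unfolding res
    proof (rule expectation_bind_ge)
      fix S assume S: "S \<in> set_pmf R"
      show "finite (set_pmf (bind_pmf (random_subset p X) (\<lambda>H. map_pmf (?best S) (result (par (?runs H)) f))))"
        using finpar finite_random_subset[OF finX] by auto
      have "\<mu> / 9.465 * (2 * f S + g Y) \<le> subset_mean p X (\<omega> S)" using avg[OF S] by simp
      also have "\<dots> \<le> measure_pmf.expectation
          (bind_pmf (random_subset p X) (\<lambda>H. map_pmf (?best S) (result (par (?runs H)) f))) f"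
        unfolding subset_mean_def
      proof (rule expectation_bind_ge)
        show "\<omega> S H \<le> measure_pmf.expectation (map_pmf (?best S) (result (par (?runs H)) f)) f" for H
          by (simp add: \<omega>_def)
      qed (use finpar finite_random_subset[OF finX] in auto)
      finally show "\<mu> / 9.465 * (2 * f S + g Y) \<le> measure_pmf.expectation
          (bind_pmf (random_subset p X) (\<lambda>H. map_pmf (?best S) (result (par (?runs H)) f))) f" .
    qed (rule finR)
    also have "measure_pmf.expectation R (\<lambda>S. \<mu> / 9.465 * (2 * f S + g Y)) =
        \<mu> / 9.465 * (2 * measure_pmf.expectation R f + g Y)"
      using finR by (simp add: integrable_measure_pmf_finite)
    finally have E: "\<mu> / 9.465 * (2 * measure_pmf.expectation R f + g Y) \<le>
        measure_pmf.expectation (result PK f) f" .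
    have "Y \<subseteq> N" using XN by (auto simp: Y_def)
    then have gY: "0 \<le> g Y" using gnn by (simp add: nonneg_on_def)
    have "f Z \<le> f (Z \<inter> Nm) + g Y"
    \<comment> \<open>At the empty set \<open>g\<close> and \<open>f\<close> differ, so an optimum
      without expensive elements is treated separately.\<close>
    proof (cases "Y = {}")
      case True
      then have "Z = Z \<inter> Nm" using Z(1) dec by (auto simp: Y_def)
      then show ?thesis using gY by simp
    next
      case False
      have "f ((Z \<inter> Nm) \<union> Y) + f ((Z \<inter> Nm) \<inter> Y) \<le> f (Z \<inter> Nm) + f Y"
        using Z(1) by (intro submodular_union_inter[OF sub fin]) (auto simp: Y_def)
      moreover have "(Z \<inter> Nm) \<union> Y = Z" using Z(1) dec by (auto simp: Y_def)
      moreover have "0 \<le> f ((Z \<inter> Nm) \<inter> Y)" using Z(1) by (intro f0) auto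
      ultimately show ?thesis using False by (simp add: g_def)
    qed
    also have "\<dots> \<le> (2 + e) * measure_pmf.expectation R f + g Y" using Vm[of "Z \<inter> Nm"] by simp
    also have "\<dots> \<le> (1 + e / 2) * (2 * measure_pmf.expectation R f + g Y)"
      using e gY by (simp add: algebra_simps)
    also have "\<dots> \<le> ((9.465 + \<epsilon>) * (\<mu> / 9.465)) * (2 * measure_pmf.expectation R f + g Y)"
    proof (rule mult_right_mono)
      have "9.465 * (1 + e / 2) \<le> (9.465 + 125 * e) * \<mu>"
        unfolding \<mu>_def by (rule approximation_constants[OF e(1,2)])
      then show "1 + e / 2 \<le> (9.465 + \<epsilon>) * (\<mu> / 9.465)" unfolding e(4) by (simp add: field_simps)
    qed (use ER0 gY in simp)
    also have "\<dots> \<le> (9.465 + \<epsilon>) * measure_pmf.expectation (result PK f) f"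
      unfolding mult.assoc using E \<epsilon> by (intro mult_left_mono) (auto simp: mult.assoc)
    finally have "OPT N f c B \<le> (9.465 + \<epsilon>) * measure_pmf.expectation (result PK f) f" using Z(3) by simp
    with \<open>set_pmf (result PK f) \<subseteq> feasible_sets N c B\<close> show ?thesis
      unfolding PK_def[symmetric] approximation_algorithm_def
      by (auto simp: expected_value_result set_result[symmetric])
  qed
qed

section \<open>Adaptivity and query complexity\<close>

lemma outcomes_ask_bindE:
  assumes "(y, r, q) \<in> outcomes (ask Q \<bind>\<^sub>q k) f"
  obtains r' q' where "(y, r', q') \<in> outcomes (k (restrict f Q)) f" "r = 1 + r'" "q = card Q + q'"
  using assms by (rule outcomes_qbindE) (auto simp: outcomes_ask)

lemma outcomes_draw_bindE:
  assumes "(y, r, q) \<in> outcomes (draw P \<bind>\<^sub>q k) f"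
  obtains x where "x \<in> set_pmf P" "(y, r, q) \<in> outcomes (k x) f"
  using assms by (rule outcomes_qbindE) (auto simp: outcomes_draw)

text \<open>The two extra rounds query the singletons and compare the candidates. The runs share
  their rounds while their queries add up over \<open>b\<close> runs, and the final comparison asks
  for at most \<open>b + 2\<close> sets.\<close>

lemma par_knapsack_complexity:
  fixes sm :: "'a set \<Rightarrow> real \<Rightarrow> ('a, 'a set) qalg" and \<epsilon> \<alpha> K :: real
  defines "e \<equiv> \<epsilon> / 125"
  assumes \<epsilon>: "0 < \<epsilon>" "\<epsilon> < 1 / 3" and \<alpha>: "0 \<le> \<alpha>" and K: "0 < K"
    and inst: "knapsack_instance N f c B"
    and sm: "\<forall>X\<subseteq>N. \<forall>(S, r, q)\<in>outcomes (sm X e) f.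
      real r \<le> K * (1 / e * ln (1 / e)) \<and> real q \<le> K * max 1 (real (card X))"
    and N: "n = real (card N)" "1 \<le> n" and R: "R = 3 + 2 * ln n / e + 1 / e\<^sup>2"
    and runs: "k = nat \<lceil>1 / e * ln n\<rceil>" "m = nat \<lceil>1 / e * ln (1 / e)\<rceil>" "b = real ((k + 1) * m)"
    and y: "(y, r, q) \<in> outcomes (par_knapsack sm c N \<epsilon> \<alpha> p B) f"
  shows "real r \<le> K * (1 / e * ln (1 / e)) + 2 + R \<and>
    real q \<le> K * n + n + b * (n + R * (n * (n + 1)) + 1) + 2"
proof -
  define Nm where "Nm = {x \<in> N. c x < B / n}"
  define X where "X = N - Nm"
  define g where "g = ground f"
  have fin: "finite N" and nn: "nonneg_on N f" and sub: "submodular_on N f" and B: "0 < B"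
    and c0: "\<And>x. x \<in> N \<Longrightarrow> 0 < c x" and cB: "\<And>x. x \<in> N \<Longrightarrow> c x \<le> B"
    using inst by (auto simp: knapsack_instance_def)
  have e: "0 < e" "e < 1" using \<epsilon> by (auto simp: e_def)
  have R0: "0 \<le> R" using N(2) e unfolding R by simp
  have b0: "0 \<le> b" by (simp add: runs(3))
  have NmN: "Nm \<subseteq> N" and XN: "X \<subseteq> N" by (auto simp: Nm_def X_def)
  have finX: "finite X" using XN fin finite_subset by auto
  define v where "v = restrict f ((\<lambda>x. {x}) ` X)"
  define xs where "xs = arg_max_on (\<lambda>x. v {x}) X"
  define \<tau> where "\<tau> = \<alpha> * n * v {xs} / B"
  from y obtain S r1 q1 r2 q2 where S: "(S, r1, q1) \<in> outcomes (sm Nm e) f"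
    and rest: "(y, r2, q2) \<in> outcomes (if X = {} then qreturn S else ask ((\<lambda>x. {x}) ` X) \<bind>\<^sub>q (\<lambda>v.
        let x_star = arg_max_on (\<lambda>x. v {x}) X; \<tau> = \<alpha> * n * v {x_star} / B
        in draw (random_subset p X) \<bind>\<^sub>q (\<lambda>H.
          par (threshold_runs c B e k m \<tau> H) \<bind>\<^sub>q (\<lambda>Ss.
          let candidates = insert {x_star} (insert S (set Ss)) in
          ask candidates \<bind>\<^sub>q (\<lambda>w. qreturn (arg_max_on w candidates)))))) f"
    and rq: "r = r1 + r2" "q = q1 + q2"
    unfolding par_knapsack_def threshold_runs_def Let_def N(1)[symmetric]
    unfolding Nm_def[symmetric] X_def[symmetric] e_def[symmetric] runs(1,2)[symmetric]
    by (rule outcomes_qbindE)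
  have "real (card Nm) \<le> n" using NmN fin N(1) by (simp add: card_mono)
  then have "K * max 1 (real (card Nm)) \<le> K * n" using K N(2) by (intro mult_left_mono) auto
  then have 1: "real r1 \<le> K * (1 / e * ln (1 / e))" "real q1 \<le> K * n"
    using sm[rule_format, OF NmN S] by auto
  have "real r2 \<le> 2 + R \<and> real q2 \<le> n + b * (n + R * (n * (n + 1)) + 1) + 2"
  proof (cases "X = {}")
    case True
    then have "r2 = 0" "q2 = 0" using rest by (auto simp: outcomes_qreturn)
    moreover have "0 \<le> b * (n + R * (n * (n + 1)) + 1)" using b0 R0 N(2) by simp
    ultimately show ?thesis using R0 N(2) by simp
  next
    case False
    from rest obtain r3 q3 where
      3: "(y, r3, q3) \<in> outcomes (draw (random_subset p X) \<bind>\<^sub>q (\<lambda>H.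
          par (threshold_runs c B e k m \<tau> H) \<bind>\<^sub>q (\<lambda>Ss.
          let candidates = insert {xs} (insert S (set Ss)) in
          ask candidates \<bind>\<^sub>q (\<lambda>w. qreturn (arg_max_on w candidates))))) f"
      and rq2: "r2 = 1 + r3" "q2 = card ((\<lambda>x. {x}) ` X) + q3"
      unfolding Let_def \<tau>_def xs_def v_def if_not_P[OF False]
      by (rule outcomes_ask_bindE)
    from 3 obtain H where H: "H \<in> set_pmf (random_subset p X)" and
      4: "(y, r3, q3) \<in> outcomes (par (threshold_runs c B e k m \<tau> H) \<bind>\<^sub>q (\<lambda>Ss.
          let candidates = insert {xs} (insert S (set Ss)) in
          ask candidates \<bind>\<^sub>q (\<lambda>w. qreturn (arg_max_on w candidates)))) f"
      by (rule outcomes_draw_bindE)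
    from 4 obtain Ss r4 q4 r5 q5 where par: "(Ss, r4, q4) \<in> outcomes (par (threshold_runs c B e k m \<tau> H)) f"
      and fin_round: "(y, r5, q5) \<in> outcomes (let candidates = insert {xs} (insert S (set Ss)) in
          ask candidates \<bind>\<^sub>q (\<lambda>w. qreturn (arg_max_on w candidates))) f"
      and rq3: "r3 = r4 + r5" "q3 = q4 + q5"
      by (rule outcomes_qbindE)
    have rq5: "r5 = 1" "q5 = card (insert {xs} (insert S (set Ss)))"
      using fin_round unfolding Let_def by (auto elim!: outcomes_ask_bindE simp: outcomes_qreturn)
    have HX: "H \<subseteq> X" using H set_random_subset by blast
    have xsX: "xs \<in> X" unfolding xs_def by (rule arg_max_on_finite(1)[OF finX False])
    then have "v {xs} = f {xs}" by (simp add: v_def)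
    then have "0 \<le> v {xs}" using xsX XN nn by (auto simp: nonneg_on_def)
    then have \<tau>0: "0 \<le> \<tau>" using \<alpha> N(2) B by (simp add: \<tau>_def)
    have gnn: "nonneg_on N g" and gsub: "submodular_on N g" and g0: "g {} = 0"
      using nonneg_ground[OF nn] submodular_ground[OF nn sub] by (auto simp: g_def)
    have P: "length Ss = length (threshold_runs c B e k m \<tau> H) \<and> real r4 \<le> R \<and>
        real q4 \<le> real (length (threshold_runs c B e k m \<tau> H)) * (n + R * (n * (n + 1)))"
    proof (rule par_complexity[OF par R0])
      show "0 \<le> n + R * (n * (n + 1))" using N(2) R0 by simp
      fix M z r q assume M: "M \<in> set (threshold_runs c B e k m \<tau> H)" and z: "(z, r, q) \<in> outcomes M f"
      from M obtain i where i: "M = thresh_seq c H (\<tau> * (1 - e) ^ i) e (1 / e\<^sup>2) B"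
        by (auto simp: set_threshold_runs)
      have ts: "threshold_setting N g c (\<tau> * (1 - e) ^ i) e"
        using fin gnn gsub c0 e \<tau>0 by unfold_locales auto
      have z': "(z, r, q) \<in> set_pmf (thresh_seq c H (\<tau> * (1 - e) ^ i) e (1 / e\<^sup>2) B g)"
        using z unfolding i g_def outcomes_def by (subst (asm) thresh_seq_ground)
      have cl: "B / real (card N) \<le> c x" if "x \<in> H" for x
        using that HX by (auto simp: X_def Nm_def not_less N(1))
      have HB: "H \<subseteq> N" "\<And>x. x \<in> H \<Longrightarrow> c x \<le> B" using HX XN cB by auto
      have l: "0 \<le> 1 / e\<^sup>2" by simp
      from threshold_setting.thresh_seq_complexity[OF ts HB(1) g0 B HB(2) cl l z']
      have rR: "real r \<le> R" and q: "real q \<le> n + real r * (n * (n + 1))"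
        by (auto simp: R N(1))
      have "real r * (n * (n + 1)) \<le> R * (n * (n + 1))" using rR N(2) by (intro mult_right_mono) auto
      then show "real r \<le> R \<and> real q \<le> n + R * (n * (n + 1))" using rR q by linarith
    qed
    then have len: "real (length Ss) = b" by (simp add: length_threshold_runs runs(3))
    have "card (insert {xs} (insert S (set Ss))) \<le> card (set Ss) + 2"
      using card_insert_le_m1 by (simp add: card_insert_if)
    also have "card (set Ss) \<le> length Ss" by (rule card_length)
    finally have q5: "real q5 \<le> b + 2" using len rq5(2) by linarith
    have q4: "real q4 \<le> b * (n + R * (n * (n + 1)))" using P by (simp add: length_threshold_runs runs(3))
    have "card ((\<lambda>x. {x}) ` X) \<le> card N"
      using card_image_le[OF finX, of "\<lambda>x. {x}"] card_mono[OF fin XN] by linarith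
    then have "real q2 \<le> n + (b * (n + R * (n * (n + 1))) + (b + 2))"
      using q4 q5 by (simp add: rq2 rq3 N(1))
    then show ?thesis using P by (simp add: rq2 rq3 rq5(1) algebra_simps)
  qed
  then show ?thesis using 1 by (auto simp: rq)
qed

text \<open>\<open>L\<close> stands for \<open>ln n\<close>. The hypothesis on \<open>L\<close> lets
  \<open>L / e\<close> absorb the terms \<open>1 / e\<^sup>2\<close> and
  \<open>1 / e * ln (1 / e)\<close>, which do not depend on \<open>n\<close>; this is why the
  complexity bounds are stated for large \<open>n\<close>, given \<open>\<epsilon>\<close>. In
  \<open>K + 35\<close>, the runs contribute \<open>2 * 2 * 8 = 32\<close> and
  \<open>n + 2 \<le> 3 * n\<^sup>2\<close> the rest.\<close>

lemma complexity_asymptotics: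
  fixes e K n L \<Lambda> R b :: real
  assumes e: "0 < e" "e \<le> 1 / 375" and K: "0 < K" and n: "1 \<le> n"
    and \<Lambda>: "\<Lambda> = ln (1 / e)" and L: "K * \<Lambda> + 1 / e + 5 \<le> L"
    and R: "R = 3 + 2 * L / e + 1 / e\<^sup>2"
    and b: "b = real ((nat \<lceil>1 / e * L\<rceil> + 1) * nat \<lceil>1 / e * \<Lambda>\<rceil>)"
  shows "K * (1 / e * \<Lambda>) + 2 + R \<le> 3 * (L / e)"
    "K * n + n + b * (n + R * (n * (n + 1)) + 1) + 2 \<le> (K + 35) * (n\<^sup>2 / e ^ 3 * L\<^sup>2 * \<Lambda>)"
proof -
  define d where "d = 1 / e"
  have d: "375 \<le> d" using e by (simp add: d_def field_simps)
  have "exp 1 \<le> (3::real)" by (rule exp_le)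
  then have "exp 1 \<le> d" using d by linarith
  then have \<Lambda>1: "1 \<le> \<Lambda>" unfolding \<Lambda> using e by (subst ln_ge_iff) (auto simp: d_def)
  have K\<Lambda>: "0 < K * \<Lambda>" using K \<Lambda>1 by simp
  have L5: "5 \<le> L" using L K\<Lambda> d unfolding d_def by linarith
  have Rd: "R = 3 + 2 * (d * L) + d * d" by (simp add: R d_def power2_eq_square)
  have dd: "d * (K * \<Lambda> + d + 5) \<le> d * L" using L d by (intro mult_left_mono) (auto simp: d_def[symmetric])
  have dK: "0 \<le> d * (K * \<Lambda>)" using d K\<Lambda> by simp
  have sum: "d * (K * \<Lambda>) + 5 + d * d \<le> d * L" using dd d by (simp add: distrib_left)
  moreover have "K * (1 / e * \<Lambda>) = d * (K * \<Lambda>)" "L / e = d * L" by (simp_all add: d_def)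
  ultimately show "K * (1 / e * \<Lambda>) + 2 + R \<le> 3 * (L / e)"
    unfolding Rd by linarith
  have R3: "R \<le> 3 * (d * L)" using sum dK unfolding Rd by linarith
  have R0: "0 \<le> R" using d L5 unfolding Rd by simp
  have dL: "5 \<le> d * L" using mult_mono[of 1 d 5 L] d L5 by simp
  have d\<Lambda>: "1 \<le> d * \<Lambda>" using mult_mono[of 1 d 1 \<Lambda>] d \<Lambda>1 by simp
  have "real (nat \<lceil>1 / e * L\<rceil>) \<le> d * L + 1" using dL unfolding d_def by linarith
  then have k: "real (nat \<lceil>1 / e * L\<rceil> + 1) \<le> 2 * (d * L)" using dL by simp
  have "real (nat \<lceil>1 / e * \<Lambda>\<rceil>) \<le> d * \<Lambda> + 1" using d\<Lambda> unfolding d_def by linarith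
  then have m: "real (nat \<lceil>1 / e * \<Lambda>\<rceil>) \<le> 2 * (d * \<Lambda>)" using d\<Lambda> by simp
  have bb: "b \<le> (2 * (d * L)) * (2 * (d * \<Lambda>))"
    unfolding b of_nat_mult using k m dL by (intro mult_mono) auto
  have b0: "0 \<le> b" by (simp add: b)
  have n2: "n \<le> n * n" "1 \<le> n * n" using mult_mono[of 1 n 1 n] mult_left_mono[of 1 n n] n by auto
  have "R * (n * (n + 1)) \<le> (3 * (d * L)) * (2 * (n * n))"
  proof (rule mult_mono[OF R3])
    show "n * (n + 1) \<le> 2 * (n * n)" using n2(1) by (simp add: distrib_left)
  qed (use n dL in auto)
  moreover have "n * n \<le> (d * L) * (n * n)" using mult_right_mono[of 1 "d * L" "n * n"] dL n2 by simp
  ultimately have inner: "n + R * (n * (n + 1)) + 1 \<le> 8 * ((d * L) * (n * n))" using n2 by linarith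
  have "b * (n + R * (n * (n + 1)) + 1) \<le> ((2 * (d * L)) * (2 * (d * \<Lambda>))) * (8 * ((d * L) * (n * n)))"
    using bb inner b0 R0 n dL d\<Lambda> by (intro mult_mono) auto
  also have "\<dots> = 32 * (n\<^sup>2 / e ^ 3 * L\<^sup>2 * \<Lambda>)" by (simp add: d_def power2_eq_square power3_eq_cube)
  finally have A: "b * (n + R * (n * (n + 1)) + 1) \<le> 32 * (n\<^sup>2 / e ^ 3 * L\<^sup>2 * \<Lambda>)" .
  have "1 * 1 \<le> (d * L) * (d * \<Lambda>)" using dL d\<Lambda> by (intro mult_mono) auto
  then have "1 * 1 \<le> (d * L) * (d * L) * (d * \<Lambda>)"
    using mult_mono[of 1 "d * L" 1 "(d * L) * (d * \<Lambda>)"] dL by (simp add: mult.assoc)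
  then have "n * n \<le> ((d * L) * (d * L) * (d * \<Lambda>)) * (n * n)"
    using n2 mult_right_mono[of 1 "(d * L) * (d * L) * (d * \<Lambda>)" "n * n"] by simp
  also have "\<dots> = n\<^sup>2 / e ^ 3 * L\<^sup>2 * \<Lambda>" by (simp add: d_def power2_eq_square power3_eq_cube)
  finally have Q: "n * n \<le> n\<^sup>2 / e ^ 3 * L\<^sup>2 * \<Lambda>" .
  have "K * n \<le> K * (n * n)" using K n2 by (intro mult_left_mono) auto
  also have "\<dots> \<le> K * (n\<^sup>2 / e ^ 3 * L\<^sup>2 * \<Lambda>)" using K Q by (intro mult_left_mono) auto
  finally have "K * n \<le> K * (n\<^sup>2 / e ^ 3 * L\<^sup>2 * \<Lambda>)" .
  moreover have arith: "x + n + w + 2 \<le> x' + 35 * t"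
    if "x \<le> x'" "w \<le> 32 * t" "n \<le> s" "1 \<le> s" "s \<le> t" for x x' w s t :: real
    using that by linarith
  ultimately have "K * n + n + b * (n + R * (n * (n + 1)) + 1) + 2 \<le>
      K * (n\<^sup>2 / e ^ 3 * L\<^sup>2 * \<Lambda>) + 35 * (n\<^sup>2 / e ^ 3 * L\<^sup>2 * \<Lambda>)"
    using A n2 Q by (intro arith)
  then show "K * n + n + b * (n + R * (n * (n + 1)) + 1) + 2 \<le> (K + 35) * (n\<^sup>2 / e ^ 3 * L\<^sup>2 * \<Lambda>)"
    by (simp only: distrib_right)
qed

lemma sampling_probability:
  fixes p :: real
  assumes "p = (1 - (2 - sqrt 3)) / 2"
  shows "0.36602 \<le> p" "p \<le> 0.36603" "2 * p\<^sup>2 = 1 - 2 * p" "2 - sqrt 3 = 1 - 2 * p"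
proof -
  have "1.73204 \<le> sqrt 3" by (rule real_le_rsqrt) (simp add: power2_eq_square)
  then show "0.36602 \<le> p" unfolding assms by simp
  have "sqrt 3 \<le> 1.73206" by (rule real_le_lsqrt) (simp_all add: power2_eq_square)
  then show "p \<le> 0.36603" unfolding assms by simp
  have s: "sqrt 3 = 2 * p + 1" using assms by (simp add: field_simps)
  moreover have "(sqrt 3)\<^sup>2 = (3 :: real)" by simp
  ultimately have "(2 * p + 1)\<^sup>2 = 3" by metis
  then show "2 * p\<^sup>2 = 1 - 2 * p" by (simp add: power2_eq_square algebra_simps)
  show "2 - sqrt 3 = 1 - 2 * p" using s by simp
qed

theorem theorem1:
  fixes submod_max :: "'a set \<Rightarrow> real \<Rightarrow> ('a, 'a set) qalg"
    and \<alpha> p :: real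
  assumes "is_submod_max submod_max"
    and "\<alpha> = 2 - sqrt 3"
    and "p = (1 - \<alpha>) / 2"
  shows
    "(\<forall>\<epsilon> N f c B. 0 < \<epsilon> \<and> \<epsilon> < 1 / 3 \<and> knapsack_instance N f c B \<longrightarrow>
        approximation_algorithm (9.465 + \<epsilon>) (par_knapsack submod_max c N \<epsilon> \<alpha> p B) N f c B) \<and>
     (\<exists>C > 0. \<forall>\<epsilon>. 0 < \<epsilon> \<and> \<epsilon> < 1 / 3 \<longrightarrow>
        (\<forall>\<^sub>F n in sequentially. \<forall>N f c B. knapsack_instance N f c B \<and> card N = n \<longrightarrow>
          (\<forall>(S, rounds, queries) \<in> outcomes (par_knapsack submod_max c N \<epsilon> \<alpha> p B) f.
             real rounds \<le> C * (1 / \<epsilon> * ln (real n)) \<and>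
             real queries \<le>
               C * ((real n)\<^sup>2 / \<epsilon> ^ 3 * (ln (real n))\<^sup>2 * ln (1 / \<epsilon>)))))"
proof -
  obtain K where K: "0 < K" and spec: "\<And>N \<delta> f. finite N \<Longrightarrow> nonneg_on N f \<Longrightarrow> submodular_on N f \<Longrightarrow>
      0 < \<delta> \<Longrightarrow> \<delta> \<le> 1 / 2 \<Longrightarrow> output_set (submod_max N \<delta>) f \<subseteq> Pow N \<and>
       (2 + \<delta>) * expected_value (submod_max N \<delta>) f \<ge> Max (f ` Pow N) \<and>
       (\<forall>(S, r, q) \<in> outcomes (submod_max N \<delta>) f.
          real r \<le> K * (1 / \<delta> * ln (1 / \<delta>)) \<and> real q \<le> K * max 1 (real (card N)))"
    using assms(1) unfolding is_submod_max_def by auto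
  have p: "p = (1 - (2 - sqrt 3)) / 2" using assms(2,3) by simp
  note prob = sampling_probability[OF p]
  have \<alpha>: "\<alpha> = 1 - 2 * p" "0 \<le> \<alpha>" using prob assms(2) by auto
  have sub: "output_set (submod_max X (\<epsilon> / 125)) f \<subseteq> Pow X \<and>
       (2 + \<epsilon> / 125) * expected_value (submod_max X (\<epsilon> / 125)) f \<ge> Max (f ` Pow X) \<and>
       (\<forall>(S, r, q) \<in> outcomes (submod_max X (\<epsilon> / 125)) f.
          real r \<le> K * (1 / (\<epsilon> / 125) * ln (1 / (\<epsilon> / 125))) \<and> real q \<le> K * max 1 (real (card X)))"
    if "0 < \<epsilon>" "\<epsilon> < 1 / 3" "knapsack_instance N f c B" "X \<subseteq> N" for \<epsilon> N f c B X
    using that unfolding knapsack_instance_def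
    by (intro spec) (auto intro: finite_subset nonneg_on_subset submodular_on_subset)
  \<comment> \<open>\<open>125 ^ 3\<close> turns \<open>1 / e ^ 3\<close> into
    \<open>1 / \<epsilon> ^ 3\<close>, and the 6 turns \<open>ln (1 / e)\<close> into
    \<open>ln (1 / \<epsilon>)\<close>; the rounds need only \<open>3 * 125 = 375\<close>.\<close>
  define C where "C = (K + 35) * (6 * 125 ^ 3)"
  have C: "0 < C" "375 \<le> C" using K by (auto simp: C_def)
  show ?thesis
  proof (intro conjI exI[of _ C] allI impI; (elim conjE)?)
    fix \<epsilon> :: real and N :: "'a set" and f c B
    assume \<epsilon>: "0 < \<epsilon>" "\<epsilon> < 1 / 3" and inst: "knapsack_instance N f c B"
    show "approximation_algorithm (9.465 + \<epsilon>) (par_knapsack submod_max c N \<epsilon> \<alpha> p B) N f c B"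
      unfolding \<alpha>(1) using sub[OF \<epsilon> inst]
      by (intro par_knapsack_approximation[OF prob(1-3) \<epsilon> inst]) blast+
  next
    fix \<epsilon> :: real
    assume \<epsilon>: "0 < \<epsilon>" "\<epsilon> < 1 / 3"
    define e where "e = \<epsilon> / 125"
    define \<Lambda> where "\<Lambda> = ln (1 / e)"
    have e: "0 < e" "e \<le> 1 / 375" using \<epsilon> by (auto simp: e_def)
    \<comment> \<open>Since \<open>125 \<le> 3 ^ 5\<close> and
      \<open>3 \<le> 1 / \<epsilon>\<close>, \<open>ln 125\<close> is at most five times
      \<open>ln (1 / \<epsilon>)\<close>.\<close>
    have \<Lambda>6: "\<Lambda> \<le> 6 * ln (1 / \<epsilon>)"
    proof -
      have "1 / e = 125 * (1 / \<epsilon>)" using \<epsilon> by (simp add: e_def)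
      then have "\<Lambda> = ln 125 + ln (1 / \<epsilon>)" unfolding \<Lambda>_def using \<epsilon> by (simp add: ln_mult del: times_divide_eq_right)
      also have "ln (125 :: real) \<le> ln (3 ^ 5)" by (subst ln_le_cancel_iff) auto
      also have "ln ((3 :: real) ^ 5) = 5 * ln 3" by (subst ln_realpow) auto
      also have "ln 3 \<le> ln (1 / \<epsilon>)" using \<epsilon> by (subst ln_le_cancel_iff) (auto simp: field_simps)
      finally show ?thesis by simp
    qed
    have "filterlim (\<lambda>n. ln (real n)) at_top sequentially"
      by (rule filterlim_compose[OF ln_at_top filterlim_real_sequentially])
    \<comment> \<open>How large \<open>n\<close> must be depends on \<open>\<epsilon>\<close>
      through \<open>\<Lambda>\<close> and \<open>1 / e\<close>, whereas \<open>C\<close> depends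
      only on the subroutine.\<close>
    then have "\<forall>\<^sub>F n in sequentially. K * \<Lambda> + 1 / e + 5 \<le> ln (real n)"
      by (simp add: filterlim_at_top)
    then show "\<forall>\<^sub>F n in sequentially. \<forall>N f c B. knapsack_instance N f c B \<and> card N = n \<longrightarrow>
          (\<forall>(S, rounds, queries) \<in> outcomes (par_knapsack submod_max c N \<epsilon> \<alpha> p B) f.
             real rounds \<le> C * (1 / \<epsilon> * ln (real n)) \<and>
             real queries \<le> C * ((real n)\<^sup>2 / \<epsilon> ^ 3 * (ln (real n))\<^sup>2 * ln (1 / \<epsilon>)))"
      using eventually_ge_at_top[of 1]
    proof eventually_elim
      case (elim n)
      let ?n = "real n"
      have n1: "1 \<le> ?n" using elim(2) by simp
      have L0: "0 \<le> ln ?n" using n1 by simp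
      note asym = complexity_asymptotics[OF e K n1 \<Lambda>_def elim(1) refl refl]
      have main: "real r \<le> C * (1 / \<epsilon> * ln ?n) \<and> real q \<le> C * (?n\<^sup>2 / \<epsilon> ^ 3 * (ln ?n)\<^sup>2 * ln (1 / \<epsilon>))"
        if inst: "knapsack_instance N f c B" and N: "card N = n"
          and y: "(y, r, q) \<in> outcomes (par_knapsack submod_max c N \<epsilon> \<alpha> p B) f" for N f c B y r q
      proof -
        have sm: "\<forall>X\<subseteq>N. \<forall>(S, r, q)\<in>outcomes (submod_max X (\<epsilon> / 125)) f.
            real r \<le> K * (1 / (\<epsilon> / 125) * ln (1 / (\<epsilon> / 125))) \<and> real q \<le> K * max 1 (real (card X))"
          using sub[OF \<epsilon> inst] by blast
        have nN: "?n = real (card N)" using N by simp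
        note cx = par_knapsack_complexity[OF \<epsilon> \<alpha>(2) K inst sm nN n1 refl refl refl refl y, folded e_def, folded \<Lambda>_def]
        have "real r \<le> 3 * (ln ?n / e)" by (rule order_trans[OF conjunct1[OF cx] asym(1)])
        also have "\<dots> = 375 * (1 / \<epsilon> * ln ?n)" by (simp add: e_def)
        also have "\<dots> \<le> C * (1 / \<epsilon> * ln ?n)" using C(2) \<epsilon> L0 by (intro mult_right_mono) auto
        finally have r: "real r \<le> C * (1 / \<epsilon> * ln ?n)" .
        have "real q \<le> (K + 35) * (?n\<^sup>2 / e ^ 3 * (ln ?n)\<^sup>2 * \<Lambda>)"
          by (rule order_trans[OF conjunct2[OF cx] asym(2)])
        also have "\<dots> \<le> (K + 35) * (?n\<^sup>2 / e ^ 3 * (ln ?n)\<^sup>2 * (6 * ln (1 / \<epsilon>)))"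
          using K e \<Lambda>6 by (intro mult_left_mono) auto
        also have "\<dots> = C * (?n\<^sup>2 / \<epsilon> ^ 3 * (ln ?n)\<^sup>2 * ln (1 / \<epsilon>))"
          by (simp add: C_def e_def power_divide)
        finally show ?thesis using r by simp
      qed
      then show ?case by auto
    qed
  qed (use C in auto)
qed

end
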